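(* For a general sequence $(\gamma_j)$, multiplying the vector of basis functions $\Phi(z)=[\phi_0,\phi_1(z),\phi_2(z),\dots]$ by $z$ corresponds to multiplying it from the right with the infinite matrix $$(\hat{\mathcal G}+\mathcal A)(\mathcal I+\mathcal A^*\hat{\mathcal G})^{-1}=\eta_{\mathcal A}^{-1}(\mathcal G+\mathcal A)(\mathcal I+\mathcal A^*\mathcal G)^{-1}\eta_{\mathcal A},$$ i.e. $z\,\Phi(z)=\Phi(z)\,(\hat{\mathcal G}+\mathcal A)(\mathcal I+\mathcal A^*\hat{\mathcal G})^{-1}$, where $\mathcal A=\mathrm{diag}(\alpha_0,\alpha_1,\dots)$, $\eta_{\mathcal A}=\sqrt{\mathcal I-\mathcal A^*\mathcal A}$, $\hat{\mathcal G}=\eta_{\mathcal A}^{-1}\mathcal G\eta_{\mathcal A}$, and $\mathcal G$ is the ordered product of the unitary factors $G_k$ ($G_k=G_k^\alpha$ if $\gamma_k=\alpha_k$, $G_k=G_k^\beta$ if $\gamma_k=\beta_k$), the order of multiplication being from left to right in a block of successive $\alpha$-values and from right to left in a block of successive $\beta$-values (as specified in the context). For the sequence $(\gamma_j)=(\alpha_j)$ one gets the Hessenberg matrix $\mathcal G=G_1^\alpha G_2^\alpha G_3^\alpha\cdots$. For $(\gamma_j)_{j\ge1}=(\alpha_1,\beta_2,\alpha_3,\beta_4,\dots)$ one gets the CMV matrix $$\mathcal G=G_1^\alpha(G_3^\alpha G_2^\beta)(G_5^\alpha G_4^\beta)(G_7^\alpha G_6^\beta)\cdots=(G_1^\alpha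 G_3^\alpha G_5^\alpha\cdots)(G_2^\beta G_4^\beta G_6^\beta\cdots),$$ and for $(\gamma_j)_{j\ge1}=(\beta_1,\alpha_2,\beta_3,\alpha_4,\dots)$ the CMV matrix $$\mathcal G=(G_2^\alpha G_1^\beta)(G_4^\alpha G_3^\beta)(G_6^\alpha G_5^\beta)\cdots=(G_2^\alpha G_4^\alpha G_6^\alpha\cdots)(G_1^\beta G_3^\beta G_5^\beta\cdots).$$ If instead the orthonormal basis $(\varphi_n^\alpha)_{n\ge0}$, $\varphi_n^\alpha=\bigl(\prod_{j\in\mathbb b_n}\sigma_j\bigr)\phi_n$, is used, then the previous relations still hold true, except that all $G_j^\beta$ can be replaced by $G_j^\alpha$.
   Context: Notation: $\mathbb D$ is the open unit disk, $\mathbb T$ the unit circle, $f_*(z)=\overline{f(1/\overline z)}$. $(\alpha_j)_{j\ge1}$ is a sequence in $\mathbb D$, $\beta_j=1/\overline{\alpha}_j$ ($=\infty$ if $\alpha_j=0$), $\alpha_0=0$, $\beta_0=\infty$; $(\gamma_j)_{j\ge0}$ satisfies $\gamma_j\in\{\alpha_j,\beta_j\}$ for each $j$. $\mathbb a_n=\{1\le j\le n:\gamma_j=\alpha_j\}$, $\mathbb b_n=\{1\le j\le n:\gamma_j=\beta_j\}$. $\sigma_j=\overline{\alpha}_j/|\alpha_j|$ if $\alpha_j\ne0$, else $\sigma_j=1$. For $\nu\in\{\alpha,\beta\}$: $\varpi_j^\nu(z)=1-\overline{\nu}_jz$, $\varpi_j^{\nu*}(z)=z-\nu_j$ (if $\nu_j=\infty$: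 $-z$ and $-1$ respectively), $\zeta_j^\nu=\sigma_j\varpi_j^{\nu*}/\varpi_j^\nu$. $B_n^\alpha=\prod_{j=1}^n\zeta_j^\alpha$, $\dot B_n^\alpha=\prod_{j\in\mathbb a_n}\zeta_j^\alpha$, $\dot B_n^\beta=\prod_{j\in\mathbb b_n}\zeta_j^\beta$; $B_0=1$, $B_n=\dot B_n^\alpha$ if $\gamma_n=\alpha_n$, $B_n=\dot B_n^\beta$ if $\gamma_n=\beta_n$. $\mathcal L_n^\alpha=\mathrm{span}\{B_0^\alpha,\dots,B_n^\alpha\}$, $\mathcal L_n=\mathrm{span}\{B_0,\dots,B_n\}$. $\mu$ is a probability measure positive a.e. on $\mathbb T$, $\langle f,g\rangle=\int_{\mathbb T}\overline fg\,d\mu$. $\phi_0^\alpha=\phi_0=1$; $\phi_n^\alpha\in\mathcal L_n^\alpha$ is orthogonal to $\mathcal L_{n-1}^\alpha$ with norm $1$ and normalized by $\phi_n^{\alpha*}(\alpha_n)>0$, where $\phi_n^{\alpha*}=B_n^\alpha(\phi_n^\alpha)_*$; $\phi_n\in\mathcal L_n$ is orthogonal to $\mathcal L_{n-1}$ with norm $1$ and normalized by $(\phi_n^*/\dot B_n^\beta)(\alpha_n)>0$ if $\gamma_n=\alpha_n$, $(\phi_n^*/\dot B_n^\alpha)(\beta_n)>0$ if $\gamma_n=\beta_n$, where $\phi_n^*=\dot B_n^\alpha\dot B_n^\beta(\phi_n)_*$. The functions $\phi_n^\alpha$ satisfy, for $n\ge1$ and unique $\lambda_n^\alpha\in\mathbb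 D$, $\eta_{n1}^\alpha\in\mathbb T$, the recurrence $$\phi_n^\alpha=e_n^\alpha\eta_{n1}^\alpha\frac{\varpi_{n-1}^\alpha}{\varpi_n^\alpha}\bigl[\zeta_{n-1}^\alpha\phi_{n-1}^\alpha+\lambda_n^\alpha\phi_{n-1}^{\alpha*}\bigr],\qquad e_n^\alpha=\sqrt{\frac{1-|\alpha_n|^2}{1-|\alpha_{n-1}|^2}\,\frac1{1-|\lambda_n^\alpha|^2}}>0 .$$ Define the $2\times2$ unitary matrices $$\tilde G_n^\alpha=\overline{\sigma}_{n-1}\overline{\eta_{n1}^\alpha}\begin{bmatrix}-\lambda_n^\alpha\eta_{n1}^\alpha&\sqrt{1-|\lambda_n^\alpha|^2}\\ \sqrt{1-|\lambda_n^\alpha|^2}&\overline{\lambda_n^\alpha}\,\overline{\eta_{n1}^\alpha}\end{bmatrix}\begin{bmatrix}1&0\\0&\sigma_n\end{bmatrix},\qquad \tilde G_n^\beta=\begin{bmatrix}\overline{\sigma}_n&0\\0&1\end{bmatrix}\tilde G_n^\alpha\begin{bmatrix}\sigma_n&0\\0&1\end{bmatrix},$$ and the infinite matrices $G_n^\nu=\mathrm{diag}(I_{n-1},\tilde G_n^\nu,I_\infty)$, $\nu\in\{\alpha,\beta\}$ (rows and columns indexed by $0,1,2,\dots$; $\tilde G_n^\nu$ acts on the indices $n-1,n$). Note that $G_i$ and $G_j$ commute when $|i-j|>1$. Order of the product $\mathcal G$. If, for $1\le n<k<m<\ell<\dots\le\infty$, $\gamma_1,\dots,\gamma_{n-1}$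 are $\alpha$'s, $\gamma_n,\dots,\gamma_{k-1}$ are $\beta$'s, $\gamma_k,\dots,\gamma_{m-1}$ are $\alpha$'s, $\gamma_m,\dots,\gamma_{\ell-1}$ are $\beta$'s, and so on, then $$\mathcal G=(G_1^\alpha G_2^\alpha\cdots G_{n-1}^\alpha)(G_k^\alpha G_{k-1}^\beta\cdots G_n^\beta)(G_{k+1}^\alpha\cdots G_{m-1}^\alpha)(G_\ell^\alpha G_{\ell-1}^\beta\cdots G_m^\beta)(G_{\ell+1}^\alpha\cdots)\cdots$$ (empty groups are the identity). In other words $G_{j+1}$ stands to the right of $G_j$ if $\gamma_j=\alpha_j$ and to the left of $G_j$ if $\gamma_j=\beta_j$. The matrix $\mathcal I+\mathcal A^*\hat{\mathcal G}$ is taken to be invertible; $\mathcal A^*$ is the conjugate transpose.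
   Formalization: If only finitely many γ_j equal α_j, the product 𝒢 is also required to converge strongly (columns in ℓ²); otherwise the claim fails (arc length, α_j=0, γ_j=∞). Invertibility is meant on ℓ², and zΦ=ΦU in L²(μ). *)

theory Defs
  imports "HOL-Analysis.Analysis" "HOL-Probability.Probability_Measure"
begin

datatype riemann = Fin complex | Infty

definition beta :: "(nat \<Rightarrow> complex) \<Rightarrow> nat \<Rightarrow> riemann" where
  "beta \<alpha> j = (if \<alpha> j = 0 then Infty else Fin (1 / cnj (\<alpha> j)))"

definition sg :: "(nat \<Rightarrow> complex) \<Rightarrow> nat \<Rightarrow> complex" where
  "sg \<alpha> j = (if \<alpha> j = 0 then 1 else cnj (\<alpha> j) / of_real (cmod (\<alpha> j)))"

fun varpi :: "riemann \<Rightarrow> complex \<Rightarrow> complex" where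
  "varpi (Fin \<nu>) z = 1 - cnj \<nu> * z"
| "varpi Infty z = - z"

fun varpi_star :: "riemann \<Rightarrow> complex \<Rightarrow> complex" where
  "varpi_star (Fin \<nu>) z = z - \<nu>"
| "varpi_star Infty z = - 1"

definition zeta_a :: "(nat \<Rightarrow> complex) \<Rightarrow> nat \<Rightarrow> complex \<Rightarrow> complex" where
  "zeta_a \<alpha> j z = sg \<alpha> j * varpi_star (Fin (\<alpha> j)) z / varpi (Fin (\<alpha> j)) z"

definition zeta_b :: "(nat \<Rightarrow> complex) \<Rightarrow> nat \<Rightarrow> complex \<Rightarrow> complex" where
  "zeta_b \<alpha> j z = sg \<alpha> j * varpi_star (beta \<alpha> j) z / varpi (beta \<alpha> j) z"

definition idx_a :: "(nat \<Rightarrow> complex) \<Rightarrow> (nat \<Rightarrow> riemann) \<Rightarrow> nat \<Rightarrow> nat set" where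
  "idx_a \<alpha> \<gamma> n = {j. 1 \<le> j \<and> j \<le> n \<and> \<gamma> j = Fin (\<alpha> j)}"

definition idx_b :: "(nat \<Rightarrow> complex) \<Rightarrow> (nat \<Rightarrow> riemann) \<Rightarrow> nat \<Rightarrow> nat set" where
  "idx_b \<alpha> \<gamma> n = {j. 1 \<le> j \<and> j \<le> n \<and> \<gamma> j = beta \<alpha> j}"

text \<open>
  \<open>Ba\<close>, \<open>dBa\<close>, \<open>dBb\<close> and \<open>Bg\<close> are \<open>B\<^sub>n\<^sup>\<alpha>\<close>, the dotted products over \<open>idx_a\<close> and \<open>idx_b\<close>,
  and \<open>B\<^sub>n\<close>.  All rational functions below are HOL functions with a meaningless value at their
  finitely many poles.
\<close>

definition Ba :: "(nat \<Rightarrow> complex) \<Rightarrow> nat \<Rightarrow> complex \<Rightarrow> complex" where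
  "Ba \<alpha> n z = (\<Prod>j=1..n. zeta_a \<alpha> j z)"

definition dBa :: "(nat \<Rightarrow> complex) \<Rightarrow> (nat \<Rightarrow> riemann) \<Rightarrow> nat \<Rightarrow> complex \<Rightarrow> complex" where
  "dBa \<alpha> \<gamma> n z = (\<Prod>j\<in>idx_a \<alpha> \<gamma> n. zeta_a \<alpha> j z)"

definition dBb :: "(nat \<Rightarrow> complex) \<Rightarrow> (nat \<Rightarrow> riemann) \<Rightarrow> nat \<Rightarrow> complex \<Rightarrow> complex" where
  "dBb \<alpha> \<gamma> n z = (\<Prod>j\<in>idx_b \<alpha> \<gamma> n. zeta_b \<alpha> j z)"

definition Bg :: "(nat \<Rightarrow> complex) \<Rightarrow> (nat \<Rightarrow> riemann) \<Rightarrow> nat \<Rightarrow> complex \<Rightarrow> complex" where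
  "Bg \<alpha> \<gamma> n z =
     (if n = 0 then 1 else if \<gamma> n = Fin (\<alpha> n) then dBa \<alpha> \<gamma> n z else dBb \<alpha> \<gamma> n z)"

definition fspan :: "(nat \<Rightarrow> complex \<Rightarrow> complex) \<Rightarrow> nat \<Rightarrow> (complex \<Rightarrow> complex) set" where
  "fspan B n = {f. \<exists>c. \<forall>z. f z = (\<Sum>k\<le>n. c k * B k z)}"

definition substar :: "(complex \<Rightarrow> complex) \<Rightarrow> complex \<Rightarrow> complex" where
  "substar f z = cnj (f (1 / cnj z))"

definition star_a :: "(nat \<Rightarrow> complex) \<Rightarrow> nat \<Rightarrow> (complex \<Rightarrow> complex) \<Rightarrow> complex \<Rightarrow> complex" where
  "star_a \<alpha> n f z = Ba \<alpha> n z * substar f z"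

definition star_g ::
    "(nat \<Rightarrow> complex) \<Rightarrow> (nat \<Rightarrow> riemann) \<Rightarrow> nat \<Rightarrow> (complex \<Rightarrow> complex) \<Rightarrow> complex \<Rightarrow> complex" where
  "star_g \<alpha> \<gamma> n f z = dBa \<alpha> \<gamma> n z * dBb \<alpha> \<gamma> n z * substar f z"

fun punctured :: "riemann \<Rightarrow> complex filter" where
  "punctured (Fin a) = at a"
| "punctured Infty = at_infinity"

text \<open>
  The value at \<^term>\<open>\<nu>\<close> of a rational function is its limit there: the expressions to
  which this is applied are products with a removable singularity at \<^term>\<open>\<nu>\<close>
  (a zero of a Blaschke factor against a pole of \<^const>\<open>substar\<close>), where
  HOL's total division would return a meaningless number.
\<close>

definition pos_at :: "(complex \<Rightarrow> complex) \<Rightarrow> riemann \<Rightarrow> bool" where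
  "pos_at f \<nu> \<longleftrightarrow> (\<exists>r::real. 0 < r \<and> (f \<longlongrightarrow> of_real r) (punctured \<nu>))"

definition arc :: "complex measure" where
  "arc = distr (uniform_measure lborel {0..2 * pi}) borel cis"

text \<open>
  ``Positive a.e.'': in the Lebesgue decomposition
  \<open>d\<mu> = w dm + d\<mu>\<^sub>s\<close> with respect to normalized arc length \<open>m\<close>, with
  \<open>\<mu>\<^sub>s\<close> carried by the null set \<open>S\<close>, one has \<open>w > 0\<close> almost everywhere.
\<close>

definition positive_ae :: "complex measure \<Rightarrow> bool" where
  "positive_ae \<mu> \<longleftrightarrow>
     (\<exists>w :: complex \<Rightarrow> ennreal. \<exists>S.
        w \<in> borel_measurable borel \<and> S \<in> sets borel \<and> emeasure arc S = 0 \<and>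
        (AE z in arc. 0 < w z) \<and>
        (\<forall>E\<in>sets borel. emeasure \<mu> (E - S) = (\<integral>\<^sup>+ z. w z * indicator E z \<partial>arc)))"

definition circle_probability :: "complex measure \<Rightarrow> bool" where
  "circle_probability \<mu> \<longleftrightarrow>
     prob_space \<mu> \<and> sets \<mu> = sets borel \<and> (AE z in \<mu>. cmod z = 1) \<and> positive_ae \<mu>"

definition ip :: "complex measure \<Rightarrow> (complex \<Rightarrow> complex) \<Rightarrow> (complex \<Rightarrow> complex) \<Rightarrow> complex" where
  "ip \<mu> f g = (LINT z|\<mu>. cnj (f z) * g z)"

definition orf_a ::
    "(nat \<Rightarrow> complex) \<Rightarrow> complex measure \<Rightarrow> (nat \<Rightarrow> complex \<Rightarrow> complex) \<Rightarrow> bool" where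
  "orf_a \<alpha> \<mu> \<phi> \<longleftrightarrow>
     \<phi> 0 = (\<lambda>z. 1) \<and>
     (\<forall>n\<ge>1. \<phi> n \<in> fspan (Ba \<alpha>) n \<and>
            (\<forall>f\<in>fspan (Ba \<alpha>) (n - 1). ip \<mu> f (\<phi> n) = 0) \<and>
            ip \<mu> (\<phi> n) (\<phi> n) = 1 \<and>
            pos_at (star_a \<alpha> n (\<phi> n)) (Fin (\<alpha> n)))"

definition orf_g ::
    "(nat \<Rightarrow> complex) \<Rightarrow> (nat \<Rightarrow> riemann) \<Rightarrow> complex measure \<Rightarrow> (nat \<Rightarrow> complex \<Rightarrow> complex) \<Rightarrow> bool" where
  "orf_g \<alpha> \<gamma> \<mu> \<phi> \<longleftrightarrow>
     \<phi> 0 = (\<lambda>z. 1) \<and>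
     (\<forall>n\<ge>1. \<phi> n \<in> fspan (Bg \<alpha> \<gamma>) n \<and>
            (\<forall>f\<in>fspan (Bg \<alpha> \<gamma>) (n - 1). ip \<mu> f (\<phi> n) = 0) \<and>
            ip \<mu> (\<phi> n) (\<phi> n) = 1 \<and>
            (\<gamma> n = Fin (\<alpha> n) \<longrightarrow>
               pos_at (\<lambda>z. star_g \<alpha> \<gamma> n (\<phi> n) z / dBb \<alpha> \<gamma> n z) (Fin (\<alpha> n))) \<and>
            (\<gamma> n = beta \<alpha> n \<longrightarrow>
               pos_at (\<lambda>z. star_g \<alpha> \<gamma> n (\<phi> n) z / dBa \<alpha> \<gamma> n z) (beta \<alpha> n)))"

text \<open>
  The recurrence is an identity of rational functions without poles on the unit circle, hence
  determined by its values there; stating it on the circle avoids evaluation at poles.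
\<close>

definition recurrence ::
    "(nat \<Rightarrow> complex) \<Rightarrow> (nat \<Rightarrow> complex \<Rightarrow> complex) \<Rightarrow> (nat \<Rightarrow> complex) \<Rightarrow> (nat \<Rightarrow> complex) \<Rightarrow> bool" where
  "recurrence \<alpha> \<phi> lam eta \<longleftrightarrow>
     (\<forall>n\<ge>1. cmod (lam n) < 1 \<and> cmod (eta n) = 1 \<and>
       (\<forall>z. cmod z = 1 \<longrightarrow>
          \<phi> n z =
            of_real (sqrt ((1 - (cmod (\<alpha> n))\<^sup>2) / (1 - (cmod (\<alpha> (n - 1)))\<^sup>2) *
                           (1 / (1 - (cmod (lam n))\<^sup>2)))) * eta n *
            (varpi (Fin (\<alpha> (n - 1))) z / varpi (Fin (\<alpha> n)) z) *
            (zeta_a \<alpha> (n - 1) z * \<phi> (n - 1) z + lam n * star_a \<alpha> (n - 1) (\<phi> (n - 1)) z)))"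

type_synonym imat = "nat \<Rightarrow> nat \<Rightarrow> complex"

definition mmult :: "imat \<Rightarrow> imat \<Rightarrow> imat" (infixl "\<odot>" 70) where
  "X \<odot> Y = (\<lambda>i k. \<Sum>\<^sub>\<infinity>j. X i j * Y j k)"

definition madd :: "imat \<Rightarrow> imat \<Rightarrow> imat" (infixl "\<oplus>" 65) where
  "X \<oplus> Y = (\<lambda>i j. X i j + Y i j)"

definition mdiag :: "(nat \<Rightarrow> complex) \<Rightarrow> imat" where
  "mdiag d = (\<lambda>i j. if i = j then d i else 0)"

definition mone :: imat where
  "mone = mdiag (\<lambda>_. 1)"

definition madj :: "imat \<Rightarrow> imat" where
  "madj X = (\<lambda>i j. cnj (X j i))"

definition mprod :: "imat list \<Rightarrow> imat" where
  "mprod Xs = foldr (\<odot>) Xs mone"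

definition mat_lim :: "(nat \<Rightarrow> imat) \<Rightarrow> imat \<Rightarrow> bool" where
  "mat_lim X L \<longleftrightarrow> (\<forall>i j. (\<lambda>n. X n i j) \<longlonglongrightarrow> L i j)"

definition has_mprod :: "(nat \<Rightarrow> imat) \<Rightarrow> imat \<Rightarrow> bool" where
  "has_mprod H P \<longleftrightarrow> mat_lim (\<lambda>n. mprod (map H [0..<n])) P"

text \<open>Convergence of every column in \<open>\<ell>\<^sup>2\<close>, i.e., for unitaries, strong operator convergence.\<close>

definition strong_mat_lim :: "(nat \<Rightarrow> imat) \<Rightarrow> imat \<Rightarrow> bool" where
  "strong_mat_lim X L \<longleftrightarrow>
     (\<forall>k. (\<forall>n. summable (\<lambda>i. (cmod (X n i k - L i k))\<^sup>2)) \<and>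
          (\<lambda>n. \<Sum>i. (cmod (X n i k - L i k))\<^sup>2) \<longlonglongrightarrow> 0)"

definition l2 :: "(nat \<Rightarrow> complex) set" where
  "l2 = {x. summable (\<lambda>n. (cmod (x n))\<^sup>2)}"

definition mvec :: "imat \<Rightarrow> (nat \<Rightarrow> complex) \<Rightarrow> nat \<Rightarrow> complex" where
  "mvec X x = (\<lambda>i. \<Sum>\<^sub>\<infinity>j. X i j * x j)"

definition bounded_mat :: "imat \<Rightarrow> bool" where
  "bounded_mat X \<longleftrightarrow>
     (\<exists>C. \<forall>x\<in>l2. (\<forall>i. (\<lambda>j. X i j * x j) summable_on UNIV) \<and> mvec X x \<in> l2 \<and>
          (\<Sum>n. (cmod (mvec X x n))\<^sup>2) \<le> C * (\<Sum>n. (cmod (x n))\<^sup>2))"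

text \<open>
  Invertibility as an operator on \<open>\<ell>\<^sup>2\<close>; the inverse is then unique.  A two-sided inverse
  with respect to formal multiplication of infinite matrices need be neither unique nor
  compatible with multiplication by row vectors, since that multiplication is not associative.
\<close>

definition l2_inverse :: "imat \<Rightarrow> imat \<Rightarrow> bool" where
  "l2_inverse M N \<longleftrightarrow>
     bounded_mat M \<and> bounded_mat N \<and> M \<odot> N = mone \<and> N \<odot> M = mone"

definition formal_inverse :: "imat \<Rightarrow> imat \<Rightarrow> bool" where
  "formal_inverse M N \<longleftrightarrow>
     (\<forall>i k. (\<lambda>j. M i j * N j k) summable_on UNIV \<and> (\<lambda>j. N i j * M j k) summable_on UNIV) \<and>
     M \<odot> N = mone \<and> N \<odot> M = mone"

definition Gt_a :: "(nat \<Rightarrow> complex) \<Rightarrow> (nat \<Rightarrow> complex) \<Rightarrow> (nat \<Rightarrow> complex) \<Rightarrow> nat \<Rightarrow> complex^2^2" where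
  "Gt_a \<alpha> lam eta n =
     (mat (cnj (sg \<alpha> (n - 1)) * cnj (eta n)) :: complex^2^2) **
     (vector [vector [- lam n * eta n, of_real (sqrt (1 - (cmod (lam n))\<^sup>2))],
             vector [of_real (sqrt (1 - (cmod (lam n))\<^sup>2)), cnj (lam n) * cnj (eta n)]] :: complex^2^2) **
     (vector [vector [1, 0], vector [0, sg \<alpha> n]] :: complex^2^2)"

definition Gt_b :: "(nat \<Rightarrow> complex) \<Rightarrow> (nat \<Rightarrow> complex) \<Rightarrow> (nat \<Rightarrow> complex) \<Rightarrow> nat \<Rightarrow> complex^2^2" where
  "Gt_b \<alpha> lam eta n =
     (vector [vector [cnj (sg \<alpha> n), 0], vector [0, 1]] :: complex^2^2) ** Gt_a \<alpha> lam eta n **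
     (vector [vector [sg \<alpha> n, 0], vector [0, 1]] :: complex^2^2)"

text \<open>\<open>diag(I, T, I)\<close> with \<open>T\<close> acting on the indices \<open>n - 1\<close> and \<open>n\<close> (for \<open>n \<ge> 1\<close>).\<close>

definition embed2 :: "nat \<Rightarrow> complex^2^2 \<Rightarrow> imat" where
  "embed2 n T = (\<lambda>i j.
     if i \<in> {n - 1, n} \<and> j \<in> {n - 1, n}
     then T $ (if i = n then 2 else 1) $ (if j = n then 2 else 1)
     else if i = j then 1 else 0)"

definition G_a :: "(nat \<Rightarrow> complex) \<Rightarrow> (nat \<Rightarrow> complex) \<Rightarrow> (nat \<Rightarrow> complex) \<Rightarrow> nat \<Rightarrow> imat" where
  "G_a \<alpha> lam eta n = embed2 n (Gt_a \<alpha> lam eta n)"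

definition G_b :: "(nat \<Rightarrow> complex) \<Rightarrow> (nat \<Rightarrow> complex) \<Rightarrow> (nat \<Rightarrow> complex) \<Rightarrow> nat \<Rightarrow> imat" where
  "G_b \<alpha> lam eta n = embed2 n (Gt_b \<alpha> lam eta n)"

definition select :: "(nat \<Rightarrow> complex) \<Rightarrow> (nat \<Rightarrow> riemann) \<Rightarrow> (nat \<Rightarrow> imat) \<Rightarrow> (nat \<Rightarrow> imat) \<Rightarrow> nat \<Rightarrow> imat" where
  "select \<alpha> \<gamma> Ga Gb n = (if \<gamma> n = Fin (\<alpha> n) then Ga n else Gb n)"

text \<open>
  The order of the factors with indices \<open>1, \<dots>, n\<close>: the factor \<open>j + 1\<close> is put at the right end
  if \<open>\<gamma>\<^sub>j = \<alpha>\<^sub>j\<close>, and immediately to the left of the factor \<open>j\<close> if \<open>\<gamma>\<^sub>j = \<beta>\<^sub>j\<close>.  For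
  \<open>\<gamma> = (\<alpha>, \<beta>, \<beta>, \<alpha>, \<alpha>, \<beta>, \<alpha>, \<dots>)\<close> this is \<open>[1, 4, 3, 2, 5, 7, 6, \<dots>]\<close>.
\<close>

primrec factor_order :: "(nat \<Rightarrow> complex) \<Rightarrow> (nat \<Rightarrow> riemann) \<Rightarrow> nat \<Rightarrow> nat list" where
  "factor_order \<alpha> \<gamma> 0 = []"
| "factor_order \<alpha> \<gamma> (Suc n) =
     (if n = 0 then [1]
      else if \<gamma> n = Fin (\<alpha> n) then factor_order \<alpha> \<gamma> n @ [Suc n]
      else takeWhile (\<lambda>i. i \<noteq> n) (factor_order \<alpha> \<gamma> n) @ [Suc n] @
           dropWhile (\<lambda>i. i \<noteq> n) (factor_order \<alpha> \<gamma> n))"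

definition partial_product :: "(nat \<Rightarrow> complex) \<Rightarrow> (nat \<Rightarrow> riemann) \<Rightarrow> (nat \<Rightarrow> imat) \<Rightarrow> nat \<Rightarrow> imat" where
  "partial_product \<alpha> \<gamma> G n = mprod (map G (factor_order \<alpha> \<gamma> n))"

text \<open>
  For factors of the form \<^const>\<open>embed2\<close> every entry of the partial products is eventually
  constant, because passing from \<open>n\<close> to \<open>n + 1\<close> changes only two rows or two columns, with
  indices \<open>n\<close> and \<open>n + 1\<close>.
\<close>

definition ordered_product :: "(nat \<Rightarrow> complex) \<Rightarrow> (nat \<Rightarrow> riemann) \<Rightarrow> (nat \<Rightarrow> imat) \<Rightarrow> imat" where
  "ordered_product \<alpha> \<gamma> G = (\<lambda>i j. lim (\<lambda>n. partial_product \<alpha> \<gamma> G n i j))"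

definition Amat :: "(nat \<Rightarrow> complex) \<Rightarrow> imat" where
  "Amat \<alpha> = mdiag \<alpha>"

definition etaA :: "(nat \<Rightarrow> complex) \<Rightarrow> imat" where
  "etaA \<alpha> = mdiag (\<lambda>j. of_real (sqrt (1 - (cmod (\<alpha> j))\<^sup>2)))"

definition etaA_inv :: "(nat \<Rightarrow> complex) \<Rightarrow> imat" where
  "etaA_inv \<alpha> = mdiag (\<lambda>j. 1 / of_real (sqrt (1 - (cmod (\<alpha> j))\<^sup>2)))"

definition hat :: "(nat \<Rightarrow> complex) \<Rightarrow> imat \<Rightarrow> imat" where
  "hat \<alpha> G = etaA_inv \<alpha> \<odot> G \<odot> etaA \<alpha>"

text \<open>
  \<open>z \<Phi>(z) = \<Phi>(z) U\<close> in \<open>L\<^sup>2(\<mu>)\<close>: the series \<open>\<Sum>\<^sub>j \<phi>\<^sub>j U\<^sub>j\<^sub>k\<close> given by the \<open>k\<close>-th column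
  converges in mean square to \<open>z \<phi>\<^sub>k\<close>.
\<close>

definition mult_by_z :: "complex measure \<Rightarrow> (nat \<Rightarrow> complex \<Rightarrow> complex) \<Rightarrow> imat \<Rightarrow> bool" where
  "mult_by_z \<mu> \<Phi> U \<longleftrightarrow>
     (\<forall>k. (\<lambda>n. \<integral>\<^sup>+ z. ennreal ((cmod (z * \<Phi> k z - (\<Sum>j<n. \<Phi> j z * U j k)))\<^sup>2) \<partial>\<mu>)
            \<longlonglongrightarrow> 0)"

text \<open>
  \<open>N\<close> plays the role of \<open>(I + A\<^sup>* hat G)\<^sup>-\<^sup>1\<close> and \<open>N'\<close> that of \<open>(I + A\<^sup>* G)\<^sup>-\<^sup>1\<close>.  If
  \<open>|\<alpha>\<^sub>j|\<close> is not bounded away from \<open>1\<close>, boundedness of \<open>N\<close> gives \<open>N'\<close> only as a formal inverse;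
  it is the \<open>\<ell>\<^sup>2\<close> inverse as soon as the latter exists.
\<close>

definition mult_matrix_relations ::
    "complex measure \<Rightarrow> (nat \<Rightarrow> complex) \<Rightarrow> (nat \<Rightarrow> complex \<Rightarrow> complex) \<Rightarrow> imat \<Rightarrow> imat \<Rightarrow> bool" where
  "mult_matrix_relations \<mu> \<alpha> \<Phi> G N \<longleftrightarrow>
     mult_by_z \<mu> \<Phi> ((hat \<alpha> G \<oplus> Amat \<alpha>) \<odot> N) \<and>
     (\<exists>N'. formal_inverse (mone \<oplus> madj (Amat \<alpha>) \<odot> G) N' \<and>
           (\<forall>X. l2_inverse (mone \<oplus> madj (Amat \<alpha>) \<odot> G) X \<longrightarrow> X = N') \<and>
           (hat \<alpha> G \<oplus> Amat \<alpha>) \<odot> N = etaA_inv \<alpha> \<odot> (G \<oplus> Amat \<alpha>) \<odot> N' \<odot> etaA \<alpha>)"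

definition hessenberg :: "imat \<Rightarrow> bool" where
  "hessenberg G \<longleftrightarrow> (\<forall>i j. j + 1 < i \<longrightarrow> G i j = 0)"

definition five_diagonal :: "imat \<Rightarrow> bool" where
  "five_diagonal G \<longleftrightarrow> (\<forall>i j. i + 2 < j \<or> j + 2 < i \<longrightarrow> G i j = 0)"

definition special_forms ::
    "(nat \<Rightarrow> complex) \<Rightarrow> (nat \<Rightarrow> riemann) \<Rightarrow> (nat \<Rightarrow> imat) \<Rightarrow> (nat \<Rightarrow> imat) \<Rightarrow> imat \<Rightarrow> bool" where
  "special_forms \<alpha> \<gamma> Ga Gb G \<longleftrightarrow>
     ((\<forall>j\<ge>1. \<gamma> j = Fin (\<alpha> j)) \<longrightarrow>
        hessenberg G \<and> has_mprod (\<lambda>k. Ga (k + 1)) G) \<and>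
     ((\<forall>j\<ge>1. \<gamma> j = (if odd j then Fin (\<alpha> j) else beta \<alpha> j)) \<longrightarrow>
        five_diagonal G \<and>
        has_mprod (\<lambda>k. if k = 0 then Ga 1 else Ga (2 * k + 1) \<odot> Gb (2 * k)) G \<and>
        (\<exists>P Q. has_mprod (\<lambda>k. Ga (2 * k + 1)) P \<and> has_mprod (\<lambda>k. Gb (2 * k + 2)) Q \<and>
               G = P \<odot> Q)) \<and>
     ((\<forall>j\<ge>1. \<gamma> j = (if odd j then beta \<alpha> j else Fin (\<alpha> j))) \<longrightarrow>
        five_diagonal G \<and>
        has_mprod (\<lambda>k. Ga (2 * k + 2) \<odot> Gb (2 * k + 1)) G \<and>
        (\<exists>P Q. has_mprod (\<lambda>k. Ga (2 * k + 2)) P \<and> has_mprod (\<lambda>k. Gb (2 * k + 1)) Q \<and>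
               G = P \<odot> Q))"

end

theory Submission
  imports Defs
begin

text \<open>
  Formally the claim says \<open>z \<Phi> (I + A\<^sup>* hat G) = \<Phi> (hat G + A)\<close>. Since \<open>A\<close> and \<open>\<eta>\<^sub>A\<close> are diagonal, this
  is the same as \<open>v = u G\<close> for the row vectors with the entries
  \<open>u\<^sub>n = (1 - cnj \<alpha>\<^sub>n z) \<phi>\<^sub>n / s\<^sub>n\<close> and \<open>v\<^sub>n = (z - \<alpha>\<^sub>n) \<phi>\<^sub>n / s\<^sub>n\<close>, where
  \<open>s\<^sub>n = \<surd>(1 - \<bar>\<alpha>\<^sub>n\<bar>\<^sup>2)\<close>. The proof consists of an algebraic part, which establishes \<open>v = u G\<close> on the
  circle up to an explicit remainder, and an analytic part, which turns it into the statement
  about \<open>L\<^sup>2(\<mu>)\<close>.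

  On the circle \<open>\<phi>\<^sub>n\<close> equals \<open>D\<^sub>n \<phi>\<^sub>n\<^sup>\<alpha>\<close> or \<open>D\<^sub>n \<phi>\<^sub>n\<^sup>\<alpha>\<^sup>*\<close>, depending on \<open>\<gamma>\<^sub>n\<close>, where \<open>D\<^sub>n\<close> is the product of the
  \<open>\<zeta>\<^sub>j\<^sup>\<beta>\<close> with \<open>\<gamma>\<^sub>j = \<beta>\<^sub>j\<close>, \<open>j \<le> n\<close> (\<open>orf_g_formula\<close>): the spaces \<open>\<L>\<^sub>n\<close> are \<open>D\<^sub>n \<L>\<^sub>n\<^sup>\<alpha>\<close>,
  multiplication by \<open>D\<^sub>n\<close> is isometric, and the normalizations fix the remaining constant. The
  recurrence relates \<open>\<phi>\<^sub>n\<^sup>\<alpha>, \<phi>\<^sub>n\<^sup>\<alpha>\<^sup>*\<close> to \<open>\<phi>\<^sub>n\<^sub>-\<^sub>1\<^sup>\<alpha>, \<phi>\<^sub>n\<^sub>-\<^sub>1\<^sup>\<alpha>\<^sup>*\<close> by a transfer matrix. Solved for another pair of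
  the four functions it becomes a unitary scattering matrix, and this is \<open>G\<^sub>n\<^sup>\<alpha>\<close> (\<open>scattering\<close>). A product of
  scattering matrices describes a chain of scatterers, each of which has to be applied as soon as
  its incoming amplitudes are known; whether the function \<open>u\<^sub>n\<close> is an incoming amplitude of
  scatterer \<open>n\<close> or of scatterer \<open>n + 1\<close> depends on \<open>\<gamma>\<^sub>n\<close>, and this is what determines the order of the
  factors (\<open>zigzag_scattering\<close>, \<open>orf_scattering\<close>).

  The remainder vanishes eventually in each column unless all \<open>\<gamma>\<^sub>n\<close> are \<open>\<beta>\<close>'s from some index
  on. In that case strong convergence of the partial products makes it tend to zero apart
  from the weights \<open>1 / s\<^sub>n\<close>, which may be unbounded; square-summability of the columns of
  \<open>hat G\<close> compensates for that along a subsequence, which is enough (\<open>column_relation\<close>). So the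
  identity holds for every column, and it extends to all square-summable combinations of columns
  by continuity (\<open>times_z_closed\<close>), because \<open>hat G\<close> is bounded (\<open>hat_bounded\<close>). Applied to the
  columns of the inverse \<open>N\<close> it yields multiplication by \<open>z\<close>.

  Replacing the \<open>G\<^sub>n\<^sup>\<beta>\<close> by \<open>G\<^sub>n\<^sup>\<alpha>\<close> conjugates \<open>G\<close> by a diagonal unitary matrix, namely the one that relates
  the two orthonormal bases (\<open>zigzag_Gt_a_conjugate_by\<close>). The Hessenberg and CMV forms are facts about
  products of arbitrary matrices of the shape \<^const>\<open>embed2\<close> (\<open>special_forms_ordered_product\<close>).
\<close>

section \<open>Infinite matrices with finitely supported rows and columns\<close>

definition row_finite :: "imat \<Rightarrow> bool" where
  "row_finite X \<longleftrightarrow> (\<forall>i. finite {j. X i j \<noteq> 0})"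

definition column_finite :: "imat \<Rightarrow> bool" where
  "column_finite X \<longleftrightarrow> (\<forall>j. finite {i. X i j \<noteq> 0})"

definition finitary :: "imat \<Rightarrow> bool" where
  "finitary X \<longleftrightarrow> row_finite X \<and> column_finite X"

lemma infsum_finite_support:
  fixes f :: "'a \<Rightarrow> 'b::{comm_monoid_add, t2_space}"
  assumes "finite F" "\<And>j. j \<notin> F \<Longrightarrow> f j = 0"
  shows "(\<Sum>\<^sub>\<infinity>j. f j) = (\<Sum>j\<in>F. f j)"
proof -
  have "(\<Sum>\<^sub>\<infinity>j. f j) = (\<Sum>\<^sub>\<infinity>j\<in>F. f j)"
    by (rule infsum_cong_neutral) (use assms in auto)
  then show ?thesis using assms(1) by simp
qed

lemma mmult_finite_sum:
  assumes "finite F" "\<And>j. j \<notin> F \<Longrightarrow> X i j * Y j k = 0"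
  shows "(X \<odot> Y) i k = (\<Sum>j\<in>F. X i j * Y j k)"
  unfolding mmult_def using assms by (rule infsum_finite_support)

text \<open>
  Formal multiplication of infinite matrices is not associative in general. Here the finite
  supports of the outer factors confine both double sums to the same finite rectangle.
\<close>

lemma mmult_assoc:
  assumes X: "row_finite X" and Z: "column_finite Z"
  shows "(X \<odot> Y) \<odot> Z = X \<odot> (Y \<odot> Z)"
proof (intro ext)
  fix i k
  define F where "F = {j. X i j \<noteq> 0}"
  define H where "H = {l. Z l k \<noteq> 0}"
  have F: "finite F" and H: "finite H"
    using X Z by (auto simp: F_def H_def row_finite_def column_finite_def)
  have "((X \<odot> Y) \<odot> Z) i k = (\<Sum>l\<in>H. (X \<odot> Y) i l * Z l k)"
    by (rule mmult_finite_sum) (use H in \<open>auto simp: H_def\<close>)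
  also have "\<dots> = (\<Sum>l\<in>H. (\<Sum>j\<in>F. X i j * Y j l) * Z l k)"
    by (intro sum.cong refl arg_cong2[where f = "(*)"] mmult_finite_sum) (use F in \<open>auto simp: F_def\<close>)
  also have "\<dots> = (\<Sum>j\<in>F. X i j * (\<Sum>l\<in>H. Y j l * Z l k))"
    by (simp add: sum_distrib_left sum_distrib_right mult.assoc sum.swap[of _ F H])
  also have "\<dots> = (\<Sum>j\<in>F. X i j * (Y \<odot> Z) j k)"
    by (intro sum.cong refl arg_cong2[where f = "(*)"] mmult_finite_sum[symmetric]) (use H in \<open>auto simp: H_def\<close>)
  also have "\<dots> = (X \<odot> (Y \<odot> Z)) i k"
    by (rule mmult_finite_sum[symmetric]) (use F in \<open>auto simp: F_def\<close>)
  finally show "((X \<odot> Y) \<odot> Z) i k = (X \<odot> (Y \<odot> Z)) i k" .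
qed

lemma mdiag_mmult: "mdiag d \<odot> X = (\<lambda>i j. d i * X i j)"
proof (intro ext)
  fix i k
  have "(mdiag d \<odot> X) i k = (\<Sum>j\<in>{i}. mdiag d i j * X j k)"
    by (rule mmult_finite_sum) (auto simp: mdiag_def)
  then show "(mdiag d \<odot> X) i k = d i * X i k" by (simp add: mdiag_def)
qed

lemma mmult_mdiag: "X \<odot> mdiag d = (\<lambda>i j. X i j * d j)"
proof (intro ext)
  fix i k
  have "(X \<odot> mdiag d) i k = (\<Sum>j\<in>{k}. X i j * mdiag d j k)"
    by (rule mmult_finite_sum) (auto simp: mdiag_def)
  then show "(X \<odot> mdiag d) i k = X i k * d k" by (simp add: mdiag_def)
qed

lemma mone_apply: "mone i j = (if i = j then 1 else 0)"
  by (simp add: mone_def mdiag_def)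

lemma mmult_mone [simp]: "X \<odot> mone = X" and mone_mmult [simp]: "mone \<odot> X = X"
  by (simp_all add: mone_def mmult_mdiag mdiag_mmult)

lemma finitary_mone [simp]: "finitary mone"
  by (auto simp: finitary_def row_finite_def column_finite_def mone_apply)

lemma finitary_mmult:
  assumes "finitary X" "finitary Y"
  shows "finitary (X \<odot> Y)"
proof -
  have *: "(X \<odot> Y) i k = (\<Sum>j\<in>{j. X i j \<noteq> 0}. X i j * Y j k)" for i k
    by (rule mmult_finite_sum) (use assms in \<open>auto simp: finitary_def row_finite_def\<close>)
  have **: "\<exists>j. X i j \<noteq> 0 \<and> Y j k \<noteq> 0" if "(X \<odot> Y) i k \<noteq> 0" for i k
    using that unfolding * by (metis (no_types, lifting) mult_zero_left mult_zero_right sum.not_neutral_contains_not_neutral)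
  have "finite {k. (X \<odot> Y) i k \<noteq> 0}" for i
    by (rule finite_subset[of _ "\<Union>j\<in>{j. X i j \<noteq> 0}. {k. Y j k \<noteq> 0}"])
       (use assms in \<open>auto simp: finitary_def row_finite_def dest!: **\<close>)
  moreover have "finite {i. (X \<odot> Y) i k \<noteq> 0}" for k
    by (rule finite_subset[of _ "\<Union>j\<in>{j. Y j k \<noteq> 0}. {i. X i j \<noteq> 0}"])
       (use assms in \<open>auto simp: finitary_def column_finite_def dest!: **\<close>)
  ultimately show ?thesis by (auto simp: finitary_def row_finite_def column_finite_def)
qed

lemma finitary_assoc: "finitary X \<Longrightarrow> finitary Z \<Longrightarrow> (X \<odot> Y) \<odot> Z = X \<odot> (Y \<odot> Z)"
  by (simp add: mmult_assoc finitary_def)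

lemma mprod_Nil [simp]: "mprod [] = mone"
  and mprod_Cons [simp]: "mprod (X # Xs) = X \<odot> mprod Xs"
  by (simp_all add: mprod_def)

lemma finitary_mprod: "(\<And>X. X \<in> set Xs \<Longrightarrow> finitary X) \<Longrightarrow> finitary (mprod Xs)"
  by (induction Xs) (auto intro: finitary_mmult)

lemma mprod_append:
  "(\<And>X. X \<in> set (Xs @ Ys) \<Longrightarrow> finitary X) \<Longrightarrow> mprod (Xs @ Ys) = mprod Xs \<odot> mprod Ys"
proof (induction Xs)
  case (Cons X Xs)
  have "finitary X" "finitary (mprod Ys)" using Cons.prems by (auto intro: finitary_mprod)
  then show ?case using Cons by (simp add: finitary_assoc)
qed simp

lemma mprod_snoc:
  "(\<And>X. X \<in> set Xs \<Longrightarrow> finitary X) \<Longrightarrow> finitary Y \<Longrightarrow> mprod (Xs @ [Y]) = mprod Xs \<odot> Y"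
  by (subst mprod_append) auto

section \<open>Elementary factors and their ordered products\<close>

lemma embed2_right:
  assumes "1 \<le> n"
  shows "(X \<odot> embed2 n T) i k =
    (if k = n - 1 then X i (n - 1) * T$1$1 + X i n * T$2$1
     else if k = n then X i (n - 1) * T$1$2 + X i n * T$2$2 else X i k)"
proof -
  have "(X \<odot> embed2 n T) i k = (\<Sum>j\<in>{n - 1, n, k}. X i j * embed2 n T j k)"
    by (rule mmult_finite_sum) (auto simp: embed2_def)
  then show ?thesis using assms by (auto simp: embed2_def insert_commute)
qed

lemma embed2_left:
  assumes "1 \<le> n"
  shows "(embed2 n T \<odot> X) i k =
    (if i = n - 1 then T$1$1 * X (n - 1) k + T$1$2 * X n k
     else if i = n then T$2$1 * X (n - 1) k + T$2$2 * X n k else X i k)"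
proof -
  have "(embed2 n T \<odot> X) i k = (\<Sum>j\<in>{n - 1, n, i}. embed2 n T i j * X j k)"
    by (rule mmult_finite_sum) (auto simp: embed2_def)
  then show ?thesis using assms by (auto simp: embed2_def insert_commute)
qed

lemma finitary_embed2: "1 \<le> n \<Longrightarrow> finitary (embed2 n T)"
proof -
  assume "1 \<le> n"
  have "finite {j. embed2 n T i j \<noteq> 0}" for i
    by (rule finite_subset[of _ "{n - 1, n, i}"]) (auto simp: embed2_def split: if_splits)
  moreover have "finite {i. embed2 n T i j \<noteq> 0}" for j
    by (rule finite_subset[of _ "{n - 1, n, j}"]) (auto simp: embed2_def split: if_splits)
  ultimately show ?thesis by (auto simp: finitary_def row_finite_def column_finite_def)
qed

text \<open>Agreement with the identity in all rows and columns with index at least \<^term>\<open>m\<close>.\<close>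

definition corner :: "nat \<Rightarrow> imat \<Rightarrow> bool" where
  "corner m X \<longleftrightarrow> (\<forall>i j. m \<le> i \<or> m \<le> j \<longrightarrow> X i j = mone i j)"

lemma corner_mone [simp]: "corner m mone"
  by (simp add: corner_def)

lemma corner_mono: "corner m X \<Longrightarrow> m \<le> n \<Longrightarrow> corner n X"
  unfolding corner_def by (blast intro: le_trans)

lemma corner_embed2_right:
  assumes "1 \<le> n" "corner m X" "n + 1 \<le> m"
  shows "corner m (X \<odot> embed2 n T)"
  using assms unfolding corner_def by (auto simp: embed2_right mone_apply)

lemma corner_embed2_left:
  assumes "1 \<le> n" "corner m X" "n + 1 \<le> m"
  shows "corner m (embed2 n T \<odot> X)"
  using assms unfolding corner_def by (auto simp: embed2_left mone_apply)

lemma corner_commute: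
  assumes "1 \<le> n" "corner m X" "m \<le> n - 1"
  shows "X \<odot> embed2 n T = embed2 n T \<odot> X"
proof (intro ext)
  fix i k
  have X: "X i j = mone i j" if "m \<le> i \<or> m \<le> j" for i j
    using assms(2) that unfolding corner_def by blast
  show "(X \<odot> embed2 n T) i k = (embed2 n T \<odot> X) i k"
    using assms(1,3) le_trans[OF assms(3), of n]
    by (auto simp: embed2_left embed2_right X mone_apply)
qed

text \<open>
  The ordered product with \<^term>\<open>app n\<close> saying whether factor \<open>n + 1\<close> goes to the right of factor
  \<open>n\<close>.  Since factor \<open>n + 1\<close> commutes with the factors before \<open>n\<close>, a factor put to the left of
  its predecessor may be moved to the left end of the product.
\<close>

primrec zigzag :: "(nat \<Rightarrow> bool) \<Rightarrow> (nat \<Rightarrow> complex^2^2) \<Rightarrow> nat \<Rightarrow> imat" where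
  "zigzag app T 0 = mone"
| "zigzag app T (Suc n) =
    (if app n then zigzag app T n \<odot> embed2 (Suc n) (T (Suc n))
     else embed2 (Suc n) (T (Suc n)) \<odot> zigzag app T n)"

lemma finitary_zigzag: "finitary (zigzag app T n)"
  by (induction n) (auto intro!: finitary_mmult finitary_embed2)

lemma corner_zigzag: "corner (Suc n) (zigzag app T n)"
proof (induction n)
  case (Suc n)
  have "corner (Suc (Suc n)) (zigzag app T n)" using Suc by (rule corner_mono) simp
  then show ?case by (auto intro: corner_embed2_right corner_embed2_left)
qed simp

lemma zigzag_outside:
  "n < i \<or> n < j \<Longrightarrow> zigzag app T n i j = (if i = j then 1 else 0)"
  using corner_zigzag[of n app T] by (auto simp: corner_def mone_apply Suc_le_eq)

lemma zigzag_eventually_constant: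
  assumes "i < n" "j < n" "n \<le> m"
  shows "zigzag app T m i j = zigzag app T n i j"
  using assms(3)
proof (induction m rule: dec_induct)
  case (step m)
  then show ?case using assms by (auto simp: embed2_left embed2_right)
qed simp

text \<open>
  After an appended factor the columns to the left are complete: factors appended later act on
  later columns, and factors put to the left act on later rows, where these columns vanish.
\<close>

lemma zigzag_column_constant:
  assumes "app n" "k < n" "n \<le> m"
  shows "zigzag app T m j k = zigzag app T n j k"
  using assms(3)
proof (induction m arbitrary: j rule: dec_induct)
  case (step m)
  have zero: "zigzag app T n j k = 0" if "n < j" for j
    using zigzag_outside[of n j k app T] that assms(2) by auto
  show ?case
  proof (cases "app m")
    case True
    then show ?thesis using step assms by (auto simp: embed2_right)
  next
    case False
    with assms(1) step.hyps have "n < m" by (metis le_neq_implies_less)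
    then show ?thesis using False step zero by (auto simp: embed2_left)
  qed
qed simp

text \<open>
  An entry is constant from the first partial product on in which it lies in the upper left
  corner.
\<close>

definition zigzag_limit :: "(nat \<Rightarrow> bool) \<Rightarrow> (nat \<Rightarrow> complex^2^2) \<Rightarrow> imat" where
  "zigzag_limit app T = (\<lambda>i j. zigzag app T (Suc (max i j)) i j)"

lemma zigzag_limit_eq: "i < n \<Longrightarrow> j < n \<Longrightarrow> zigzag_limit app T i j = zigzag app T n i j"
  unfolding zigzag_limit_def by (rule zigzag_eventually_constant[symmetric]) auto

lemma mat_lim_eventually_constant:
  assumes "\<And>i j. \<exists>N. \<forall>n\<ge>N. X n i j = L i j"
  shows "mat_lim X L"
  unfolding mat_lim_def
proof (intro allI tendsto_eventually)
  fix i j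
  obtain N where "\<forall>n\<ge>N. X n i j = L i j" using assms by blast
  then show "\<forall>\<^sub>F n in sequentially. X n i j = L i j"
    unfolding eventually_sequentially by blast
qed

lemma mat_lim_zigzag: "mat_lim (zigzag app T) (zigzag_limit app T)"
proof (rule mat_lim_eventually_constant)
  fix i j
  have "zigzag_limit app T i j = zigzag app T n i j" if "Suc (max i j) \<le> n" for n
    by (rule zigzag_limit_eq) (use that in auto)
  then show "\<exists>N. \<forall>n\<ge>N. zigzag app T n i j = zigzag_limit app T i j"
    by metis
qed

lemma takeWhile_dropWhile_split:
  assumes "n \<notin> set ps"
  shows "takeWhile (\<lambda>i. i \<noteq> n) (ps @ n # qs) = ps" "dropWhile (\<lambda>i. i \<noteq> n) (ps @ n # qs) = n # qs"
  using assms by (auto simp: takeWhile_append2 dropWhile_append2 takeWhile_append dropWhile_append)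

lemma set_factor_order: "distinct (factor_order \<alpha> \<gamma> n) \<and> set (factor_order \<alpha> \<gamma> n) = {1..n}"
proof (induction n)
  case (Suc n)
  let ?L = "factor_order \<alpha> \<gamma> n"
  show ?case
  proof (cases "n = 0")
    case False
    with Suc obtain ps qs where pq: "?L = ps @ n # qs"
      by (metis One_nat_def Suc_leI atLeastAtMost_iff le_refl neq0_conv split_list)
    with Suc have d: "n \<notin> set ps" by auto
    have e: "{1..Suc n} = insert (Suc n) {1..n}" by auto
    have "Suc n \<notin> set (ps @ n # qs)"
      using Suc pq by (metis atLeastAtMost_iff not_less_eq_eq order_refl)
    moreover have "distinct (ps @ n # qs)" "set (ps @ n # qs) = {1..n}" using Suc pq by auto
    moreover from this(2) have "n \<in> {1..n}" by auto
    ultimately show ?thesis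
      unfolding e using pq takeWhile_dropWhile_split[OF d, of qs] False
      by (auto simp del: atLeastAtMost_iff)
  qed auto
qed simp

lemma corner_mprod_embed2:
  assumes "\<And>m. m \<in> set ms \<Longrightarrow> 1 \<le> m \<and> m < n"
  shows "corner n (mprod (map (\<lambda>m. embed2 m (T m)) ms))"
  using assms
proof (induction ms)
  case (Cons m ms)
  then have "corner n (mprod (map (\<lambda>m. embed2 m (T m)) ms))" "1 \<le> m" "m + 1 \<le> n"
    by (auto simp: Suc_le_eq)
  then show ?case by (auto intro: corner_embed2_left)
qed simp

text \<open>
  Factor \<^term>\<open>n + 1\<close>, when put directly to the left of factor \<^term>\<open>n\<close>, may be moved to the left end:
  the factors that it passes have indices less than \<^term>\<open>n\<close>, hence commute with it.
\<close>

lemma mprod_factor_order: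
  assumes E: "\<And>n. 1 \<le> n \<Longrightarrow> E n = embed2 n (T n)"
  shows "partial_product \<alpha> \<gamma> E n = zigzag (\<lambda>n. n = 0 \<or> \<gamma> n = Fin (\<alpha> n)) T n"
proof (induction n)
  case 0
  show ?case by (simp add: partial_product_def)
next
  case (Suc n)
  let ?app = "\<lambda>n. n = 0 \<or> \<gamma> n = Fin (\<alpha> n)"
  let ?L = "factor_order \<alpha> \<gamma> n"
  have fin: "finitary (E m)" if "1 \<le> m" for m
    using that by (simp add: E finitary_embed2)
  have pos: "1 \<le> m" if "m \<in> set ?L" for m
    using that set_factor_order[of \<alpha> \<gamma> n] by auto
  show ?case
  proof (cases "?app n")
    case True
    then have "factor_order \<alpha> \<gamma> (Suc n) = ?L @ [Suc n]" by auto
    moreover have "mprod (map E ?L @ [E (Suc n)]) = mprod (map E ?L) \<odot> E (Suc n)"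
      by (rule mprod_snoc) (auto intro!: fin dest: pos)
    ultimately show ?thesis using True Suc E[of "Suc n"] by (simp add: partial_product_def)
  next
    case False
    then obtain ps qs where pq: "?L = ps @ n # qs"
      using set_factor_order[of \<alpha> \<gamma> n] by (metis One_nat_def Suc_leI atLeastAtMost_iff le_refl neq0_conv split_list)
    then have d: "n \<notin> set ps" and ps: "\<And>m. m \<in> set ps \<Longrightarrow> 1 \<le> m \<and> m < n"
      and qs: "\<And>m. m \<in> set qs \<Longrightarrow> 1 \<le> m"
      using set_factor_order[of \<alpha> \<gamma> n] by (auto simp: set_eq_iff) (metis le_neq_implies_less)
    have fo: "factor_order \<alpha> \<gamma> (Suc n) = ps @ Suc n # n # qs"
      using False takeWhile_dropWhile_split[OF d, of qs] pq by auto
    have finp: "finitary (mprod (map E ps))" by (rule finitary_mprod) (use ps fin in auto)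
    have finq: "finitary (mprod (map E (n # qs)))"
      by (rule finitary_mprod) (use qs fin False in auto)
    have finr: "finitary (mprod (map E (Suc n # n # qs)))"
      by (rule finitary_mprod) (use qs fin False in auto)
    have c: "mprod (map E ps) \<odot> E (Suc n) = E (Suc n) \<odot> mprod (map E ps)"
    proof -
      have "map E ps = map (\<lambda>m. embed2 m (T m)) ps" using ps E by auto
      moreover have "corner n (mprod (map (\<lambda>m. embed2 m (T m)) ps))"
        using ps by (rule corner_mprod_embed2)
      ultimately have "corner n (mprod (map E ps))" by metis
      then show ?thesis using corner_commute[of "Suc n" n] E[of "Suc n"] by auto
    qed
    have "partial_product \<alpha> \<gamma> E (Suc n) = mprod (map E ps @ map E (Suc n # n # qs))"
      by (simp only: partial_product_def fo map_append)
    also have "\<dots> = mprod (map E ps) \<odot> (E (Suc n) \<odot> mprod (map E (n # qs)))"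
      by (subst mprod_append) (use ps qs fin False in auto)
    also have "\<dots> = E (Suc n) \<odot> (mprod (map E ps) \<odot> mprod (map E (n # qs)))"
      using finp finq fin[of "Suc n"] c by (simp add: finitary_assoc[symmetric])
    also have "mprod (map E ps) \<odot> mprod (map E (n # qs)) = mprod (map E ?L)"
      unfolding pq map_append by (subst mprod_append) (use ps qs fin False in auto)
    also have "\<dots> = zigzag ?app T n" using Suc by (simp add: partial_product_def)
    finally show ?thesis using False E[of "Suc n"] by simp
  qed
qed

lemma ordered_product_zigzag:
  assumes "\<And>n. 1 \<le> n \<Longrightarrow> E n = embed2 n (T n)"
  shows "ordered_product \<alpha> \<gamma> E = zigzag_limit (\<lambda>n. n = 0 \<or> \<gamma> n = Fin (\<alpha> n)) T"
proof (intro ext)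
  fix i j
  have "(\<lambda>n. partial_product \<alpha> \<gamma> E n i j)
      \<longlonglongrightarrow> zigzag_limit (\<lambda>n. n = 0 \<or> \<gamma> n = Fin (\<alpha> n)) T i j"
    using mat_lim_zigzag[of _ T] mprod_factor_order[of E T \<alpha> \<gamma>] assms unfolding mat_lim_def by presburger
  then show "ordered_product \<alpha> \<gamma> E i j = zigzag_limit (\<lambda>n. n = 0 \<or> \<gamma> n = Fin (\<alpha> n)) T i j"
    unfolding ordered_product_def by (rule limI)
qed

section \<open>Hessenberg and CMV products\<close>

lemma has_mprod_zigzag_limit:
  assumes "\<And>n. mprod (map H [0..<n]) = zigzag app T (f n)" "\<And>n. n \<le> Suc (f n)"
  shows "has_mprod H (zigzag_limit app T)"
  unfolding has_mprod_def
proof (rule mat_lim_eventually_constant)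
  fix i j
  have "mprod (map H [0..<n]) i j = zigzag_limit app T i j" if "Suc (Suc (max i j)) \<le> n" for n
    unfolding assms(1) by (rule zigzag_limit_eq[symmetric]) (use that assms(2)[of n] in auto)
  then show "\<exists>N. \<forall>n\<ge>N. mprod (map H [0..<n]) i j = zigzag_limit app T i j"
    by metis
qed

lemma zigzag_appending:
  assumes "\<And>n. app n"
  shows "mprod (map (\<lambda>k. embed2 (k + 1) (T (k + 1))) [0..<n]) = zigzag app T n"
proof (induction n)
  case (Suc n)
  have "mprod (map (\<lambda>k. embed2 (k + 1) (T (k + 1))) [0..<n] @ [embed2 (n + 1) (T (n + 1))])
      = mprod (map (\<lambda>k. embed2 (k + 1) (T (k + 1))) [0..<n]) \<odot> embed2 (n + 1) (T (n + 1))"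
    by (rule mprod_snoc) (auto intro!: finitary_embed2)
  then show ?case using assms[of n] Suc by simp
qed simp

lemma hessenberg_zigzag:
  assumes "\<And>n. app n"
  shows "hessenberg (zigzag app T n)"
proof (induction n)
  case 0
  show ?case by (simp add: hessenberg_def mone_apply)
next
  case (Suc n)
  then show ?case
    using assms[of n] zigzag_outside[of n _ _ app T] by (auto simp: hessenberg_def embed2_right)
qed

text \<open>
  Products of factors with the indices \<^term>\<open>c\<close>, \<^term>\<open>c + 2\<close>, \<^term>\<open>c + 4\<close>, \dots: the factors
  act on disjoint pairs of indices, so that the product is block diagonal.
\<close>

definition every_other :: "nat \<Rightarrow> (nat \<Rightarrow> complex^2^2) \<Rightarrow> nat \<Rightarrow> imat" where
  "every_other c T n = mprod (map (\<lambda>k. embed2 (2 * k + c) (T (2 * k + c))) [0..<n])"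

lemma every_other_0: "every_other c T 0 = mone"
  by (simp add: every_other_def)

lemma every_other_Suc:
  "1 \<le> c \<Longrightarrow> every_other c T (Suc n) = every_other c T n \<odot> embed2 (2 * n + c) (T (2 * n + c))"
  unfolding every_other_def upt_Suc_append[OF le0] map_append list.map
  by (rule mprod_snoc) (auto intro!: finitary_embed2)

lemma finitary_every_other: "1 \<le> c \<Longrightarrow> finitary (every_other c T n)"
  by (induction n) (auto simp: every_other_0 every_other_Suc intro!: finitary_mmult finitary_embed2)

lemma corner_every_other:
  assumes "1 \<le> c"
  shows "corner (2 * n + c - 1) (every_other c T n)"
proof (induction n)
  case 0
  show ?case by (simp add: every_other_0)
next
  case (Suc n)
  have "corner (2 * Suc n + c - 1) (every_other c T n)"
    by (rule corner_mono[OF Suc]) (use assms in auto)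
  then show ?case using assms by (auto simp: every_other_Suc intro!: corner_embed2_right)
qed

lemma every_other_tridiagonal:
  assumes "1 \<le> c" "i + 1 < j \<or> j + 1 < i"
  shows "every_other c T n i j = 0"
  using assms(2)
proof (induction n arbitrary: i j)
  case (Suc n)
  have "every_other c T n i k = mone i k" if "2 * n + c - 1 \<le> k" for i k
    using corner_every_other[OF assms(1), of n T] that unfolding corner_def by blast
  moreover have "every_other c T n i j = 0" using Suc by blast
  ultimately show ?case
    using Suc.prems assms(1) by (auto simp: every_other_Suc embed2_right mone_apply)
qed (auto simp: every_other_0 mone_apply)

lemma every_other_constant:
  assumes "1 \<le> c" "j + 1 < 2 * n + c" "n \<le> m"
  shows "every_other c T m i j = every_other c T n i j"
  using assms(3)
proof (induction m rule: dec_induct)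
  case (step m)
  then show ?case using assms(1,2) by (auto simp: every_other_Suc embed2_right)
qed simp

definition every_other_limit :: "nat \<Rightarrow> (nat \<Rightarrow> complex^2^2) \<Rightarrow> imat" where
  "every_other_limit c T = (\<lambda>i j. every_other c T (Suc j) i j)"

lemma every_other_limit_eq:
  "1 \<le> c \<Longrightarrow> j < n \<Longrightarrow> every_other_limit c T i j = every_other c T n i j"
  unfolding every_other_limit_def by (rule every_other_constant[symmetric]) auto

lemma has_mprod_every_other:
  assumes "1 \<le> c" "\<And>k. H k = embed2 (2 * k + c) (T (2 * k + c))"
  shows "has_mprod H (every_other_limit c T)"
  unfolding has_mprod_def
proof (rule mat_lim_eventually_constant)
  fix i j
  have "mprod (map H [0..<n]) i j = every_other_limit c T i j" if "Suc j \<le> n" for n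
    using every_other_limit_eq[OF assms(1), of j n T i] that
    by (simp add: every_other_def assms(2) cong: map_cong)
  then show "\<exists>N. \<forall>n\<ge>N. mprod (map H [0..<n]) i j = every_other_limit c T i j"
    by metis
qed

text \<open>
  In an alternating order with \<^term>\<open>c\<close> factors in front, the factors are multiplied in pairs.
  Each new pair \<open>E\<^sub>m\<^sub>+\<^sub>2 E\<^sub>m\<^sub>+\<^sub>1\<close> has its left factor beyond everything present so far, which
  allows both to add the pair at the right end and to sort the factors by parity.
\<close>

lemma zigzag_pair:
  assumes "app m" "\<not> app (Suc m)"
  shows "zigzag app T (Suc (Suc m)) =
    zigzag app T m \<odot> (embed2 (Suc (Suc m)) (T (Suc (Suc m))) \<odot> embed2 (Suc m) (T (Suc m)))"
proof -
  let ?E = "\<lambda>k. embed2 k (T k)"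
  have f: "finitary (?E (Suc k))" "finitary (zigzag app T k)" for k
    by (auto simp: finitary_embed2 finitary_zigzag)
  have "zigzag app T (Suc (Suc m)) = ?E (Suc (Suc m)) \<odot> zigzag app T m \<odot> ?E (Suc m)"
    using assms f by (simp add: finitary_assoc)
  also have "?E (Suc (Suc m)) \<odot> zigzag app T m = zigzag app T m \<odot> ?E (Suc (Suc m))"
    by (rule corner_commute[symmetric, OF _ corner_zigzag]) auto
  finally show ?thesis using f by (simp add: finitary_assoc)
qed

text \<open>
  For \<^term>\<open>c = 0\<close> the sequence begins with a \<open>\<beta>\<close>, for \<^term>\<open>c = 1\<close> with an \<open>\<alpha>\<close>. Accordingly the
  left product collects the even factors or the odd ones.
\<close>

lemma zigzag_alternating:
  assumes c: "c \<le> 1" and app: "\<And>n. app (2 * n + c)" "\<And>n. \<not> app (Suc (2 * n + c))"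
  shows "zigzag app T (2 * n + c) = every_other (2 - c) T (n + c) \<odot> every_other (1 + c) T n"
proof (induction n)
  case 0
  consider "c = 0" | "c = 1" using c by linarith
  then show ?case by cases (auto simp: every_other_0 every_other_Suc)
next
  case (Suc n)
  let ?E = "\<lambda>k. embed2 k (T k)"
  let ?A = "every_other (2 - c) T (n + c)" and ?Q = "every_other (1 + c) T n"
  let ?a = "?E (2 * n + 2 + c)" and ?b = "?E (2 * n + 1 + c)"
  have f: "finitary ?A" "finitary ?Q" "finitary ?a" "finitary ?b"
    using c by (auto intro!: finitary_every_other finitary_embed2)
  have "zigzag app T (2 * Suc n + c) = ?A \<odot> ?Q \<odot> (?a \<odot> ?b)"
    using zigzag_pair[of app "2 * n + c" T] app Suc by simp
  also have "\<dots> = ?A \<odot> (?Q \<odot> ?a) \<odot> ?b"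
    using f by (simp add: finitary_assoc finitary_mmult)
  also have "?Q \<odot> ?a = ?a \<odot> ?Q"
    by (rule corner_commute[OF _ corner_every_other]) auto
  also have "?A \<odot> (?a \<odot> ?Q) \<odot> ?b = (?A \<odot> ?a) \<odot> (?Q \<odot> ?b)"
    using f by (simp add: finitary_assoc finitary_mmult)
  also have "?A \<odot> ?a = every_other (2 - c) T (Suc n + c)"
  proof -
    have "2 * (n + c) + (2 - c) = 2 * n + 2 + c" using c by simp
    then show ?thesis using every_other_Suc[of "2 - c" T "n + c"] c by (simp add: add.commute)
  qed
  also have "?Q \<odot> ?b = every_other (1 + c) T (Suc n)"
    using every_other_Suc[of "1 + c" T n] by (simp add: add.commute add.left_commute)
  finally show ?case .
qed

lemma zigzag_limit_alternating:
  assumes c: "c \<le> 1" and app: "\<And>n. app (2 * n + c)" "\<And>n. \<not> app (Suc (2 * n + c))"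
  shows "zigzag_limit app T = every_other_limit (2 - c) T \<odot> every_other_limit (1 + c) T"
proof (intro ext)
  fix i k :: nat
  define N where "N = i + k + 2"
  have c': "1 \<le> 2 - c" "1 \<le> 1 + c" using c by auto
  have "zigzag_limit app T i k = zigzag app T (2 * N + c) i k"
    by (rule zigzag_limit_eq) (auto simp: N_def)
  also have "\<dots> = (\<Sum>j\<le>Suc i. every_other (2 - c) T (N + c) i j * every_other (1 + c) T N j k)"
    unfolding zigzag_alternating[of c app, OF c app]
    by (rule mmult_finite_sum) (use every_other_tridiagonal[OF c'(1)] in auto)
  also have "\<dots> = (\<Sum>j\<le>Suc i. every_other_limit (2 - c) T i j * every_other_limit (1 + c) T j k)"
    by (intro sum.cong refl arg_cong2[where f = "(*)"] every_other_limit_eq[symmetric] c')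
       (auto simp: N_def)
  also have "\<dots> = (every_other_limit (2 - c) T \<odot> every_other_limit (1 + c) T) i k"
    by (rule mmult_finite_sum[symmetric])
       (use every_other_tridiagonal[OF c'(1)] in \<open>auto simp: every_other_limit_def\<close>)
  finally show "zigzag_limit app T i k
      = (every_other_limit (2 - c) T \<odot> every_other_limit (1 + c) T) i k" .
qed

lemma five_diagonal_every_other:
  assumes "1 \<le> c" "1 \<le> d"
  shows "five_diagonal (every_other_limit c T \<odot> every_other_limit d S)"
  unfolding five_diagonal_def
proof (intro allI impI)
  fix i k :: nat
  assume far: "i + 2 < k \<or> k + 2 < i"
  have "every_other_limit c T i j * every_other_limit d S j k = 0" for j
  proof (cases "i + 1 < j \<or> j + 1 < i")
    case False
    then have "j + 1 < k \<or> k + 1 < j" using far by linarith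
    then show ?thesis using every_other_tridiagonal[OF assms(2)] by (simp add: every_other_limit_def)
  qed (use every_other_tridiagonal[OF assms(1)] in \<open>simp add: every_other_limit_def\<close>)
  then show "(every_other_limit c T \<odot> every_other_limit d S) i k = 0"
    unfolding mmult_def by (intro infsum_0) auto
qed

lemma beta_neq:
  assumes "cmod (\<alpha> j) < 1"
  shows "beta \<alpha> j \<noteq> Fin (\<alpha> j)"
proof
  assume "beta \<alpha> j = Fin (\<alpha> j)"
  then have "\<alpha> j * cnj (\<alpha> j) = 1" by (auto simp: beta_def field_simps split: if_splits)
  then have "cmod (\<alpha> j) * cmod (\<alpha> j) = 1" by (metis complex_mod_cnj norm_mult norm_one)
  moreover have "cmod (\<alpha> j) * cmod (\<alpha> j) < 1 * 1"
    using assms by (intro mult_strict_mono) auto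
  ultimately show False by simp
qed

lemma special_forms_ordered_product:
  assumes \<alpha>: "\<forall>j. cmod (\<alpha> j) < 1"
    and Ga: "\<And>n. Ga n = embed2 n (S n)" and Gb: "\<And>n. Gb n = embed2 n (R n)"
  shows "special_forms \<alpha> \<gamma> Ga Gb (ordered_product \<alpha> \<gamma> (select \<alpha> \<gamma> Ga Gb))"
proof -
  define T where "T n = (if \<gamma> n = Fin (\<alpha> n) then S n else R n)" for n
  define app where "app n \<longleftrightarrow> n = 0 \<or> \<gamma> n = Fin (\<alpha> n)" for n
  have G: "ordered_product \<alpha> \<gamma> (select \<alpha> \<gamma> Ga Gb) = zigzag_limit app T"
    unfolding app_def[abs_def]
    by (rule ordered_product_zigzag) (auto simp: select_def Ga Gb T_def)
  have beta: "beta \<alpha> j \<noteq> Fin (\<alpha> j)" for j using \<alpha> by (simp add: beta_neq)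
  show ?thesis unfolding special_forms_def G
  proof (intro conjI impI)
    assume all: "\<forall>j\<ge>1. \<gamma> j = Fin (\<alpha> j)"
    then have app: "app n" for n by (auto simp: app_def Suc_le_eq)
    show "hessenberg (zigzag_limit app T)"
      using hessenberg_zigzag[of app T, OF app] unfolding hessenberg_def zigzag_limit_def by blast
    have "mprod (map (\<lambda>k. Ga (k + 1)) [0..<n]) = zigzag app T n" for n
      using zigzag_appending[of app T, OF app, symmetric] all by (simp add: T_def Ga cong: map_cong)
    then show "has_mprod (\<lambda>k. Ga (k + 1)) (zigzag_limit app T)"
      by (rule has_mprod_zigzag_limit) simp
  next
    assume alt: "\<forall>j\<ge>1. \<gamma> j = (if odd j then Fin (\<alpha> j) else beta \<alpha> j)"
    then have app: "app (2 * n + 1)" "\<not> app (Suc (2 * n + 1))" for n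
      using beta by (auto simp: app_def)
    have E: "embed2 (2 * k + 1) (T (2 * k + 1)) = Ga (2 * k + 1)"
      "embed2 (2 * k + 2) (T (2 * k + 2)) = Gb (2 * k + 2)" for k
      using alt beta by (auto simp: T_def Ga Gb)
    have eq: "zigzag_limit app T = every_other_limit 1 T \<odot> every_other_limit 2 T"
      using zigzag_limit_alternating[of 1 app T, OF _ app] by (simp add: numeral_2_eq_2)
    then show "five_diagonal (zigzag_limit app T)" by (simp add: five_diagonal_every_other)
    let ?H = "\<lambda>k. if k = 0 then Ga 1 else Ga (2 * k + 1) \<odot> Gb (2 * k)"
    have "mprod (map ?H [0..<Suc n]) = zigzag app T (2 * n + 1)" for n
    proof (induction n)
      case 0
      then show ?case using E(1)[of 0] by (simp add: Ga)
    next
      case (Suc n)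
      have fin: "finitary (?H k)" for k by (auto simp: Ga Gb intro!: finitary_mmult finitary_embed2)
      have "mprod (map ?H [0..<Suc (Suc n)]) = mprod (map ?H [0..<Suc n] @ [?H (Suc n)])" by simp
      also have "\<dots> = mprod (map ?H [0..<Suc n]) \<odot> ?H (Suc n)"
        by (rule mprod_snoc, unfold set_map image_iff) (blast intro: fin)+
      finally show ?case
        using Suc zigzag_pair[of app "2 * n + 1" T, OF app] E(1)[of "Suc n"] E(2)[of n] by simp
    qed
    then have "mprod (map ?H [0..<n]) = zigzag app T (2 * n - 1)" for n
      by (cases n) auto
    then show "has_mprod ?H (zigzag_limit app T)"
      by (rule has_mprod_zigzag_limit) simp
    show "\<exists>P Q. has_mprod (\<lambda>k. Ga (2 * k + 1)) P \<and> has_mprod (\<lambda>k. Gb (2 * k + 2)) Q \<and>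
        zigzag_limit app T = P \<odot> Q"
      using eq has_mprod_every_other[of 1 "\<lambda>k. Ga (2 * k + 1)" T]
        has_mprod_every_other[of 2 "\<lambda>k. Gb (2 * k + 2)" T] E by auto
  next
    assume alt: "\<forall>j\<ge>1. \<gamma> j = (if odd j then beta \<alpha> j else Fin (\<alpha> j))"
    then have app: "app (2 * n + 0)" "\<not> app (Suc (2 * n + 0))" for n
      using beta by (cases n; auto simp: app_def)+
    have E: "embed2 (2 * k + 1) (T (2 * k + 1)) = Gb (2 * k + 1)"
      "embed2 (2 * k + 2) (T (2 * k + 2)) = Ga (2 * k + 2)" for k
      using alt beta by (auto simp: T_def Ga Gb)
    have eq: "zigzag_limit app T = every_other_limit 2 T \<odot> every_other_limit 1 T"
      using zigzag_limit_alternating[of 0 app T, OF _ app] by simp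
    then show "five_diagonal (zigzag_limit app T)" by (simp add: five_diagonal_every_other)
    let ?H = "\<lambda>k. Ga (2 * k + 2) \<odot> Gb (2 * k + 1)"
    have "mprod (map ?H [0..<n]) = zigzag app T (2 * n)" for n
    proof (induction n)
      case (Suc n)
      have fin: "finitary (?H k)" for k by (auto simp: Ga Gb intro!: finitary_mmult finitary_embed2)
      have "mprod (map ?H [0..<Suc n]) = mprod (map ?H [0..<n] @ [?H n])" by simp
      also have "\<dots> = mprod (map ?H [0..<n]) \<odot> ?H n"
        by (rule mprod_snoc, unfold set_map image_iff) (blast intro: fin)+
      finally show ?case
        using Suc zigzag_pair[of app "2 * n + 0" T, OF app] E[of n] by simp
    qed simp
    then show "has_mprod ?H (zigzag_limit app T)"
      by (rule has_mprod_zigzag_limit) simp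
    show "\<exists>P Q. has_mprod (\<lambda>k. Ga (2 * k + 2)) P \<and> has_mprod (\<lambda>k. Gb (2 * k + 1)) Q \<and>
        zigzag_limit app T = P \<odot> Q"
      using eq has_mprod_every_other[of 2 "\<lambda>k. Ga (2 * k + 2)" T]
        has_mprod_every_other[of 1 "\<lambda>k. Gb (2 * k + 1)" T] E by auto
  qed
qed

section \<open>Matrices acting on square-summable sequences\<close>

definition sqnorm :: "(nat \<Rightarrow> complex) \<Rightarrow> real" where
  "sqnorm x = (\<Sum>n. (cmod (x n))\<^sup>2)"

definition trunc :: "nat \<Rightarrow> (nat \<Rightarrow> complex) \<Rightarrow> nat \<Rightarrow> complex" where
  "trunc m x = (\<lambda>n. if n < m then x n else 0)"

lemma cmod_add_sq_le: "(cmod (a + b))\<^sup>2 \<le> 2 * (cmod a)\<^sup>2 + 2 * (cmod b)\<^sup>2"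
proof -
  have "(cmod (a + b))\<^sup>2 \<le> (cmod a + cmod b)\<^sup>2"
    by (simp add: norm_triangle_ineq power_mono)
  also have "\<dots> \<le> 2 * (cmod a)\<^sup>2 + 2 * (cmod b)\<^sup>2"
    using sum_squares_bound[of "cmod a" "cmod b"] by (simp add: power2_sum)
  finally show ?thesis .
qed

lemma cmod_diff_sq_le: "(cmod (a - b))\<^sup>2 \<le> 2 * (cmod a)\<^sup>2 + 2 * (cmod b)\<^sup>2"
  using cmod_add_sq_le[of a "- b"] by simp

lemma tendsto_0_if_sq:
  fixes f :: "nat \<Rightarrow> complex"
  assumes "(\<lambda>m. (cmod (f m))\<^sup>2) \<longlonglongrightarrow> 0"
  shows "f \<longlonglongrightarrow> 0"
  using tendsto_real_sqrt[OF assms] by (simp add: tendsto_norm_zero_iff)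

lemma infsum_diff:
  fixes f g :: "'a \<Rightarrow> complex"
  assumes "f summable_on A" "g summable_on A"
  shows "(\<Sum>\<^sub>\<infinity>x\<in>A. f x - g x) = (\<Sum>\<^sub>\<infinity>x\<in>A. f x) - (\<Sum>\<^sub>\<infinity>x\<in>A. g x)"
  using infsum_add[OF assms(1), of "\<lambda>x. - g x"] assms(2)
  by (simp add: summable_on_uminus infsum_uminus)

lemma infsum_lessThan_swap:
  fixes f :: "nat \<Rightarrow> 'a \<Rightarrow> complex"
  assumes "\<And>j. f j summable_on A"
  shows "(\<lambda>x. \<Sum>j<m. f j x) summable_on A \<and> (\<Sum>\<^sub>\<infinity>x\<in>A. \<Sum>j<m. f j x) = (\<Sum>j<m. \<Sum>\<^sub>\<infinity>x\<in>A. f j x)"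
  by (induction m) (auto simp: infsum_add summable_on_add assms)

lemma l2_summable: "x \<in> l2 \<Longrightarrow> summable (\<lambda>n. (cmod (x n))\<^sup>2)"
  by (simp add: l2_def)

lemma sqnorm_nonneg: "x \<in> l2 \<Longrightarrow> 0 \<le> sqnorm x"
  unfolding sqnorm_def by (rule suminf_nonneg[OF l2_summable]) auto

lemma cmod_sq_le_sqnorm: "x \<in> l2 \<Longrightarrow> (cmod (x n))\<^sup>2 \<le> sqnorm x"
  unfolding sqnorm_def using sum_le_suminf[OF l2_summable, of x "{n}"] by simp

lemma l2_dominated:
  assumes "x \<in> l2" "\<And>n. cmod (y n) \<le> cmod (x n)"
  shows "y \<in> l2" "sqnorm y \<le> sqnorm x"
proof -
  have le: "(cmod (y n))\<^sup>2 \<le> (cmod (x n))\<^sup>2" for n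
    using assms(2) by (simp add: power_mono)
  show y: "y \<in> l2" unfolding l2_def
    using summable_comparison_test'[OF l2_summable[OF assms(1)], of 0 "\<lambda>n. (cmod (y n))\<^sup>2"] le by simp
  show "sqnorm y \<le> sqnorm x" unfolding sqnorm_def
    by (rule suminf_le[OF le l2_summable[OF y] l2_summable[OF assms(1)]])
qed

lemma l2_diff:
  assumes "x \<in> l2" "y \<in> l2"
  shows "(\<lambda>n. x n - y n) \<in> l2"
proof -
  have "summable (\<lambda>n. 2 * (cmod (x n))\<^sup>2 + 2 * (cmod (y n))\<^sup>2)"
    using assms by (intro summable_add summable_mult l2_summable)
  then have "summable (\<lambda>n. (cmod (x n - y n))\<^sup>2)"
    by (rule summable_comparison_test') (use cmod_diff_sq_le in auto)
  then show ?thesis by (simp add: l2_def)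
qed

lemma l2_scale: "x \<in> l2 \<Longrightarrow> (\<lambda>n. c * x n) \<in> l2"
  by (simp add: l2_def norm_mult power_mult_distrib summable_mult)

lemma l2_finite_support: "finite F \<Longrightarrow> (\<And>n. n \<notin> F \<Longrightarrow> x n = 0) \<Longrightarrow> x \<in> l2"
  unfolding l2_def by (auto intro!: summable_finite[of F])

lemma l2_trunc: "trunc m x \<in> l2"
  by (rule l2_finite_support[of "{..<m}"]) (auto simp: trunc_def)

lemma sqnorm_tail_tendsto_0:
  assumes "x \<in> l2"
  shows "(\<lambda>m. sqnorm (\<lambda>n. x n - trunc m x n)) \<longlonglongrightarrow> 0"
proof -
  have "sqnorm (\<lambda>n. x n - trunc m x n) = sqnorm x - (\<Sum>n<m. (cmod (x n))\<^sup>2)" for m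
  proof -
    have "sqnorm (\<lambda>n. x n - trunc m x n)
        = (\<Sum>n. (cmod (x n))\<^sup>2 - (cmod (trunc m x n))\<^sup>2)"
      unfolding sqnorm_def by (rule suminf_cong) (simp add: trunc_def)
    also have "\<dots> = sqnorm x - sqnorm (trunc m x)"
      unfolding sqnorm_def by (intro suminf_diff[symmetric] l2_summable assms l2_trunc)
    also have "sqnorm (trunc m x) = (\<Sum>n<m. (cmod (trunc m x n))\<^sup>2)"
      unfolding sqnorm_def by (rule suminf_finite) (auto simp: trunc_def)
    finally show ?thesis by (simp add: trunc_def)
  qed
  moreover have "(\<lambda>m. sqnorm x - (\<Sum>n<m. (cmod (x n))\<^sup>2)) \<longlonglongrightarrow> sqnorm x - sqnorm x"
    unfolding sqnorm_def by (intro tendsto_diff tendsto_const summable_LIMSEQ l2_summable assms)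
  ultimately show ?thesis by simp
qed

lemma bounded_mat_summable: "bounded_mat X \<Longrightarrow> x \<in> l2 \<Longrightarrow> (\<lambda>j. X i j * x j) summable_on UNIV"
  and bounded_mat_l2: "bounded_mat X \<Longrightarrow> x \<in> l2 \<Longrightarrow> mvec X x \<in> l2"
  unfolding bounded_mat_def by blast+

lemma bounded_matE:
  assumes "bounded_mat X"
  obtains C where "0 \<le> C" "\<And>x. x \<in> l2 \<Longrightarrow> sqnorm (mvec X x) \<le> C * sqnorm x"
proof -
  from assms obtain C where C: "\<And>x. x \<in> l2 \<Longrightarrow> sqnorm (mvec X x) \<le> C * sqnorm x"
    unfolding bounded_mat_def sqnorm_def by blast
  have "sqnorm (mvec X x) \<le> \<bar>C\<bar> * sqnorm x" if "x \<in> l2" for x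
    using C[OF that] mult_right_mono[of C "\<bar>C\<bar>" "sqnorm x"] sqnorm_nonneg[OF that] by linarith
  with C that[of "\<bar>C\<bar>"] show thesis by auto
qed

lemma mvec_finite_sum:
  "finite F \<Longrightarrow> (\<And>j. j \<notin> F \<Longrightarrow> x j = 0) \<Longrightarrow> mvec X x i = (\<Sum>j\<in>F. X i j * x j)"
  unfolding mvec_def by (rule infsum_finite_support) auto

lemma mvec_trunc: "mvec X (trunc m x) i = (\<Sum>j<m. X i j * x j)"
  by (subst mvec_finite_sum[of "{..<m}"]) (auto simp: trunc_def)

lemma mvec_diff:
  assumes "bounded_mat X" "x \<in> l2" "y \<in> l2"
  shows "mvec X (\<lambda>n. x n - y n) = (\<lambda>i. mvec X x i - mvec X y i)"
proof
  fix i
  show "mvec X (\<lambda>n. x n - y n) i = mvec X x i - mvec X y i"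
    unfolding mvec_def right_diff_distrib by (intro infsum_diff bounded_mat_summable assms)
qed

lemma bounded_mat_column: "bounded_mat X \<Longrightarrow> (\<lambda>i. X i k) \<in> l2"
proof -
  assume X: "bounded_mat X"
  define e where "e n = (if n = k then 1 else 0 :: complex)" for n
  have "e \<in> l2" by (rule l2_finite_support[of "{k}"]) (auto simp: e_def)
  then have "mvec X e \<in> l2" by (rule bounded_mat_l2[OF X])
  moreover have "mvec X e i = X i k" for i
    by (subst mvec_finite_sum[of "{k}"]) (auto simp: e_def)
  ultimately show ?thesis by (simp add: l2_def)
qed

lemma mmult_eq_mvec: "(X \<odot> Y) i k = mvec X (\<lambda>j. Y j k) i"
  by (simp add: mmult_def mvec_def)

lemma sqnorm_mvec_trunc_tendsto:
  assumes "bounded_mat X" "x \<in> l2"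
  shows "(\<lambda>m. sqnorm (\<lambda>i. mvec X x i - (\<Sum>j<m. X i j * x j))) \<longlonglongrightarrow> 0"
proof -
  obtain C where C: "0 \<le> C" "\<And>x. x \<in> l2 \<Longrightarrow> sqnorm (mvec X x) \<le> C * sqnorm x"
    using bounded_matE[OF assms(1)] by blast
  let ?r = "\<lambda>m n. x n - trunc m x n"
  have r: "?r m \<in> l2" for m using assms(2) by (intro l2_diff l2_trunc)
  have "(\<lambda>i. mvec X x i - (\<Sum>j<m. X i j * x j)) = mvec X (?r m)" for m
    unfolding mvec_diff[OF assms l2_trunc] mvec_trunc ..
  moreover have "(\<lambda>m. sqnorm (mvec X (?r m))) \<longlonglongrightarrow> 0"
  proof (rule tendsto_sandwich[of "\<lambda>_. 0" _ _ "\<lambda>m. C * sqnorm (?r m)"])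
    show "(\<lambda>m. C * sqnorm (?r m)) \<longlonglongrightarrow> 0"
      using tendsto_mult_left[OF sqnorm_tail_tendsto_0[OF assms(2)], of C] by simp
  qed (use C r in \<open>auto intro!: always_eventually sqnorm_nonneg bounded_mat_l2 assms\<close>)
  ultimately show ?thesis by simp
qed

text \<open>
  Associativity \<open>X (Y x) = (X Y) x\<close> for bounded matrices, with the right-hand side as the limit
  of its partial sums: both sides agree on truncated vectors, and the left-hand side is
  continuous.
\<close>

lemma mvec_mvec_tendsto:
  assumes X: "bounded_mat X" and Y: "bounded_mat Y" and x: "x \<in> l2"
  shows "(\<lambda>m. \<Sum>j<m. (X \<odot> Y) i j * x j) \<longlonglongrightarrow> mvec X (mvec Y x) i"
proof -
  obtain C where C: "0 \<le> C" "\<And>x. x \<in> l2 \<Longrightarrow> sqnorm (mvec X x) \<le> C * sqnorm x"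
    using bounded_matE[OF X] by blast
  note D = bounded_mat_l2[OF Y]
  have eq: "(\<Sum>j<m. (X \<odot> Y) i j * x j) = mvec X (mvec Y (trunc m x)) i" for m
  proof -
    have "(\<Sum>j<m. (X \<odot> Y) i j * x j) = (\<Sum>j<m. \<Sum>\<^sub>\<infinity>l. X i l * Y l j * x j)"
      unfolding mmult_def
      by (intro sum.cong refl infsum_cmult_left[symmetric])
         (use bounded_mat_summable[OF X bounded_mat_column[OF Y]] in auto)
    also have "\<dots> = (\<Sum>\<^sub>\<infinity>l. \<Sum>j<m. X i l * Y l j * x j)"
      by (rule infsum_lessThan_swap[THEN conjunct2, symmetric])
         (use bounded_mat_summable[OF X bounded_mat_column[OF Y]] in \<open>auto intro!: summable_on_cmult_left\<close>)
    also have "\<dots> = mvec X (mvec Y (trunc m x)) i"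
      unfolding mvec_trunc[abs_def] mvec_def[of X] by (simp add: sum_distrib_left mult.assoc)
    finally show ?thesis .
  qed
  let ?r = "\<lambda>m n. mvec Y x n - mvec Y (trunc m x) n"
  have r: "?r m \<in> l2" for m using x by (intro l2_diff D l2_trunc)
  have "(\<lambda>m. (cmod (mvec X (?r m) i))\<^sup>2) \<longlonglongrightarrow> 0"
  proof (rule tendsto_sandwich[of "\<lambda>_. 0" _ _ "\<lambda>m. C * sqnorm (?r m)"])
    show "(\<lambda>m. C * sqnorm (?r m)) \<longlonglongrightarrow> 0"
      using tendsto_mult_left[OF sqnorm_mvec_trunc_tendsto[OF Y x], of C] by (simp add: mvec_trunc)
    show "\<forall>\<^sub>F m in sequentially. (cmod (mvec X (?r m) i))\<^sup>2 \<le> C * sqnorm (?r m)"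
      using order_trans[OF cmod_sq_le_sqnorm[OF bounded_mat_l2[OF X r]] C(2)[OF r]] by auto
  qed auto
  then have "(\<lambda>m. mvec X (?r m) i) \<longlonglongrightarrow> 0"
    by (rule tendsto_0_if_sq)
  then have "(\<lambda>m. mvec X (mvec Y x) i - mvec X (mvec Y (trunc m x)) i) \<longlonglongrightarrow> 0"
    by (simp add: mvec_diff[OF X D[OF x] D[OF l2_trunc]])
  from tendsto_diff[OF tendsto_const[of "mvec X (mvec Y x) i"] this] show ?thesis by (simp add: eq)
qed

lemma mvec_mone: "mvec mone x = x"
proof
  fix i
  have "mvec mone x i = (\<Sum>j\<in>{i}. mone i j * x j)"
    unfolding mvec_def by (rule infsum_finite_support) (auto simp: mone_apply)
  then show "mvec mone x i = x i" by (simp add: mone_apply)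
qed

text \<open>
  For a bounded left inverse associativity may be used on square-summable vectors, so a right
  inverse with square-summable columns must agree with it.
\<close>

lemma bounded_left_inverse_unique:
  assumes X: "bounded_mat X" and M: "bounded_mat M" and XM: "X \<odot> M = mone"
    and MN: "M \<odot> N = mone" and N: "\<And>k. (\<lambda>i. N i k) \<in> l2"
  shows "X = N"
proof (intro ext)
  fix i k
  have "(\<lambda>m. \<Sum>j<m. mone i j * N j k) \<longlonglongrightarrow> mvec X (mvec M (\<lambda>j. N j k)) i"
    using mvec_mvec_tendsto[OF X M N] unfolding XM .
  moreover have "mvec M (\<lambda>j. N j k) = (\<lambda>i. mone i k)"
    using mmult_eq_mvec[of M N _ k] unfolding MN by auto
  moreover have "mvec X (\<lambda>i. mone i k) i = X i k"
    using mmult_eq_mvec[of X mone i k] by simp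
  moreover have "(\<lambda>m. \<Sum>j<m. mone i j * N j k) \<longlonglongrightarrow> N i k"
  proof (rule tendsto_eventually, unfold eventually_sequentially, intro exI allI impI)
    fix m assume "Suc i \<le> m"
    then have "(\<Sum>j<m. mone i j * N j k) = (\<Sum>j\<in>{i}. mone i j * N j k)"
      by (intro sum.mono_neutral_right) (auto simp: mone_apply)
    then show "(\<Sum>j<m. mone i j * N j k) = N i k" by (simp add: mone_apply)
  qed
  ultimately show "X i k = N i k" using LIMSEQ_unique by metis
qed

text \<open>
  A uniform bound for the finite sections bounds the rows, as one sees by applying the section to
  the conjugate of a row; so the products with square-summable vectors converge absolutely, and
  the bound passes to the limit.
\<close>

lemma bounded_matI_finite_sections:
  assumes C: "0 \<le> C" and X: "\<And>r m x. (\<Sum>i<r. (cmod (\<Sum>j<m. X i j * x j))\<^sup>2) \<le> C * (\<Sum>j<m. (cmod (x j))\<^sup>2)"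
  shows "bounded_mat X"
proof -
  have row: "summable (\<lambda>j. (cmod (X i j))\<^sup>2)" for i
  proof (rule summableI_nonneg_bounded[of _ C])
    fix m
    let ?S = "\<Sum>j<m. (cmod (X i j))\<^sup>2"
    have "?S * ?S \<le> C * ?S"
    proof -
      have "complex_of_real ?S = (\<Sum>j<m. X i j * cnj (X i j))"
        by (simp only: of_real_sum complex_norm_square)
      then have "(cmod (\<Sum>j<m. X i j * cnj (X i j)))\<^sup>2 = (cmod (complex_of_real ?S))\<^sup>2"
        by simp
      then have "?S\<^sup>2 = (cmod (\<Sum>j<m. X i j * cnj (X i j)))\<^sup>2"
        by (simp only: norm_of_real power2_abs)
      also have "\<dots> \<le> (\<Sum>l<Suc i. (cmod (\<Sum>j<m. X l j * cnj (X i j)))\<^sup>2)"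
        by (simp add: sum_nonneg)
      also have "\<dots> \<le> C * ?S" 
        using X[where r = "Suc i" and m = m and x = "\<lambda>j. cnj (X i j)"] by (simp only: complex_mod_cnj)
      finally show ?thesis by (simp add: power2_eq_square)
    qed
    then show "?S \<le> C" using C
      by (smt (verit) mult_le_cancel_right sum_nonneg zero_le_power2)
  qed simp
  have main: "(\<lambda>j. X i j * x j) summable_on UNIV \<and> (\<lambda>m. \<Sum>j<m. X i j * x j) \<longlonglongrightarrow> mvec X x i"
    if x: "x \<in> l2" for x i
  proof -
    have "summable (\<lambda>j. (cmod (X i j))\<^sup>2 + (cmod (x j))\<^sup>2)"
      by (intro summable_add row l2_summable x)
    then have n: "summable (\<lambda>j. cmod (X i j * x j))"
    proof (rule summable_comparison_test')
      fix j
      have "cmod (X i j) * cmod (x j) \<le> (cmod (X i j))\<^sup>2 + (cmod (x j))\<^sup>2"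
        using sum_squares_bound[of "cmod (X i j)" "cmod (x j)"]
          mult_nonneg_nonneg[OF norm_ge_zero norm_ge_zero, of "X i j" "x j"] by linarith
      then show "norm (cmod (X i j * x j)) \<le> (cmod (X i j))\<^sup>2 + (cmod (x j))\<^sup>2"
        by (simp add: norm_mult)
    qed
    have hs: "((\<lambda>j. X i j * x j) has_sum (\<Sum>j. X i j * x j)) UNIV"
      by (rule norm_summable_imp_has_sum[OF n]) (rule summable_sums[OF summable_norm_cancel[OF n]])
    have e: "mvec X x i = (\<Sum>j. X i j * x j)" unfolding mvec_def by (rule infsumI[OF hs])
    show ?thesis using hs summable_LIMSEQ[OF summable_norm_cancel[OF n]]
      by (auto simp: e summable_on_def)
  qed
  have bd: "(\<Sum>i<r. (cmod (mvec X x i))\<^sup>2) \<le> C * sqnorm x" if x: "x \<in> l2" for x r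
  proof (rule LIMSEQ_le)
    show "(\<lambda>m. \<Sum>i<r. (cmod (\<Sum>j<m. X i j * x j))\<^sup>2) \<longlonglongrightarrow> (\<Sum>i<r. (cmod (mvec X x i))\<^sup>2)"
      by (intro tendsto_intros) (use main[OF x] in auto)
    show "(\<lambda>m. C * (\<Sum>j<m. (cmod (x j))\<^sup>2)) \<longlonglongrightarrow> C * sqnorm x"
      unfolding sqnorm_def by (intro tendsto_intros summable_LIMSEQ l2_summable x)
  qed (use X in auto)
  have s: "summable (\<lambda>i. (cmod (mvec X x i))\<^sup>2)" if "x \<in> l2" for x
    by (rule summableI_nonneg_bounded[OF _ bd[OF that]]) simp
  show ?thesis unfolding bounded_mat_def
  proof (intro exI ballI conjI allI)
    fix x :: "nat \<Rightarrow> complex" and i assume x: "x \<in> l2"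
    show "(\<lambda>j. X i j * x j) summable_on UNIV" using main[OF x] by blast
    show "mvec X x \<in> l2" using s[OF x] by (simp add: l2_def)
    show "(\<Sum>n. (cmod (mvec X x n))\<^sup>2) \<le> C * (\<Sum>n. (cmod (x n))\<^sup>2)"
      using suminf_le_const[OF s[OF x] bd[OF x]] by (simp add: sqnorm_def)
  qed
qed

lemma bounded_mat_add:
  assumes X: "bounded_mat X" and Y: "bounded_mat Y"
  shows "bounded_mat (X \<oplus> Y)"
proof -
  obtain C where C: "0 \<le> C" "\<And>x. x \<in> l2 \<Longrightarrow> sqnorm (mvec X x) \<le> C * sqnorm x"
    using bounded_matE[OF X] by blast
  obtain D where D: "0 \<le> D" "\<And>x. x \<in> l2 \<Longrightarrow> sqnorm (mvec Y x) \<le> D * sqnorm x"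
    using bounded_matE[OF Y] by blast
  show ?thesis unfolding bounded_mat_def
  proof (intro exI[of _ "2 * C + 2 * D"] ballI conjI allI)
    fix x :: "nat \<Rightarrow> complex" and i assume x: "x \<in> l2"
    show "(\<lambda>j. (X \<oplus> Y) i j * x j) summable_on UNIV"
      unfolding madd_def distrib_right by (intro summable_on_add bounded_mat_summable X Y x)
    have e: "mvec (X \<oplus> Y) x = (\<lambda>i. mvec X x i + mvec Y x i)"
      unfolding mvec_def madd_def distrib_right by (intro ext infsum_add bounded_mat_summable X Y x)
    have s: "summable (\<lambda>n. 2 * (cmod (mvec X x n))\<^sup>2 + 2 * (cmod (mvec Y x n))\<^sup>2)"
      by (intro summable_add summable_mult l2_summable bounded_mat_l2 X Y x)
    have s': "summable (\<lambda>n. (cmod (mvec X x n + mvec Y x n))\<^sup>2)"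
      by (rule summable_comparison_test'[OF s]) (use cmod_add_sq_le in auto)
    then show "mvec (X \<oplus> Y) x \<in> l2" unfolding e l2_def by simp
    have "(\<Sum>n. (cmod (mvec (X \<oplus> Y) x n))\<^sup>2) \<le> (\<Sum>n. 2 * (cmod (mvec X x n))\<^sup>2 + 2 * (cmod (mvec Y x n))\<^sup>2)"
      unfolding e by (rule suminf_le[OF cmod_add_sq_le s' s])
    also have "\<dots> = 2 * sqnorm (mvec X x) + 2 * sqnorm (mvec Y x)"
      using bounded_mat_l2[OF X x] bounded_mat_l2[OF Y x] unfolding sqnorm_def
      by (subst suminf_add[symmetric]) (auto intro!: summable_mult l2_summable simp: suminf_mult l2_summable)
    also have "\<dots> \<le> 2 * (C * sqnorm x) + 2 * (D * sqnorm x)"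
      using C(2)[OF x] D(2)[OF x] by linarith
    finally show "(\<Sum>n. (cmod (mvec (X \<oplus> Y) x n))\<^sup>2) \<le> (2 * C + 2 * D) * (\<Sum>n. (cmod (x n))\<^sup>2)"
      by (simp add: sqnorm_def algebra_simps)
  qed
qed

lemma bounded_mat_mdiag:
  assumes "\<And>j. cmod (d j) \<le> 1"
  shows "bounded_mat (mdiag d)"
proof (rule bounded_matI_finite_sections[of 1])
  fix r m and x :: "nat \<Rightarrow> complex"
  have "(\<Sum>j<m. mdiag d i j * x j) = (if i < m then d i * x i else 0)" for i
    by (simp add: mdiag_def if_distrib[of "\<lambda>c. c * _"] cong: if_cong)
  then have "(\<Sum>i<r. (cmod (\<Sum>j<m. mdiag d i j * x j))\<^sup>2)
      = (\<Sum>i<r. if i < m then (cmod (d i * x i))\<^sup>2 else 0)"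
    by (intro sum.cong) auto
  also have "\<dots> \<le> (\<Sum>i<r. if i < m then (cmod (x i))\<^sup>2 else 0)"
    using assms by (intro sum_mono) (auto simp: norm_mult power_mult_distrib mult_left_le_one_le power_le_one)
  also have "\<dots> = (\<Sum>i\<in>{..<r} \<inter> {..<m}. (cmod (x i))\<^sup>2)"
    by (simp add: sum.inter_restrict)
  also have "\<dots> \<le> (\<Sum>i<m. (cmod (x i))\<^sup>2)"
    by (rule sum_mono2) auto
  finally show "(\<Sum>i<r. (cmod (\<Sum>j<m. mdiag d i j * x j))\<^sup>2) \<le> 1 * (\<Sum>j<m. (cmod (x j))\<^sup>2)" by simp
qed simp

section \<open>Products of isometric factors\<close>

definition isometric2 :: "complex^2^2 \<Rightarrow> bool" where
  "isometric2 T \<longleftrightarrow> (\<forall>a b. (cmod (T$1$1 * a + T$1$2 * b))\<^sup>2 + (cmod (T$2$1 * a + T$2$2 * b))\<^sup>2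
      = (cmod a)\<^sup>2 + (cmod b)\<^sup>2)"

lemma embed2_apply_isometric:
  assumes "isometric2 T" "1 \<le> n" "n \<le> m"
  shows "(\<Sum>i\<le>m. (cmod (\<Sum>j\<le>m. embed2 n T i j * x j))\<^sup>2) = (\<Sum>j\<le>m. (cmod (x j))\<^sup>2)"
proof -
  have split: "(\<Sum>i\<le>m. f i) = f (n - 1) + f n + (\<Sum>i\<in>{..m} - {n - 1, n}. f i)" for f :: "nat \<Rightarrow> 'a::comm_monoid_add"
  proof -
    have "{..m} = {n - 1, n} \<union> ({..m} - {n - 1, n})" using assms(2,3) by auto
    then have "(\<Sum>i\<le>m. f i) = (\<Sum>i\<in>{n - 1, n}. f i) + (\<Sum>i\<in>{..m} - {n - 1, n}. f i)"
      by (metis Diff_disjoint finite.emptyI finite.insertI finite_Diff finite_atMost sum.union_disjoint)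
    also have "(\<Sum>i\<in>{n - 1, n}. f i) = f (n - 1) + f n" using assms(2) by auto
    finally show ?thesis .
  qed
  have off: "(\<Sum>j\<in>{..m} - {n - 1, n}. embed2 n T i j * x j) = (if i \<in> {n - 1, n} then 0 else x i)"
    if "i \<le> m" for i
  proof -
    have "(\<Sum>j\<in>{..m} - {n - 1, n}. embed2 n T i j * x j)
        = (\<Sum>j\<in>{..m} - {n - 1, n}. if j = i then x i else 0)"
      by (intro sum.cong) (auto simp: embed2_def)
    then show ?thesis using that by (simp add: sum.delta)
  qed
  have "(\<Sum>j\<le>m. embed2 n T i j * x j) =
      (if i = n - 1 then T$1$1 * x (n - 1) + T$1$2 * x n
       else if i = n then T$2$1 * x (n - 1) + T$2$2 * x n else x i)" if "i \<le> m" for i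
    using assms(2) by (subst split, subst off[OF that]) (auto simp: embed2_def)
  then have "(\<Sum>i\<le>m. (cmod (\<Sum>j\<le>m. embed2 n T i j * x j))\<^sup>2) =
      (\<Sum>i\<le>m. (cmod (if i = n - 1 then T$1$1 * x (n - 1) + T$1$2 * x n
       else if i = n then T$2$1 * x (n - 1) + T$2$2 * x n else x i))\<^sup>2)"
    by (intro sum.cong) auto
  also have "\<dots> = (\<Sum>j\<le>m. (cmod (x j))\<^sup>2)"
    unfolding split using assms(1,2) by (auto simp: isometric2_def intro!: sum.cong)
  finally show ?thesis .
qed

lemma zigzag_isometric:
  assumes T: "\<And>k. 1 \<le> k \<Longrightarrow> isometric2 (T k)" and "n \<le> m"
  shows "(\<Sum>i\<le>m. (cmod (\<Sum>j\<le>m. zigzag app T n i j * x j))\<^sup>2) = (\<Sum>j\<le>m. (cmod (x j))\<^sup>2)"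
  using assms(2)
proof (induction n arbitrary: x)
  case 0
  have "(\<Sum>j\<le>m. mone i j * x j) = x i" if "i \<le> m" for i
  proof -
    have "(\<Sum>j\<le>m. mone i j * x j) = (\<Sum>j\<le>m. if j = i then x i else 0)"
      by (intro sum.cong) (auto simp: mone_apply)
    then show ?thesis using that by simp
  qed
  then show ?case by simp
next
  case (Suc n)
  let ?E = "embed2 (Suc n) (T (Suc n))" and ?Z = "zigzag app T n"
  have comp: "(\<Sum>j\<le>m. (X \<odot> Y) i j * x j) = (\<Sum>l\<le>m. X i l * (\<Sum>j\<le>m. Y l j * x j))"
    if "\<And>j l. j \<le> m \<Longrightarrow> m < l \<Longrightarrow> Y l j = 0" for X Y i
  proof -
    have "(\<Sum>j\<le>m. (X \<odot> Y) i j * x j) = (\<Sum>j\<le>m. (\<Sum>l\<le>m. X i l * Y l j) * x j)"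
      by (intro sum.cong refl arg_cong2[where f = "(*)"] mmult_finite_sum) (use that in auto)
    also have "\<dots> = (\<Sum>l\<le>m. X i l * (\<Sum>j\<le>m. Y l j * x j))"
      by (simp add: sum_distrib_left sum_distrib_right mult.assoc) (rule sum.swap)
    finally show ?thesis .
  qed
  have E: "(\<Sum>i\<le>m. (cmod (\<Sum>j\<le>m. ?E i j * y j))\<^sup>2) = (\<Sum>j\<le>m. (cmod (y j))\<^sup>2)" for y
    using Suc.prems by (intro embed2_apply_isometric T) auto
  have Z: "(\<Sum>i\<le>m. (cmod (\<Sum>j\<le>m. ?Z i j * y j))\<^sup>2) = (\<Sum>j\<le>m. (cmod (y j))\<^sup>2)" for y
    using Suc by auto
  show ?case
  proof (cases "app n")
    case True
    have "(\<Sum>j\<le>m. zigzag app T (Suc n) i j * x j) = (\<Sum>l\<le>m. ?Z i l * (\<Sum>j\<le>m. ?E l j * x j))" for i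
      using True Suc.prems comp[of ?E ?Z i] by (simp add: embed2_def)
    then show ?thesis by (simp add: E Z)
  next
    case False
    have "(\<Sum>j\<le>m. zigzag app T (Suc n) i j * x j) = (\<Sum>l\<le>m. ?E i l * (\<Sum>j\<le>m. ?Z l j * x j))" for i
      using False Suc.prems comp[of ?Z ?E i] zigzag_outside[of n _ _ app T] by simp
    then show ?thesis by (simp add: E Z)
  qed
qed

text \<open>
  The ordered product is a contraction, because every finite section is a compression of an
  isometric partial product.
\<close>

lemma zigzag_limit_bounded:
  assumes T: "\<And>k. 1 \<le> k \<Longrightarrow> isometric2 (T k)"
  shows "bounded_mat (zigzag_limit app T)"
proof (rule bounded_matI_finite_sections[of 1])
  fix r m and x :: "nat \<Rightarrow> complex"
  let ?n = "max r m" and ?y = "trunc m x"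
  have "(\<Sum>i<r. (cmod (\<Sum>j<m. zigzag_limit app T i j * x j))\<^sup>2)
      = (\<Sum>i<r. (cmod (\<Sum>j\<le>?n. zigzag app T ?n i j * ?y j))\<^sup>2)"
  proof (rule sum.cong[OF refl], rule arg_cong[where f = "\<lambda>z. (cmod z)\<^sup>2"])
    fix i assume "i \<in> {..<r}"
    then have "(\<Sum>j<m. zigzag_limit app T i j * x j) = (\<Sum>j<m. zigzag app T ?n i j * ?y j)"
      by (intro sum.cong refl) (auto simp: trunc_def zigzag_limit_eq[of i ?n])
    also have "\<dots> = (\<Sum>j\<le>?n. zigzag app T ?n i j * ?y j)"
      by (rule sum.mono_neutral_left) (auto simp: trunc_def)
    finally show "(\<Sum>j<m. zigzag_limit app T i j * x j) = (\<Sum>j\<le>?n. zigzag app T ?n i j * ?y j)" .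
  qed
  also have "\<dots> \<le> (\<Sum>i\<le>?n. (cmod (\<Sum>j\<le>?n. zigzag app T ?n i j * ?y j))\<^sup>2)"
    by (rule sum_mono2) auto
  also have "\<dots> = (\<Sum>j\<le>?n. (cmod (?y j))\<^sup>2)" by (rule zigzag_isometric[OF T order_refl])
  also have "\<dots> = (\<Sum>j<m. (cmod (x j))\<^sup>2)"
    by (rule sum.mono_neutral_cong_right) (auto simp: trunc_def)
  finally show "(\<Sum>i<r. (cmod (\<Sum>j<m. zigzag_limit app T i j * x j))\<^sup>2) \<le> 1 * (\<Sum>j<m. (cmod (x j))\<^sup>2)"
    by simp
qed simp

section \<open>Scaling by the defect operator and by a diagonal unitary\<close>

definition defect :: "(nat \<Rightarrow> complex) \<Rightarrow> nat \<Rightarrow> real" where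
  "defect \<alpha> j = sqrt (1 - (cmod (\<alpha> j))\<^sup>2)"

lemma defect_pos: "cmod (\<alpha> j) < 1 \<Longrightarrow> 0 < defect \<alpha> j"
  by (simp add: defect_def power_less_one_iff abs_square_less_1)

lemma defect_positive: "\<forall>j. cmod (\<alpha> j) < 1 \<Longrightarrow> 0 < defect \<alpha> n"
  by (rule defect_pos) blast

lemma defect_sq: "cmod (\<alpha> j) < 1 \<Longrightarrow> (defect \<alpha> j)\<^sup>2 = 1 - (cmod (\<alpha> j))\<^sup>2"
  by (simp add: defect_def abs_square_le_1)

lemma defect_le_1: "defect \<alpha> j \<le> 1"
  by (simp add: defect_def)

lemma hat_apply: "hat \<alpha> G i j = G i j * of_real (defect \<alpha> j) / of_real (defect \<alpha> i)"
  by (simp add: hat_def etaA_inv_def etaA_def mdiag_mmult mmult_mdiag defect_def)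

lemma shifted_apply: "(mone \<oplus> madj (Amat \<alpha>) \<odot> X) i j = mone i j + cnj (\<alpha> i) * X i j"
proof -
  have "madj (Amat \<alpha>) = mdiag (\<lambda>j. cnj (\<alpha> j))"
    by (intro ext) (simp add: madj_def Amat_def mdiag_def)
  then show ?thesis by (simp add: madd_def mdiag_mmult)
qed

text \<open>
  \<open>I + A\<^sup>* hat G = \<eta>\<^sub>A\<^sup>-\<^sup>1 (I + A\<^sup>* G) \<eta>\<^sub>A\<close>, since diagonal matrices commute, so that \<open>\<eta>\<^sub>A N \<eta>\<^sub>A\<^sup>-\<^sup>1\<close> is
  an inverse of \<open>I + A\<^sup>* G\<close>. It has square-summable columns also if \<open>\<eta>\<^sub>A\<^sup>-\<^sup>1\<close> is unbounded, which
  makes it agree with the bounded inverse, if there is one.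
\<close>

lemma hat_inverse_transfer:
  assumes \<alpha>: "\<forall>j. cmod (\<alpha> j) < 1"
    and N: "l2_inverse (mone \<oplus> madj (Amat \<alpha>) \<odot> hat \<alpha> G) N"
  shows "\<exists>N'. formal_inverse (mone \<oplus> madj (Amat \<alpha>) \<odot> G) N' \<and>
           (\<forall>X. l2_inverse (mone \<oplus> madj (Amat \<alpha>) \<odot> G) X \<longrightarrow> X = N') \<and>
           (hat \<alpha> G \<oplus> Amat \<alpha>) \<odot> N = etaA_inv \<alpha> \<odot> (G \<oplus> Amat \<alpha>) \<odot> N' \<odot> etaA \<alpha>"
proof -
  let ?s = "\<lambda>j. complex_of_real (defect \<alpha> j)"
  let ?M = "mone \<oplus> madj (Amat \<alpha>) \<odot> hat \<alpha> G" and ?M' = "mone \<oplus> madj (Amat \<alpha>) \<odot> G"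
  define N' where "N' i j = ?s i * N i j / ?s j" for i j
  have s: "?s j \<noteq> 0" for j using defect_pos[of \<alpha> j] \<alpha> by auto
  have M: "?M' i j = ?s i * ?M i j / ?s j" for i j
    using s by (auto simp: shifted_apply hat_apply mone_apply)
  have bM: "bounded_mat ?M" and bN: "bounded_mat N" and MN: "?M \<odot> N = mone" and NM: "N \<odot> ?M = mone"
    using N by (auto simp: l2_inverse_def)
  have t1: "?M' i j * N' j k = (?s i / ?s k) * (?M i j * N j k)"
    and t2: "N' i j * ?M' j k = (?s i / ?s k) * (N i j * ?M j k)" for i j k
    using s[of j] s[of k] by (simp_all add: M N'_def)
  have inv: "?M' \<odot> N' = mone" "N' \<odot> ?M' = mone"
  proof -
    have "(?M' \<odot> N') i k = (?s i / ?s k) * (?M \<odot> N) i k" for i k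
      unfolding mmult_def[of ?M' N'] mmult_def[of ?M N] t1 by (rule infsum_cmult_right')
    then show "?M' \<odot> N' = mone" using MN s by (auto simp: mone_apply fun_eq_iff)
    have "(N' \<odot> ?M') i k = (?s i / ?s k) * (N \<odot> ?M) i k" for i k
      unfolding mmult_def[of N' ?M'] mmult_def[of N ?M] t2 by (rule infsum_cmult_right')
    then show "N' \<odot> ?M' = mone" using NM s by (auto simp: mone_apply fun_eq_iff)
  qed
  have "formal_inverse ?M' N'"
    unfolding formal_inverse_def t1 t2
    by (intro conjI allI summable_on_cmult_right inv bounded_mat_summable bounded_mat_column bM bN)
  moreover have "X = N'" if "l2_inverse ?M' X" for X
  proof (rule bounded_left_inverse_unique[of X ?M'])
    fix k
    have "(\<lambda>i. (1 / ?s k) * N i k) \<in> l2" by (intro l2_scale bounded_mat_column bN)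
    then show "(\<lambda>i. N' i k) \<in> l2"
    proof (rule l2_dominated)
      fix i
      have "defect \<alpha> i * (cmod (N i k) / \<bar>defect \<alpha> k\<bar>) \<le> 1 * (cmod (N i k) / \<bar>defect \<alpha> k\<bar>)"
        by (intro mult_right_mono defect_le_1) auto
      then show "cmod (N' i k) \<le> cmod (1 / ?s k * N i k)"
        using defect_pos[of \<alpha> i] \<alpha> by (simp add: N'_def norm_mult norm_divide)
    qed
  qed (use that inv in \<open>auto simp: l2_inverse_def\<close>)
  moreover have "(hat \<alpha> G \<oplus> Amat \<alpha>) \<odot> N = etaA_inv \<alpha> \<odot> (G \<oplus> Amat \<alpha>) \<odot> N' \<odot> etaA \<alpha>"
  proof (intro ext)
    fix i k
    have "(etaA_inv \<alpha> \<odot> (G \<oplus> Amat \<alpha>) \<odot> N' \<odot> etaA \<alpha>) i k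
        = (\<Sum>\<^sub>\<infinity>j. 1 / ?s i * (G \<oplus> Amat \<alpha>) i j * N' j k) * ?s k"
      unfolding etaA_inv_def etaA_def mdiag_mmult mmult_mdiag mmult_def[of _ N'] by (simp add: defect_def)
    also have "\<dots> = (\<Sum>\<^sub>\<infinity>j. 1 / ?s i * (G \<oplus> Amat \<alpha>) i j * N' j k * ?s k)"
      by (rule infsum_cmult_left'[symmetric])
    also have "\<dots> = ((hat \<alpha> G \<oplus> Amat \<alpha>) \<odot> N) i k"
      unfolding mmult_def using s
      by (intro infsum_cong) (auto simp: N'_def madd_def hat_apply Amat_def mdiag_def field_simps)
    finally show "((hat \<alpha> G \<oplus> Amat \<alpha>) \<odot> N) i k
        = (etaA_inv \<alpha> \<odot> (G \<oplus> Amat \<alpha>) \<odot> N' \<odot> etaA \<alpha>) i k" ..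
  qed
  ultimately show ?thesis by blast
qed

text \<open>
  Where \<open>\<bar>\<alpha>\<^sub>i\<bar>\<close> is at most \<open>1/2\<close>, row \<open>i\<close> of \<^term>\<open>hat \<alpha> G\<close> is controlled by \<^term>\<open>G\<close>; where it
  is larger, dividing row \<open>i\<close> of \<open>A\<^sup>* hat G\<close> by \<open>cnj \<alpha>\<^sub>i\<close> is harmless.  So \<^term>\<open>hat \<alpha> G\<close> is bounded
  even if the \<open>\<alpha>\<^sub>i\<close> accumulate at the circle.
\<close>

lemma hat_bounded:
  assumes \<alpha>: "\<forall>j. cmod (\<alpha> j) < 1" and G: "bounded_mat G"
    and M: "bounded_mat (mone \<oplus> madj (Amat \<alpha>) \<odot> hat \<alpha> G)"
  shows "bounded_mat (hat \<alpha> G)"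
proof -
  let ?s = "\<lambda>j. complex_of_real (defect \<alpha> j)"
  let ?M = "mone \<oplus> madj (Amat \<alpha>) \<odot> hat \<alpha> G"
  obtain C where C: "0 \<le> C" "\<And>x. x \<in> l2 \<Longrightarrow> sqnorm (mvec ?M x) \<le> C * sqnorm x"
    using bounded_matE[OF M] by blast
  obtain D where D: "0 \<le> D" "\<And>x. x \<in> l2 \<Longrightarrow> sqnorm (mvec G x) \<le> D * sqnorm x"
    using bounded_matE[OF G] by blast
  show ?thesis unfolding bounded_mat_def
  proof (intro exI[of _ "8 * C + 8 + 2 * D"] ballI conjI allI)
    fix x :: "nat \<Rightarrow> complex" and i assume x: "x \<in> l2"
    define y where "y j = ?s j * x j" for j
    have y: "y \<in> l2" "sqnorm y \<le> sqnorm x"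
      using \<alpha> defect_le_1 defect_pos[of \<alpha>]
      by (auto intro!: l2_dominated[OF x] simp: y_def norm_mult mult_left_le_one_le less_imp_le)
    have summand: "hat \<alpha> G i j * x j = (1 / ?s i) * (G i j * y j)" for i j
      by (simp add: hat_apply y_def)
    have sm: "(\<lambda>j. hat \<alpha> G i j * x j) summable_on UNIV" for i
      unfolding summand by (intro summable_on_cmult_right bounded_mat_summable G y)
    then show "(\<lambda>j. hat \<alpha> G i j * x j) summable_on UNIV" .
    have h: "mvec (hat \<alpha> G) x i = (1 / ?s i) * mvec G y i" for i
      unfolding mvec_def summand by (rule infsum_cmult_right')
    have m: "mvec ?M x i = x i + cnj (\<alpha> i) * mvec (hat \<alpha> G) x i" for i
    proof -
      have fin: "mvec mone x i = x i" by (simp add: mvec_mone)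
      have "(\<lambda>j. mone i j * x j) summable_on UNIV"
        by (rule finite_nonzero_values_imp_summable_on, rule finite_subset[of _ "{i}"])
           (auto simp: mone_apply split: if_splits)
      then have "mvec ?M x i = mvec mone x i + (\<Sum>\<^sub>\<infinity>j. cnj (\<alpha> i) * (hat \<alpha> G i j * x j))"
        unfolding mvec_def shifted_apply distrib_right mult.assoc
        by (intro infsum_add summable_on_cmult_right sm)
      then show ?thesis unfolding fin by (simp add: mvec_def infsum_cmult_right')
    qed
    have le: "(cmod (mvec (hat \<alpha> G) x i))\<^sup>2
        \<le> 8 * (cmod (mvec ?M x i))\<^sup>2 + 8 * (cmod (x i))\<^sup>2 + 2 * (cmod (mvec G y i))\<^sup>2" for i
    proof (cases "cmod (\<alpha> i) \<le> 1 / 2")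
      case True
      \<comment> \<open>\<open>1 - \<bar>\<alpha>\<^sub>i\<bar>\<^sup>2 \<ge> 3/4\<close>, so the scaling costs less than a factor 2\<close>
      then have "(cmod (\<alpha> i))\<^sup>2 \<le> (1 / 2)\<^sup>2" by (intro power_mono) auto
      then have "1 / (defect \<alpha> i)\<^sup>2 \<le> 2"
        using defect_sq[of \<alpha> i] \<alpha> by (simp add: field_simps power2_eq_square)
      then have "1 / (defect \<alpha> i)\<^sup>2 * (cmod (mvec G y i))\<^sup>2 \<le> 2 * (cmod (mvec G y i))\<^sup>2"
        by (intro mult_right_mono) auto
      moreover have "(cmod (mvec (hat \<alpha> G) x i))\<^sup>2 = 1 / (defect \<alpha> i)\<^sup>2 * (cmod (mvec G y i))\<^sup>2"
        by (simp add: h norm_divide power_divide)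
      moreover have "0 \<le> 8 * (cmod (mvec ?M x i))\<^sup>2 + 8 * (cmod (x i))\<^sup>2" by simp
      ultimately show ?thesis by linarith
    next
      case False
      \<comment> \<open>the row is \<open>(M x - x)\<^sub>i / cnj \<alpha>\<^sub>i\<close>; 8 is 2 from the square of a difference times 4\<close>
      then have "(1 / 2)\<^sup>2 \<le> (cmod (\<alpha> i))\<^sup>2" by (intro power_mono) auto
      then have "1 / 4 * (cmod (mvec (hat \<alpha> G) x i))\<^sup>2 \<le> (cmod (\<alpha> i))\<^sup>2 * (cmod (mvec (hat \<alpha> G) x i))\<^sup>2"
        by (intro mult_right_mono) (auto simp: power2_eq_square)
      also have "\<dots> = (cmod (mvec ?M x i - x i))\<^sup>2"
        by (simp add: m norm_mult power_mult_distrib)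
      also have "\<dots> \<le> 2 * (cmod (mvec ?M x i))\<^sup>2 + 2 * (cmod (x i))\<^sup>2" by (rule cmod_diff_sq_le)
      moreover have "0 \<le> 2 * (cmod (mvec G y i))\<^sup>2" by simp
      ultimately show ?thesis by linarith
    qed
    have l: "mvec ?M x \<in> l2" "mvec G y \<in> l2" by (intro bounded_mat_l2 M G x y)+
    have sums: "(\<lambda>i. 8 * (cmod (mvec ?M x i))\<^sup>2 + 8 * (cmod (x i))\<^sup>2 + 2 * (cmod (mvec G y i))\<^sup>2) sums
        (8 * sqnorm (mvec ?M x) + 8 * sqnorm x + 2 * sqnorm (mvec G y))"
      unfolding sqnorm_def by (intro sums_add sums_mult summable_sums l2_summable l x)
    have s: "summable (\<lambda>i. (cmod (mvec (hat \<alpha> G) x i))\<^sup>2)"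
      by (rule summable_comparison_test'[OF sums_summable[OF sums]]) (use le in auto)
    then show "mvec (hat \<alpha> G) x \<in> l2" by (simp add: l2_def)
    have "(\<Sum>n. (cmod (mvec (hat \<alpha> G) x n))\<^sup>2)
        \<le> 8 * sqnorm (mvec ?M x) + 8 * sqnorm x + 2 * sqnorm (mvec G y)"
      unfolding sums_unique[OF sums] by (rule suminf_le[OF le s sums_summable[OF sums]])
    also have "\<dots> \<le> 8 * (C * sqnorm x) + 8 * sqnorm x + 2 * (D * sqnorm x)"
      using C(2)[OF x] order_trans[OF D(2)[OF y(1)] mult_left_mono[OF y(2) D(1)]] by linarith
    finally show "(\<Sum>n. (cmod (mvec (hat \<alpha> G) x n))\<^sup>2) \<le> (8 * C + 8 + 2 * D) * (\<Sum>n. (cmod (x n))\<^sup>2)"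
      by (simp add: sqnorm_def algebra_simps)
  qed
qed

definition conjugate_by :: "(nat \<Rightarrow> complex) \<Rightarrow> imat \<Rightarrow> imat" where
  "conjugate_by \<tau> X = (\<lambda>i j. cnj (\<tau> i) * X i j * \<tau> j)"

lemma unimodular_cancel: "cmod t = 1 \<Longrightarrow> t * (cnj t * a) = a"
  by (metis complex_norm_square mult.assoc mult.left_neutral of_real_1 power_one)

lemma unimodular_cancel': "cmod t = 1 \<Longrightarrow> cnj t * (t * a) = a"
  using unimodular_cancel[of "cnj t"] by simp

lemma conjugate_by_mmult:
  assumes "\<And>j. cmod (\<tau> j) = 1"
  shows "conjugate_by \<tau> (X \<odot> Y) = conjugate_by \<tau> X \<odot> conjugate_by \<tau> Y"
proof (intro ext)
  fix i k
  have "conjugate_by \<tau> (X \<odot> Y) i k = (\<Sum>\<^sub>\<infinity>j. cnj (\<tau> i) * (X i j * Y j k) * \<tau> k)"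
    unfolding conjugate_by_def mmult_def by (simp only: infsum_cmult_left' infsum_cmult_right')
  also have "\<dots> = (conjugate_by \<tau> X \<odot> conjugate_by \<tau> Y) i k"
    unfolding conjugate_by_def mmult_def
    by (intro infsum_cong) (simp add: unimodular_cancel assms mult.assoc)
  finally show "conjugate_by \<tau> (X \<odot> Y) i k = (conjugate_by \<tau> X \<odot> conjugate_by \<tau> Y) i k" .
qed

lemma conjugate_by_madd: "conjugate_by \<tau> (X \<oplus> Y) = conjugate_by \<tau> X \<oplus> conjugate_by \<tau> Y"
  by (auto simp: conjugate_by_def madd_def algebra_simps)

lemma conjugate_by_mdiag:
  assumes "\<And>j. cmod (\<tau> j) = 1"
  shows "conjugate_by \<tau> (mdiag d) = mdiag d"
proof (intro ext)
  fix i j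
  have "cnj (\<tau> i) * d i * \<tau> i = d i"
    using unimodular_cancel'[OF assms, of i "d i"] by (simp add: mult_ac)
  then show "conjugate_by \<tau> (mdiag d) i j = mdiag d i j"
    unfolding conjugate_by_def mdiag_def by (cases "i = j") simp_all
qed

lemma conjugate_by_shifted:
  assumes "\<And>j. cmod (\<tau> j) = 1"
  shows "conjugate_by \<tau> (mone \<oplus> madj (Amat \<alpha>) \<odot> hat \<alpha> G)
      = mone \<oplus> madj (Amat \<alpha>) \<odot> hat \<alpha> (conjugate_by \<tau> G)"
proof (intro ext)
  fix i j
  have "conjugate_by \<tau> mone i j = mone i j"
    unfolding mone_def by (simp add: conjugate_by_mdiag assms)
  then show "conjugate_by \<tau> (mone \<oplus> madj (Amat \<alpha>) \<odot> hat \<alpha> G) i j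
      = (mone \<oplus> madj (Amat \<alpha>) \<odot> hat \<alpha> (conjugate_by \<tau> G)) i j"
    unfolding conjugate_by_def shifted_apply by (simp add: hat_apply algebra_simps)
qed

lemma bounded_mat_conjugate_by:
  assumes \<tau>: "\<And>j. cmod (\<tau> j) = 1" and X: "bounded_mat X"
  shows "bounded_mat (conjugate_by \<tau> X)"
proof -
  obtain C where C: "0 \<le> C" "\<And>x. x \<in> l2 \<Longrightarrow> sqnorm (mvec X x) \<le> C * sqnorm x"
    using bounded_matE[OF X] by blast
  show ?thesis unfolding bounded_mat_def
  proof (intro exI[of _ C] ballI conjI allI)
    fix x :: "nat \<Rightarrow> complex" and i assume x: "x \<in> l2"
    define y where "y j = \<tau> j * x j" for j
    have y: "y \<in> l2" "sqnorm y \<le> sqnorm x"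
      by (auto intro!: l2_dominated[OF x] simp: y_def norm_mult \<tau>)
    have summand: "conjugate_by \<tau> X i j * x j = cnj (\<tau> i) * (X i j * y j)" for i j
      by (simp add: conjugate_by_def y_def)
    show "(\<lambda>j. conjugate_by \<tau> X i j * x j) summable_on UNIV"
      unfolding summand by (intro summable_on_cmult_right bounded_mat_summable X y)
    have m: "mvec (conjugate_by \<tau> X) x i = cnj (\<tau> i) * mvec X y i" for i
      unfolding mvec_def summand by (rule infsum_cmult_right')
    have l: "mvec X y \<in> l2" by (intro bounded_mat_l2 X y)
    then have "mvec (conjugate_by \<tau> X) x \<in> l2" "sqnorm (mvec (conjugate_by \<tau> X) x) \<le> sqnorm (mvec X y)"
      by (auto intro!: l2_dominated[OF l] simp: m norm_mult \<tau>)
    then show "mvec (conjugate_by \<tau> X) x \<in> l2"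
      "(\<Sum>n. (cmod (mvec (conjugate_by \<tau> X) x n))\<^sup>2) \<le> C * (\<Sum>n. (cmod (x n))\<^sup>2)"
      using C(2)[OF y(1)] mult_left_mono[OF y(2) C(1)] by (auto simp: sqnorm_def)
  qed
qed

lemma mult_matrix_relations_conjugate_by:
  assumes \<alpha>: "\<forall>j. cmod (\<alpha> j) < 1" and \<tau>: "\<And>j. cmod (\<tau> j) = 1"
    and N: "l2_inverse (mone \<oplus> madj (Amat \<alpha>) \<odot> hat \<alpha> G) N"
    and z: "mult_by_z \<mu> \<Phi> ((hat \<alpha> G \<oplus> Amat \<alpha>) \<odot> N)"
  shows "l2_inverse (mone \<oplus> madj (Amat \<alpha>) \<odot> hat \<alpha> (conjugate_by \<tau> G)) (conjugate_by \<tau> N)"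
    and "mult_matrix_relations \<mu> \<alpha> (\<lambda>n z. \<tau> n * \<Phi> n z) (conjugate_by \<tau> G) (conjugate_by \<tau> N)"
proof -
  have one: "conjugate_by \<tau> mone = mone"
    unfolding mone_def by (rule conjugate_by_mdiag[OF \<tau>])
  show N': "l2_inverse (mone \<oplus> madj (Amat \<alpha>) \<odot> hat \<alpha> (conjugate_by \<tau> G)) (conjugate_by \<tau> N)"
    using N unfolding l2_inverse_def conjugate_by_shifted[OF \<tau>, symmetric]
    by (auto intro: bounded_mat_conjugate_by \<tau> simp: conjugate_by_mmult[OF \<tau>, symmetric] one)
  have "(hat \<alpha> (conjugate_by \<tau> G) \<oplus> Amat \<alpha>) \<odot> conjugate_by \<tau> N
      = conjugate_by \<tau> ((hat \<alpha> G \<oplus> Amat \<alpha>) \<odot> N)"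
  proof -
    have "hat \<alpha> (conjugate_by \<tau> G) = conjugate_by \<tau> (hat \<alpha> G)"
      by (intro ext) (simp add: hat_apply conjugate_by_def mult.assoc)
    then show ?thesis
      unfolding conjugate_by_mmult[OF \<tau>] conjugate_by_madd Amat_def conjugate_by_mdiag[OF \<tau>] by simp
  qed
  moreover have "mult_by_z \<mu> (\<lambda>n z. \<tau> n * \<Phi> n z) (conjugate_by \<tau> ((hat \<alpha> G \<oplus> Amat \<alpha>) \<odot> N))"
  proof -
    let ?U = "(hat \<alpha> G \<oplus> Amat \<alpha>) \<odot> N"
    have "z * (\<tau> k * \<Phi> k z) - (\<Sum>j<n. \<tau> j * \<Phi> j z * conjugate_by \<tau> ?U j k)
        = \<tau> k * (z * \<Phi> k z - (\<Sum>j<n. \<Phi> j z * ?U j k))" for z k n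
    proof -
      have "(\<Sum>j<n. \<tau> j * \<Phi> j z * conjugate_by \<tau> ?U j k) = (\<Sum>j<n. \<tau> k * (\<Phi> j z * ?U j k))"
      proof (rule sum.cong[OF refl])
        fix j
        show "\<tau> j * \<Phi> j z * conjugate_by \<tau> ?U j k = \<tau> k * (\<Phi> j z * ?U j k)"
          using unimodular_cancel[OF \<tau>, of j "\<tau> k * (\<Phi> j z * ?U j k)"]
          by (simp add: conjugate_by_def mult_ac)
      qed
      then show ?thesis by (simp add: right_diff_distrib sum_distrib_left)
    qed
    then have "cmod (z * (\<tau> k * \<Phi> k z) - (\<Sum>j<n. \<tau> j * \<Phi> j z * conjugate_by \<tau> ?U j k))
        = cmod (z * \<Phi> k z - (\<Sum>j<n. \<Phi> j z * ?U j k))" for z k n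
      by (simp add: norm_mult \<tau>)
    with z show ?thesis by (simp add: mult_by_z_def)
  qed
  ultimately show "mult_matrix_relations \<mu> \<alpha> (\<lambda>n z. \<tau> n * \<Phi> n z) (conjugate_by \<tau> G) (conjugate_by \<tau> N)"
    unfolding mult_matrix_relations_def using hat_inverse_transfer[OF \<alpha> N'] by auto
qed

section \<open>Blaschke factors on the unit circle\<close>

lemma circle_cnj: "cmod z = 1 \<Longrightarrow> cnj z = 1 / z"
  by (metis complex_norm_square divide_conv_cnj inverse_eq_divide mult.left_neutral norm_one of_real_1 power_one complex_inverse complex_div_cnj)

lemma circle_nonzero: "cmod z = 1 \<Longrightarrow> z \<noteq> 0"
  by auto

lemma cmod_sg: "cmod (sg \<alpha> j) = 1"
  by (auto simp: sg_def norm_divide)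

lemma varpi_circle_nonzero:
  assumes "cmod a < 1" "cmod z = 1"
  shows "1 - cnj a * z \<noteq> 0"
proof
  assume "1 - cnj a * z = 0"
  then have "cmod (cnj a * z) = 1" by (metis eq_iff_diff_eq_0 norm_one)
  with assms show False by (simp add: norm_mult)
qed

lemma cnj_varpi_circle: "cmod z = 1 \<Longrightarrow> cnj (1 - cnj a * z) = (z - a) / z"
  by (simp add: circle_cnj field_simps circle_nonzero)

lemma cmod_zeta_a:
  assumes "cmod (\<alpha> j) < 1" "cmod z = 1"
  shows "cmod (zeta_a \<alpha> j z) = 1"
proof -
  have "cmod (1 - cnj (\<alpha> j) * z) = cmod (cnj (1 - cnj (\<alpha> j) * z))" by (simp only: complex_mod_cnj)
  also have "\<dots> = cmod (z - \<alpha> j)"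
    unfolding cnj_varpi_circle[OF assms(2)] by (simp add: norm_divide assms(2))
  finally show ?thesis
    using varpi_circle_nonzero[OF assms] assms by (auto simp: zeta_a_def norm_divide norm_mult cmod_sg)
qed

lemma zeta_b_eq_inverse: "z \<noteq> 0 \<or> \<alpha> j \<noteq> 0 \<Longrightarrow> zeta_b \<alpha> j z = inverse (zeta_a \<alpha> j z)"
proof (cases "\<alpha> j = 0")
  case True
  then show ?thesis by (simp add: zeta_a_def zeta_b_def beta_def sg_def divide_inverse)
next
  case False
  define a where "a = \<alpha> j"
  define r where "r = complex_of_real (cmod a)"
  have a: "a \<noteq> 0" and r: "r \<noteq> 0" "a * cnj a = r * r"
    using False by (auto simp: a_def r_def complex_norm_square[symmetric] power2_eq_square simp flip: of_real_mult)
  have 1: "zeta_b \<alpha> j z = cnj a / r * (z - 1 / cnj a) / (1 - z / a)"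
    using False by (simp add: zeta_b_def beta_def sg_def a_def r_def)
  have 2: "zeta_a \<alpha> j z = cnj a / r * (z - a) / (1 - cnj a * z)"
    using False by (simp add: zeta_a_def sg_def a_def r_def)
  have "cnj a * (z - 1 / cnj a) = - (1 - cnj a * z)" using a by (simp add: field_simps)
  moreover have "1 - z / a = - (z - a) / a" using a by (simp add: field_simps)
  moreover have "zeta_b \<alpha> j z = cnj a * (z - 1 / cnj a) / r / (1 - z / a)"
    unfolding 1 by simp
  ultimately have "zeta_b \<alpha> j z = - (1 - cnj a * z) / r / (- (z - a) / a)"
    by (simp only:)
  also have "\<dots> = (1 - cnj a * z) * (a / r) / (z - a)"
    unfolding minus_divide_left[symmetric] minus_divide_right[symmetric] by simp
  also have "a / r = r / cnj a" using a r by (simp add: frac_eq_eq)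
  also have "(1 - cnj a * z) * (r / cnj a) / (z - a) = inverse (zeta_a \<alpha> j z)"
    unfolding 2 by simp
  finally show ?thesis .
qed

section \<open>Rational functions up to finitely many exceptional points\<close>

text \<open>
  Every factor that occurs may take a meaningless value at its pole, hence the finite set of
  exceptional points. Limits at a punctured neighbourhood do not see it, and the class is closed
  under \<^const>\<open>substar\<close>.
\<close>

definition rational_fun :: "(complex \<Rightarrow> complex) \<Rightarrow> bool" where
  "rational_fun f \<longleftrightarrow> (\<exists>p q S. q \<noteq> 0 \<and> finite S \<and> (\<forall>z. z \<notin> S \<longrightarrow> f z = poly p z / poly q z))"

lemma rational_funI: "q \<noteq> 0 \<Longrightarrow> finite S \<Longrightarrow> (\<And>z. z \<notin> S \<Longrightarrow> f z = poly p z / poly q z) \<Longrightarrow> rational_fun f"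
  unfolding rational_fun_def by blast

lemma rational_fun_poly: "rational_fun (poly p)"
  by (rule rational_funI[of 1 "{}" _ p]) auto

lemma rational_fun_const: "rational_fun (\<lambda>_. c)"
  using rational_fun_poly[of "[:c:]"] by (simp add: rational_fun_def)

lemma rational_fun_ident: "rational_fun (\<lambda>z. z)"
  using rational_fun_poly[of "[:0, 1:]"] by (simp add: rational_fun_def)

lemma rational_fun_add:
  assumes "rational_fun f" "rational_fun g"
  shows "rational_fun (\<lambda>z. f z + g z)"
proof -
  obtain p q S where f: "q \<noteq> 0" "finite S" "\<And>z. z \<notin> S \<Longrightarrow> f z = poly p z / poly q z"
    using assms(1) by (auto simp: rational_fun_def)
  obtain p' q' S' where g: "q' \<noteq> 0" "finite S'" "\<And>z. z \<notin> S' \<Longrightarrow> g z = poly p' z / poly q' z"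
    using assms(2) by (auto simp: rational_fun_def)
  show ?thesis
  proof (rule rational_funI[of "q * q'" "S \<union> S' \<union> {z. poly (q * q') z = 0}" _ "p * q' + p' * q"])
    show "finite (S \<union> S' \<union> {z. poly (q * q') z = 0})"
      unfolding finite_Un using f g by (intro conjI poly_roots_finite) auto
  qed (use f g in \<open>auto simp: field_simps\<close>)
qed

lemma rational_fun_mult:
  assumes "rational_fun f" "rational_fun g"
  shows "rational_fun (\<lambda>z. f z * g z)"
proof -
  obtain p q S where f: "q \<noteq> 0" "finite S" "\<And>z. z \<notin> S \<Longrightarrow> f z = poly p z / poly q z"
    using assms(1) by (auto simp: rational_fun_def)
  obtain p' q' S' where g: "q' \<noteq> 0" "finite S'" "\<And>z. z \<notin> S' \<Longrightarrow> g z = poly p' z / poly q' z"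
    using assms(2) by (auto simp: rational_fun_def)
  show ?thesis
    by (rule rational_funI[of "q * q'" "S \<union> S'" _ "p * p'"]) (use f g in auto)
qed

lemma rational_fun_inverse:
  assumes "rational_fun f"
  shows "rational_fun (\<lambda>z. inverse (f z))"
proof -
  obtain p q S where f: "q \<noteq> 0" "finite S" "\<And>z. z \<notin> S \<Longrightarrow> f z = poly p z / poly q z"
    using assms(1) by (auto simp: rational_fun_def)
  show ?thesis
  proof (cases "p = 0")
    case True
    then show ?thesis by (intro rational_funI[of 1 S _ 0]) (use f in auto)
  next
    case False
    then show ?thesis by (intro rational_funI[of p S _ q]) (use f in auto)
  qed
qed

lemma rational_fun_divide:
  "rational_fun f \<Longrightarrow> rational_fun g \<Longrightarrow> rational_fun (\<lambda>z. f z / g z)"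
  unfolding divide_inverse by (intro rational_fun_mult rational_fun_inverse)

lemma rational_fun_diff:
  "rational_fun f \<Longrightarrow> rational_fun g \<Longrightarrow> rational_fun (\<lambda>z. f z - g z)"
  using rational_fun_add[OF _ rational_fun_mult[OF rational_fun_const], of f g "- 1"] by simp

lemma rational_fun_sum:
  "(\<And>i. i \<in> I \<Longrightarrow> rational_fun (f i)) \<Longrightarrow> rational_fun (\<lambda>z. \<Sum>i\<in>I. f i z)"
  by (induction I rule: infinite_finite_induct) (simp_all add: rational_fun_const rational_fun_add)

lemma rational_fun_prod:
  "(\<And>i. i \<in> I \<Longrightarrow> rational_fun (f i)) \<Longrightarrow> rational_fun (\<lambda>z. \<Prod>i\<in>I. f i z)"
  by (induction I rule: infinite_finite_induct) (simp_all add: rational_fun_const rational_fun_mult)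

lemmas rational_fun_intros = rational_fun_const rational_fun_ident rational_fun_add rational_fun_mult
  rational_fun_divide rational_fun_diff rational_fun_sum rational_fun_prod

lemma inj_reflection: "inj (\<lambda>z. 1 / cnj z)"
  by (rule injI) (metis complex_cnj_cancel_iff divide_inverse inverse_inverse_eq mult.left_neutral)

text \<open>
  On polynomials the reflection acts coefficient by coefficient, with \<open>1 / z\<close> for \<open>z\<close>.
\<close>

lemma rational_fun_substar:
  assumes "rational_fun f"
  shows "rational_fun (substar f)"
proof -
  have poly: "rational_fun (\<lambda>z. cnj (poly p (1 / cnj z)))" for p
  proof (induction p)
    case (pCons a p)
    have "rational_fun (\<lambda>z. cnj a + (1 / z) * cnj (poly p (1 / cnj z)))"
      by (intro rational_fun_intros pCons)
    then show ?case by simp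
  qed (simp add: rational_fun_const)
  obtain p q S where f: "q \<noteq> 0" "finite S" "\<And>z. z \<notin> S \<Longrightarrow> f z = poly p z / poly q z"
    using assms(1) by (auto simp: rational_fun_def)
  have "rational_fun (\<lambda>z. cnj (poly p (1 / cnj z)) / cnj (poly q (1 / cnj z)))"
    by (intro rational_fun_divide poly)
  then obtain p' q' S' where g: "q' \<noteq> 0" "finite S'"
    "\<And>z. z \<notin> S' \<Longrightarrow> cnj (poly p (1 / cnj z)) / cnj (poly q (1 / cnj z)) = poly p' z / poly q' z"
    by (auto simp: rational_fun_def)
  show ?thesis
  proof (rule rational_funI[of q' "S' \<union> (\<lambda>z. 1 / cnj z) -` S" _ p'])
    show "finite (S' \<union> (\<lambda>z. 1 / cnj z) -` S)"
      using g(2) finite_vimageI[OF f(2) inj_reflection] by simp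
    fix z assume z: "z \<notin> S' \<union> (\<lambda>z. 1 / cnj z) -` S"
    then have "f (1 / cnj z) = poly p (1 / cnj z) / poly q (1 / cnj z)" using f(3) by auto
    then show "substar f z = poly p' z / poly q' z"
      using z g(3)[of z] by (simp add: substar_def)
  qed (rule g(1))
qed

lemma infinite_circle: "infinite {z. cmod z = 1}"
proof
  assume "finite {z. cmod z = 1}"
  moreover have "cis ` {0..pi} \<subseteq> {z. cmod z = 1}" by auto
  ultimately have "finite (cis ` {0..pi})" by (rule rev_finite_subset)
  moreover have "inj_on cis {0..pi}"
  proof (rule inj_onI)
    fix x y assume "x \<in> {0..pi}" "y \<in> {0..pi}" "cis x = cis y"
    then show "x = y" by (metis atLeastAtMost_iff cis.sel(1) cos_inj_pi)
  qed
  ultimately have "finite {0..pi}" by (rule finite_imageD)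
  then show False using pi_gt_zero by (simp add: infinite_Icc)
qed

lemma rational_fun_identity:
  assumes "rational_fun f" "rational_fun g" "\<And>z. cmod z = 1 \<Longrightarrow> f z = g z"
  shows "finite {z. f z \<noteq> g z}"
proof -
  have "rational_fun (\<lambda>z. f z - g z)" by (intro rational_fun_diff assms)
  then obtain p q S where h: "q \<noteq> 0" "finite S" "\<And>z. z \<notin> S \<Longrightarrow> f z - g z = poly p z / poly q z"
    by (auto simp: rational_fun_def)
  have q: "finite {z. poly q z = 0}" using h(1) by (rule poly_roots_finite)
  have "{z. cmod z = 1} \<subseteq> S \<union> {z. poly q z = 0} \<union> {z. poly p z = 0}"
  proof
    fix z :: complex assume "z \<in> {z. cmod z = 1}"
    then show "z \<in> S \<union> {z. poly q z = 0} \<union> {z. poly p z = 0}"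
      using h(3)[of z] assms(3)[of z] by auto
  qed
  then have "infinite {z. poly p z = 0}"
    using infinite_circle h(2) q by (metis finite_Un finite_subset)
  then have "p = 0" using poly_roots_finite by blast
  then have "{z. f z \<noteq> g z} \<subseteq> S" using h(3) by auto
  then show ?thesis using h(2) by (rule finite_subset)
qed

lemma punctured_off_finite:
  assumes "finite S"
  shows "eventually (\<lambda>z. z \<notin> S) (punctured \<nu>)"
proof (cases \<nu>)
  case (Fin a)
  have "eventually (\<lambda>z. \<forall>s\<in>S. z \<noteq> s) (at a)"
    using assms by (subst eventually_ball_finite_distrib) (auto simp: eventually_neq_at_within)
  then show ?thesis using Fin by (auto elim: eventually_mono)
next
  case Infty
  obtain B where B: "\<And>s. s \<in> S \<Longrightarrow> norm s \<le> B" using finite_imp_bounded[OF assms] by (auto simp: bounded_iff)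
  have "eventually (\<lambda>z. z \<notin> S) (at_infinity :: complex filter)"
    unfolding eventually_at_infinity by (rule exI[of _ "B + 1"]) (use B in force)
  then show ?thesis using Infty by simp
qed

text \<open>
  Proportionality on the circle extends to the point \<^term>\<open>\<nu>\<close> off the circle, and a unimodular
  quotient of two positive limits is \<open>1\<close>.
\<close>

lemma pos_at_rational:
  assumes "rational_fun f" "rational_fun g" "\<And>z. cmod z = 1 \<Longrightarrow> f z = c * g z"
    and f: "pos_at f \<nu>" and g: "pos_at g \<nu>" and "cmod c = 1"
  shows "c = 1"
proof -
  obtain r s where r: "0 < r" "(f \<longlongrightarrow> complex_of_real r) (punctured \<nu>)"
    and s: "0 < s" "(g \<longlongrightarrow> complex_of_real s) (punctured \<nu>)"
    using f g unfolding pos_at_def by auto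
  have "finite {z. f z \<noteq> c * g z}"
    by (rule rational_fun_identity) (use assms in \<open>auto intro!: rational_fun_intros\<close>)
  from punctured_off_finite[OF this, of \<nu>] have "eventually (\<lambda>z. c * g z = f z) (punctured \<nu>)"
    by (auto elim: eventually_mono)
  moreover have "((\<lambda>z. c * g z) \<longlongrightarrow> c * of_real s) (punctured \<nu>)"
    by (intro tendsto_intros s)
  ultimately have "(f \<longlongrightarrow> c * of_real s) (punctured \<nu>)"
    by (rule Lim_transform_eventually[rotated])
  moreover have "punctured \<nu> \<noteq> bot" by (cases \<nu>) (auto simp: trivial_limit_at_infinity)
  ultimately have eq: "c * of_real s = of_real r"
    using r(2) tendsto_unique by blast
  then have "cmod (c * of_real s) = r" using r(1) by simp
  then have "s = r" using s(1) assms(6) by (simp add: norm_mult)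
  then show "c = 1" using eq r(1) by simp
qed

lemma pos_at_substar:
  assumes "pos_at f (Fin (\<alpha> n))"
  shows "pos_at (substar f) (beta \<alpha> n)"
proof -
  obtain r where r: "0 < r" "(f \<longlongrightarrow> complex_of_real r) (at (\<alpha> n))"
    using assms by (auto simp: pos_at_def)
  have "filterlim (\<lambda>z. 1 / cnj z) (at (\<alpha> n)) (punctured (beta \<alpha> n))"
  proof (cases "\<alpha> n = 0")
    case True
    have "((\<lambda>z. 1 / cnj z) \<longlongrightarrow> 0) at_infinity"
      using tendsto_cnj[OF tendsto_inverse_0] by (simp add: divide_inverse)
    moreover have "eventually (\<lambda>z. 1 / cnj z \<noteq> 0) at_infinity"
      using punctured_off_finite[of "{0}" Infty] by (auto elim: eventually_mono)
    ultimately show ?thesis using True by (simp add: beta_def filterlim_at)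
  next
    case False
    let ?b = "1 / cnj (\<alpha> n)"
    have "cnj ?b \<noteq> 0" using False by simp
    then have "((\<lambda>z. 1 / cnj z) \<longlongrightarrow> 1 / cnj ?b) (at ?b)"
      by (intro tendsto_divide tendsto_const tendsto_cnj tendsto_ident_at)
    moreover have "eventually (\<lambda>z. 1 / cnj z \<noteq> 1 / cnj ?b) (at ?b)"
    proof (rule eventually_mono)
      show "eventually (\<lambda>z. z \<noteq> ?b) (at ?b)" by (rule eventually_neq_at_within)
    next
      fix z assume "z \<noteq> ?b"
      then show "1 / cnj z \<noteq> 1 / cnj ?b" using injD[OF inj_reflection, of z ?b] by blast
    qed
    ultimately have "filterlim (\<lambda>z. 1 / cnj z) (at (1 / cnj ?b)) (at ?b)"
      by (simp add: filterlim_at)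
    then show ?thesis using False by (simp add: beta_def)
  qed
  from filterlim_compose[OF r(2) this]
  have "((\<lambda>z. f (1 / cnj z)) \<longlongrightarrow> of_real r) (punctured (beta \<alpha> n))" .
  from tendsto_cnj[OF this] have "(substar f \<longlongrightarrow> of_real r) (punctured (beta \<alpha> n))"
    by (simp add: substar_def[abs_def])
  then show ?thesis using r(1) by (auto simp: pos_at_def)
qed

lemma rational_fun_zeta_a: "rational_fun (zeta_a \<alpha> j)"
  unfolding zeta_a_def[abs_def] varpi.simps varpi_star.simps by (intro rational_fun_intros)

lemma rational_fun_zeta_b: "rational_fun (zeta_b \<alpha> j)"
proof (cases "beta \<alpha> j")
  case (Fin b)
  show ?thesis unfolding zeta_b_def[abs_def] Fin varpi.simps varpi_star.simps by (intro rational_fun_intros)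
next
  case Infty
  have "rational_fun (\<lambda>z. sg \<alpha> j * (- 1) / (0 - z))" by (intro rational_fun_intros)
  then show ?thesis unfolding zeta_b_def[abs_def] Infty varpi.simps varpi_star.simps by simp
qed

lemma rational_fun_Ba: "rational_fun (Ba \<alpha> n)"
  and rational_fun_dBa: "rational_fun (dBa \<alpha> \<gamma> n)"
  and rational_fun_dBb: "rational_fun (dBb \<alpha> \<gamma> n)"
  unfolding Ba_def[abs_def] dBa_def[abs_def] dBb_def[abs_def]
  by (intro rational_fun_prod rational_fun_zeta_a rational_fun_zeta_b)+

lemma rational_fun_Bg: "rational_fun (Bg \<alpha> \<gamma> n)"
  unfolding Bg_def[abs_def]
  by (cases "n = 0"; cases "\<gamma> n = Fin (\<alpha> n)")
     (simp_all add: rational_fun_const rational_fun_dBa[unfolded eta_contract_eq] rational_fun_dBb)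

lemma rational_fun_fspan:
  assumes "\<And>k. rational_fun (B k)" "f \<in> fspan B n"
  shows "rational_fun f"
proof -
  obtain c where f: "f = (\<lambda>z. \<Sum>k\<le>n. c k * B k z)" using assms(2) by (auto simp: fspan_def)
  show ?thesis unfolding f by (intro rational_fun_intros assms(1))
qed

section \<open>The inner product of functions bounded on the circle\<close>

definition circle_bounded :: "(complex \<Rightarrow> complex) \<Rightarrow> bool" where
  "circle_bounded f \<longleftrightarrow> f \<in> borel_measurable borel \<and> (\<exists>C. \<forall>z. cmod z = 1 \<longrightarrow> cmod (f z) \<le> C)"

lemma circle_bounded_measurable: "circle_bounded f \<Longrightarrow> f \<in> borel_measurable borel"
  by (simp add: circle_bounded_def)

lemma circle_bounded_const: "circle_bounded (\<lambda>_. c)"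
  by (auto simp: circle_bounded_def)

lemma circle_bounded_ident: "circle_bounded (\<lambda>z. z)"
  by (auto simp: circle_bounded_def)

lemma circle_bounded_add:
  assumes "circle_bounded f" "circle_bounded g" shows "circle_bounded (\<lambda>z. f z + g z)"
proof -
  obtain C D where "\<And>z. cmod z = 1 \<Longrightarrow> cmod (f z) \<le> C" "\<And>z. cmod z = 1 \<Longrightarrow> cmod (g z) \<le> D"
    using assms unfolding circle_bounded_def by blast
  then have "\<And>z. cmod z = 1 \<Longrightarrow> cmod (f z + g z) \<le> C + D" by (meson add_mono norm_triangle_ineq order_trans)
  moreover have "(\<lambda>z. f z + g z) \<in> borel_measurable borel"
    by (intro borel_measurable_add circle_bounded_measurable assms)
  ultimately show ?thesis unfolding circle_bounded_def by blast
qed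

lemma circle_bounded_mult:
  assumes "circle_bounded f" "circle_bounded g" shows "circle_bounded (\<lambda>z. f z * g z)"
proof -
  obtain C D where "\<And>z. cmod z = 1 \<Longrightarrow> cmod (f z) \<le> C" "\<And>z. cmod z = 1 \<Longrightarrow> cmod (g z) \<le> D"
    using assms unfolding circle_bounded_def by blast
  then have "\<And>z. cmod z = 1 \<Longrightarrow> cmod (f z * g z) \<le> C * D"
    unfolding norm_mult by (meson mult_mono norm_ge_zero order_trans)
  moreover have "(\<lambda>z. f z * g z) \<in> borel_measurable borel"
    by (intro borel_measurable_times circle_bounded_measurable assms)
  ultimately show ?thesis unfolding circle_bounded_def by blast
qed

lemma circle_bounded_cnj: "circle_bounded f \<Longrightarrow> circle_bounded (\<lambda>z. cnj (f z))"
proof -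
  assume f: "circle_bounded f"
  have "cnj \<in> borel_measurable borel" by (intro borel_measurable_continuous_onI continuous_intros)
  then have "(\<lambda>z. cnj (f z)) \<in> borel_measurable borel"
    using f unfolding circle_bounded_def by (blast intro: measurable_compose)
  then show ?thesis using f by (simp add: circle_bounded_def)
qed

lemma circle_bounded_diff:
  "circle_bounded f \<Longrightarrow> circle_bounded g \<Longrightarrow> circle_bounded (\<lambda>z. f z - g z)"
  using circle_bounded_add[OF _ circle_bounded_mult[OF circle_bounded_const], of f g "- 1"] by simp

lemma circle_bounded_sum:
  "(\<And>i. i \<in> I \<Longrightarrow> circle_bounded (f i)) \<Longrightarrow> circle_bounded (\<lambda>z. \<Sum>i\<in>I. f i z)"
  by (induction I rule: infinite_finite_induct) (simp_all add: circle_bounded_const circle_bounded_add)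

lemma circle_bounded_prod:
  "(\<And>i. i \<in> I \<Longrightarrow> circle_bounded (f i)) \<Longrightarrow> circle_bounded (\<lambda>z. \<Prod>i\<in>I. f i z)"
  by (induction I rule: infinite_finite_induct) (simp_all add: circle_bounded_const circle_bounded_mult)

lemmas circle_bounded_intros = circle_bounded_const circle_bounded_ident circle_bounded_add circle_bounded_mult
  circle_bounded_cnj circle_bounded_diff circle_bounded_sum circle_bounded_prod

lemma circle_bounded_zeta_a:
  assumes "cmod (\<alpha> j) < 1" shows "circle_bounded (zeta_a \<alpha> j)"
proof -
  have "zeta_a \<alpha> j \<in> borel_measurable borel" unfolding zeta_a_def[abs_def] by simp
  then show ?thesis using cmod_zeta_a[of \<alpha> j] assms unfolding circle_bounded_def by (metis order_refl)
qed

lemma circle_bounded_zeta_b: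
  assumes "cmod (\<alpha> j) < 1" shows "circle_bounded (zeta_b \<alpha> j)"
proof -
  have "zeta_b \<alpha> j \<in> borel_measurable borel"
    unfolding zeta_b_def[abs_def] by (cases "beta \<alpha> j") simp_all
  moreover have "cmod (zeta_b \<alpha> j z) = 1" if "cmod z = 1" for z
    using that assms zeta_b_eq_inverse[of z \<alpha> j] cmod_zeta_a[of \<alpha> j z] circle_nonzero[OF that]
    by (simp add: norm_inverse)
  ultimately show ?thesis unfolding circle_bounded_def by (metis order_refl)
qed

lemma circle_bounded_fspan:
  assumes "\<And>k. circle_bounded (B k)" "f \<in> fspan B n"
  shows "circle_bounded f"
proof -
  obtain c where f: "f = (\<lambda>z. \<Sum>k\<le>n. c k * B k z)" using assms(2) by (auto simp: fspan_def)
  show ?thesis unfolding f by (intro circle_bounded_intros assms(1))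
qed

lemma AE_circle:
  assumes "circle_probability \<mu>" "\<And>z. cmod z = 1 \<Longrightarrow> P z"
  shows "AE z in \<mu>. P z"
proof -
  have "AE z in \<mu>. cmod z = 1" using assms(1) by (simp add: circle_probability_def)
  then show ?thesis by (rule eventually_mono) (rule assms(2))
qed

lemma circle_measurable:
  "circle_probability \<mu> \<Longrightarrow> f \<in> borel_measurable borel \<Longrightarrow> f \<in> borel_measurable \<mu>"
  unfolding circle_probability_def using measurable_cong_sets[of \<mu> borel borel borel] by blast

lemma circle_integrable:
  assumes "circle_probability \<mu>" "circle_bounded f"
  shows "integrable \<mu> f"
proof -
  interpret prob_space \<mu> using assms(1) by (simp add: circle_probability_def)
  obtain C where C: "\<And>z. cmod z = 1 \<Longrightarrow> cmod (f z) \<le> C"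
    using assms(2) unfolding circle_bounded_def by blast
  show ?thesis
  proof (rule integrable_const_bound)
    show "AE z in \<mu>. norm (f z) \<le> C" by (rule AE_circle[OF assms(1)]) (use C in blast)
    show "f \<in> borel_measurable \<mu>"
      by (intro circle_measurable[OF assms(1)] circle_bounded_measurable assms)
  qed
qed

lemma ip_cong:
  assumes "circle_probability \<mu>" "circle_bounded f" "circle_bounded g" "circle_bounded f'" "circle_bounded g'"
    and "\<And>z. cmod z = 1 \<Longrightarrow> cnj (f z) * g z = cnj (f' z) * g' z"
  shows "ip \<mu> f g = ip \<mu> f' g'"
  unfolding ip_def
  by (intro integral_cong_AE circle_measurable[OF assms(1)] circle_bounded_measurable
      AE_circle[OF assms(1)] circle_bounded_intros assms)

lemma ip_sum_right:
  assumes "circle_probability \<mu>" "circle_bounded f" "\<And>k. k \<in> I \<Longrightarrow> circle_bounded (g k)"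
  shows "ip \<mu> f (\<lambda>z. \<Sum>k\<in>I. c k * g k z) = (\<Sum>k\<in>I. c k * ip \<mu> f (g k))"
proof -
  have "ip \<mu> f (\<lambda>z. \<Sum>k\<in>I. c k * g k z) = (LINT z|\<mu>. (\<Sum>k\<in>I. c k * (cnj (f z) * g k z)))"
    unfolding ip_def by (simp add: sum_distrib_left mult_ac)
  also have "\<dots> = (\<Sum>k\<in>I. (LINT z|\<mu>. c k * (cnj (f z) * g k z)))"
    by (intro Bochner_Integration.integral_sum circle_integrable[OF assms(1)] circle_bounded_intros assms)
  also have "\<dots> = (\<Sum>k\<in>I. c k * ip \<mu> f (g k))"
    unfolding ip_def by simp
  finally show ?thesis .
qed

lemma ip_cnj: "cnj (ip \<mu> f g) = ip \<mu> g f"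
  unfolding ip_def by (subst Bochner_Integration.integral_cnj[symmetric]) (simp add: mult.commute)

definition mean_square :: "complex measure \<Rightarrow> (complex \<Rightarrow> complex) \<Rightarrow> real" where
  "mean_square \<mu> f = (LINT z|\<mu>. (cmod (f z))\<^sup>2)"

lemma mean_square_nonneg: "0 \<le> mean_square \<mu> f"
  unfolding mean_square_def by simp

lemma mean_square_ip: "complex_of_real (mean_square \<mu> f) = ip \<mu> f f"
proof -
  have "cnj (f z) * f z = complex_of_real ((cmod (f z))\<^sup>2)" for z
    by (metis complex_norm_square mult.commute)
  then show ?thesis
    unfolding mean_square_def ip_def by (simp only: integral_complex_of_real)
qed

lemma circle_integrable_square:
  assumes "circle_probability \<mu>" "circle_bounded f"
  shows "integrable \<mu> (\<lambda>z. (cmod (f z))\<^sup>2)"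
proof -
  have "integrable \<mu> (\<lambda>z. cnj (f z) * f z)"
    by (intro circle_integrable[OF assms(1)] circle_bounded_intros assms)
  moreover have "cnj (f z) * f z = complex_of_real ((cmod (f z))\<^sup>2)" for z
    by (metis complex_norm_square mult.commute)
  ultimately have "integrable \<mu> (\<lambda>z. complex_of_real ((cmod (f z))\<^sup>2))" by simp
  then show ?thesis by (simp only: complex_of_real_integrable_eq)
qed

lemma nn_integral_mean_square:
  assumes "circle_probability \<mu>" "circle_bounded f"
  shows "(\<integral>\<^sup>+ z. ennreal ((cmod (f z))\<^sup>2) \<partial>\<mu>) = ennreal (mean_square \<mu> f)"
  unfolding mean_square_def
  by (rule nn_integral_eq_integral[OF circle_integrable_square[OF assms]]) simp

lemma mean_square_mono:
  assumes "circle_probability \<mu>" "circle_bounded f" "circle_bounded g"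
    and "\<And>z. cmod z = 1 \<Longrightarrow> cmod (f z) \<le> cmod (g z)"
  shows "mean_square \<mu> f \<le> mean_square \<mu> g"
  unfolding mean_square_def
proof (rule integral_mono_AE)
  show "AE z in \<mu>. (cmod (f z))\<^sup>2 \<le> (cmod (g z))\<^sup>2"
    by (rule AE_circle[OF assms(1)]) (simp add: assms(4) power_mono)
qed (intro circle_integrable_square assms)+

lemma mean_square_cong:
  assumes "circle_probability \<mu>" "circle_bounded f" "circle_bounded g"
    and "\<And>z. cmod z = 1 \<Longrightarrow> cmod (f z) = cmod (g z)"
  shows "mean_square \<mu> f = mean_square \<mu> g"
  by (intro antisym mean_square_mono assms(1-3)) (simp_all add: assms(4))

lemma mean_square_scale: "mean_square \<mu> (\<lambda>z. c * f z) = (cmod c)\<^sup>2 * mean_square \<mu> f"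
  unfolding mean_square_def by (simp add: norm_mult power_mult_distrib)

lemma mean_square_add_le:
  assumes "circle_probability \<mu>" "circle_bounded f" "circle_bounded g"
  shows "mean_square \<mu> (\<lambda>z. f z + g z) \<le> 2 * mean_square \<mu> f + 2 * mean_square \<mu> g"
proof -
  have "mean_square \<mu> (\<lambda>z. f z + g z) \<le> (LINT z|\<mu>. 2 * (cmod (f z))\<^sup>2 + 2 * (cmod (g z))\<^sup>2)"
    unfolding mean_square_def
    by (intro integral_mono Bochner_Integration.integrable_add integrable_mult_right
        circle_integrable_square circle_bounded_intros assms cmod_add_sq_le)
  also have "\<dots> = 2 * mean_square \<mu> f + 2 * mean_square \<mu> g"
    unfolding mean_square_def
    using circle_integrable_square[OF assms(1,2)] circle_integrable_square[OF assms(1,3)] by simp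
  finally show ?thesis .
qed

section \<open>The spaces of rational functions on the circle\<close>

text \<open>
  The restriction of \<open>\<L>\<^sub>n\<^sup>\<alpha>\<close> to the circle, where there are no poles and \<open>f\<^sub>*\<close> is the complex
  conjugate of \<open>f\<close>.
\<close>

definition circle_span :: "(nat \<Rightarrow> complex) \<Rightarrow> nat \<Rightarrow> (complex \<Rightarrow> complex) set" where
  "circle_span \<alpha> n = {f. \<exists>c. \<forall>z. cmod z = 1 \<longrightarrow> f z = (\<Sum>k\<le>n. c k * Ba \<alpha> k z)}"

lemma circle_spanI: "(\<And>z. cmod z = 1 \<Longrightarrow> f z = (\<Sum>k\<le>n. c k * Ba \<alpha> k z)) \<Longrightarrow> f \<in> circle_span \<alpha> n"
  unfolding circle_span_def by blast

lemma circle_spanE: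
  assumes "f \<in> circle_span \<alpha> n"
  obtains c where "\<And>z. cmod z = 1 \<Longrightarrow> f z = (\<Sum>k\<le>n. c k * Ba \<alpha> k z)"
  using assms unfolding circle_span_def by blast

lemma fspan_circle_span: "f \<in> fspan (Ba \<alpha>) n \<Longrightarrow> f \<in> circle_span \<alpha> n"
  unfolding fspan_def circle_span_def by blast

lemma circle_span_cong:
  "f \<in> circle_span \<alpha> n \<Longrightarrow> (\<And>z. cmod z = 1 \<Longrightarrow> g z = f z) \<Longrightarrow> g \<in> circle_span \<alpha> n"
  unfolding circle_span_def by auto

lemma circle_span_add:
  assumes "f \<in> circle_span \<alpha> n" "g \<in> circle_span \<alpha> n"
  shows "(\<lambda>z. f z + g z) \<in> circle_span \<alpha> n"
proof -
  obtain c d where "\<And>z. cmod z = 1 \<Longrightarrow> f z = (\<Sum>k\<le>n. c k * Ba \<alpha> k z)"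
    "\<And>z. cmod z = 1 \<Longrightarrow> g z = (\<Sum>k\<le>n. d k * Ba \<alpha> k z)"
    using assms unfolding circle_span_def by blast
  then show ?thesis
    by (intro circle_spanI[where c = "\<lambda>k. c k + d k"]) (simp add: distrib_right sum.distrib)
qed

lemma circle_span_scale:
  assumes "f \<in> circle_span \<alpha> n"
  shows "(\<lambda>z. a * f z) \<in> circle_span \<alpha> n"
proof -
  obtain c where "\<And>z. cmod z = 1 \<Longrightarrow> f z = (\<Sum>k\<le>n. c k * Ba \<alpha> k z)"
    using assms by (rule circle_spanE) blast
  then show ?thesis
    by (intro circle_spanI[where c = "\<lambda>k. a * c k"]) (simp add: sum_distrib_left mult.assoc)
qed

lemma circle_span_Ba: "k \<le> n \<Longrightarrow> Ba \<alpha> k \<in> circle_span \<alpha> n"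
  by (rule circle_spanI[where c = "\<lambda>j. if j = k then 1 else 0"])
     (simp add: if_distrib[of "\<lambda>c. c * _"] cong: if_cong)

lemma circle_span_zero: "(\<lambda>z. 0) \<in> circle_span \<alpha> n"
  by (rule circle_spanI[where c = "\<lambda>_. 0"]) simp

lemma circle_span_sum:
  "(\<And>k. k \<in> K \<Longrightarrow> f k \<in> circle_span \<alpha> n) \<Longrightarrow> (\<lambda>z. \<Sum>k\<in>K. f k z) \<in> circle_span \<alpha> n"
  by (induction K rule: infinite_finite_induct) (simp_all add: circle_span_zero circle_span_add)

lemma circle_span_mono:
  assumes "f \<in> circle_span \<alpha> m" "m \<le> n"
  shows "f \<in> circle_span \<alpha> n"
proof -
  obtain c where c: "\<And>z. cmod z = 1 \<Longrightarrow> f z = (\<Sum>k\<le>m. c k * Ba \<alpha> k z)"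
    using assms(1) by (rule circle_spanE) blast
  have "(\<lambda>z. \<Sum>k\<le>m. c k * Ba \<alpha> k z) \<in> circle_span \<alpha> n"
    using assms(2) by (intro circle_span_sum circle_span_scale circle_span_Ba) auto
  then show ?thesis by (rule circle_span_cong) (rule c)
qed

lemma Ba_Suc: "Ba \<alpha> (Suc n) z = zeta_a \<alpha> (Suc n) z * Ba \<alpha> n z"
  by (simp add: Ba_def)

lemma disc_product_nonzero:
  assumes "cmod a < 1" "cmod b < 1"
  shows "1 - cnj a * b \<noteq> 0"
proof
  assume "1 - cnj a * b = 0"
  then have "cmod (cnj a * b) = 1" by (metis eq_iff_diff_eq_0 norm_one)
  moreover have "cmod a * cmod b < 1 * 1" using assms by (intro mult_strict_mono) auto
  ultimately show False by (simp add: norm_mult)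
qed

text \<open>
  Subtracting from \<open>\<zeta>\<^sub>n\<close> its value at \<open>\<alpha>\<^sub>m\<close> makes it divisible by \<open>\<zeta>\<^sub>m\<close>; the quotient has the
  denominator of \<open>\<zeta>\<^sub>n\<close> and a numerator of degree at most one, so that it is a combination of
  \<open>1\<close> and \<open>\<zeta>\<^sub>n\<close>.
\<close>

lemma zeta_a_exchange:
  assumes "\<forall>j. cmod (\<alpha> j) < 1"
  obtains a b c where "\<And>z. cmod z = 1 \<Longrightarrow> zeta_a \<alpha> n z = c + zeta_a \<alpha> m z * (a + b * zeta_a \<alpha> n z)"
proof -
  define s t A N x y where "s = sg \<alpha> m" and "t = sg \<alpha> n" and "A = \<alpha> m" and "N = \<alpha> n"
    and "x = cnj (\<alpha> n)" and "y = cnj (\<alpha> m)"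
  define K where "K = t * (1 - x * N) / (s * (1 - x * A))"
  define p where "p = (1 - y * N) / (1 - x * N)"
  \<comment> \<open>\<open>K\<close> is the constant in \<open>\<zeta>\<^sub>n - \<zeta>\<^sub>n(\<alpha>\<^sub>m) = \<zeta>\<^sub>m K (1 - y z) / (1 - x z)\<close>, and \<open>p\<close>, \<open>p x - y\<close> are the
    coefficients of \<open>1 - y z\<close> with respect to \<open>1 - x z\<close> and \<open>z - N\<close>\<close>
  have nz: "s \<noteq> 0" "t \<noteq> 0" "1 - x * N \<noteq> 0" "1 - x * A \<noteq> 0"
    using cmod_sg[of \<alpha> m] cmod_sg[of \<alpha> n] disc_product_nonzero[of "\<alpha> n"] assms
    by (auto simp: s_def t_def x_def N_def A_def)
  have "zeta_a \<alpha> n z = t * (A - N) / (1 - x * A) + zeta_a \<alpha> m z * (K * p + K * (p * x - y) / t * zeta_a \<alpha> n z)"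
    if z: "cmod z = 1" for z
  proof -
    have d: "1 - x * z \<noteq> 0" "1 - y * z \<noteq> 0"
      using varpi_circle_nonzero[OF _ z] assms by (auto simp: x_def y_def)
    have zn: "zeta_a \<alpha> n z = t * (z - N) / (1 - x * z)" and zm: "zeta_a \<alpha> m z = s * (z - A) / (1 - y * z)"
      by (simp_all add: zeta_a_def s_def t_def A_def N_def x_def y_def)
    have "p * (1 - x * N) = 1 - y * N" using nz by (simp add: p_def)
    moreover have "p * (1 - x * z) + (p * x - y) * (z - N) = p * (1 - x * N) - y * (z - N)" by algebra
    ultimately have num: "p * (1 - x * z) + (p * x - y) * (z - N) = 1 - y * z" by algebra
    have "K * p + K * (p * x - y) / t * zeta_a \<alpha> n z = K * (p + (p * x - y) * (z - N) / (1 - x * z))"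
      unfolding zn using nz by (simp add: distrib_left)
    also have "p + (p * x - y) * (z - N) / (1 - x * z)
        = (p * (1 - x * z) + (p * x - y) * (z - N)) / (1 - x * z)"
      using d by (simp add: add_divide_distrib)
    also have "\<dots> = (1 - y * z) / (1 - x * z)" unfolding num ..
    finally have "zeta_a \<alpha> m z * (K * p + K * (p * x - y) / t * zeta_a \<alpha> n z)
        = s * (z - A) / (1 - y * z) * (K * ((1 - y * z) / (1 - x * z)))"
      unfolding zm by simp
    also have "\<dots> = s * K * (z - A) / (1 - x * z)" using d by simp
    also have "s * K = t * (1 - x * N) / (1 - x * A)" using nz by (simp add: K_def)
    finally have "t * (A - N) / (1 - x * A) + zeta_a \<alpha> m z * (K * p + K * (p * x - y) / t * zeta_a \<alpha> n z)
        = t * ((A - N) / (1 - x * A) + (1 - x * N) / (1 - x * A) * (z - A) / (1 - x * z))"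
      by (simp add: distrib_left)
    also have "(A - N) / (1 - x * A) + (1 - x * N) / (1 - x * A) * (z - A) / (1 - x * z)
        = ((A - N) * (1 - x * z) + (1 - x * N) * (z - A)) / ((1 - x * A) * (1 - x * z))"
      using nz d by (simp add: add_divide_distrib)
    also have "(A - N) * (1 - x * z) + (1 - x * N) * (z - A) = (z - N) * (1 - x * A)" by algebra
    finally show ?thesis unfolding zn using nz by simp
  qed
  then show thesis by (rule that)
qed

lemma zeta_a_mult_Ba:
  assumes \<alpha>: "\<forall>j. cmod (\<alpha> j) < 1" and "k \<le> n"
  shows "(\<lambda>z. zeta_a \<alpha> (Suc n) z * Ba \<alpha> k z) \<in> circle_span \<alpha> (Suc n)"
  using assms(2)
proof (induction k rule: inc_induct)
  case base
  show ?case using circle_span_Ba[of "Suc n" "Suc n" \<alpha>] by (simp add: Ba_Suc[abs_def])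
next
  case (step k)
  obtain a b c where e: "\<And>z. cmod z = 1 \<Longrightarrow>
      zeta_a \<alpha> (Suc n) z = c + zeta_a \<alpha> (Suc k) z * (a + b * zeta_a \<alpha> (Suc n) z)"
    using zeta_a_exchange[OF \<alpha>, of "Suc n" "Suc k"] by blast
  have "(\<lambda>z. c * Ba \<alpha> k z + (a * Ba \<alpha> (Suc k) z + b * (zeta_a \<alpha> (Suc n) z * Ba \<alpha> (Suc k) z)))
      \<in> circle_span \<alpha> (Suc n)"
    using step by (intro circle_span_add circle_span_scale circle_span_Ba) auto
  then show ?case
  proof (rule circle_span_cong)
    fix z :: complex assume z: "cmod z = 1"
    have "zeta_a \<alpha> (Suc n) z * Ba \<alpha> k z
        = (c + zeta_a \<alpha> (Suc k) z * (a + b * zeta_a \<alpha> (Suc n) z)) * Ba \<alpha> k z"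
      using e[OF z] by simp
    also have "\<dots> = c * Ba \<alpha> k z + (a * Ba \<alpha> (Suc k) z + b * (zeta_a \<alpha> (Suc n) z * Ba \<alpha> (Suc k) z))"
      unfolding Ba_Suc by algebra
    finally show "zeta_a \<alpha> (Suc n) z * Ba \<alpha> k z = \<dots>" .
  qed
qed

text \<open>
  All partial products of \<open>\<zeta>\<^sub>1 \<dots> \<zeta>\<^sub>n\<close>, not only the initial ones, belong to \<open>\<L>\<^sub>n\<^sup>\<alpha>\<close>.  On the circle
  this covers \<open>B\<^sub>n\<close> times the conjugate of \<open>B\<^sub>k\<close>, and \<open>B\<^sub>k\<close> of the mixed spaces after the factor
  \<open>\<zeta>\<^sub>j\<close>, \<open>j \<in> \<b>\<^sub>n\<close>, has been removed.
\<close>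

lemma zeta_a_prod_circle_span:
  assumes \<alpha>: "\<forall>j. cmod (\<alpha> j) < 1" and "J \<subseteq> {1..n}"
  shows "(\<lambda>z. \<Prod>j\<in>J. zeta_a \<alpha> j z) \<in> circle_span \<alpha> n"
  using assms(2)
proof (induction n arbitrary: J)
  case 0
  then have J: "J = {}" by auto
  show ?case using circle_span_Ba[of 0 0 \<alpha>] unfolding J by (simp add: Ba_def[abs_def])
next
  case (Suc n)
  show ?case
  proof (cases "Suc n \<in> J")
    case False
    then have "J \<subseteq> {1..n}" using Suc.prems by (auto simp: subset_iff) (metis le_SucE)
    then show ?thesis using Suc.IH circle_span_mono by (metis le_SucI order_refl)
  next
    case True
    let ?J = "J - {Suc n}"
    have "?J \<subseteq> {1..n}" using Suc.prems by (auto simp: subset_iff)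
    then have "(\<lambda>z. \<Prod>j\<in>?J. zeta_a \<alpha> j z) \<in> circle_span \<alpha> n" by (rule Suc.IH)
    then obtain c where c: "\<And>z. cmod z = 1 \<Longrightarrow> (\<Prod>j\<in>?J. zeta_a \<alpha> j z) = (\<Sum>k\<le>n. c k * Ba \<alpha> k z)"
      by (rule circle_spanE) blast
    have fin: "finite J" using Suc.prems finite_subset by blast
    have "(\<lambda>z. \<Sum>k\<le>n. c k * (zeta_a \<alpha> (Suc n) z * Ba \<alpha> k z)) \<in> circle_span \<alpha> (Suc n)"
      by (intro circle_span_sum circle_span_scale zeta_a_mult_Ba \<alpha>) auto
    then show ?thesis
    proof (rule circle_span_cong)
      fix z :: complex assume z: "cmod z = 1"
      have "(\<Prod>j\<in>J. zeta_a \<alpha> j z) = zeta_a \<alpha> (Suc n) z * (\<Prod>j\<in>?J. zeta_a \<alpha> j z)"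
        by (rule prod.remove[OF fin True])
      then show "(\<Prod>j\<in>J. zeta_a \<alpha> j z) = (\<Sum>k\<le>n. c k * (zeta_a \<alpha> (Suc n) z * Ba \<alpha> k z))"
        unfolding c[OF z] by (simp add: sum_distrib_left mult_ac)
    qed
  qed
qed

lemma cmod_prod_zeta_a:
  assumes "\<forall>j. cmod (\<alpha> j) < 1" "cmod z = 1"
  shows "cmod (\<Prod>j\<in>J. zeta_a \<alpha> j z) = 1"
  using cmod_zeta_a assms by (simp add: prod_norm[symmetric])

lemma unimodular_cnj_mult: "cmod a = 1 \<Longrightarrow> a * cnj a = 1"
  by (metis complex_norm_square of_real_1 power_one)

lemma cancel_cnj_prod:
  assumes \<alpha>: "\<forall>j. cmod (\<alpha> j) < 1" and z: "cmod z = 1" and "J \<subseteq> I" "finite I"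
  shows "(\<Prod>j\<in>I. zeta_a \<alpha> j z) * cnj (\<Prod>j\<in>J. zeta_a \<alpha> j z) = (\<Prod>j\<in>I - J. zeta_a \<alpha> j z)"
proof -
  have "(\<Prod>j\<in>I. zeta_a \<alpha> j z) = (\<Prod>j\<in>I - J. zeta_a \<alpha> j z) * (\<Prod>j\<in>J. zeta_a \<alpha> j z)"
    using assms by (intro prod.subset_diff)
  then show ?thesis
    using unimodular_cnj_mult[OF cmod_prod_zeta_a[OF \<alpha> z], of J] by (simp add: mult.assoc)
qed

text \<open>
  The involution \<open>f \<mapsto> B\<^sub>n\<^sup>\<alpha> f\<^sub>*\<close> maps \<open>\<L>\<^sub>n\<^sup>\<alpha>\<close> to itself; on the circle \<open>f\<^sub>*\<close> is the conjugate of \<open>f\<close>.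
\<close>

lemma circle_span_star:
  assumes \<alpha>: "\<forall>j. cmod (\<alpha> j) < 1" and "f \<in> circle_span \<alpha> n"
  shows "(\<lambda>z. Ba \<alpha> n z * cnj (f z)) \<in> circle_span \<alpha> n"
proof -
  obtain c where c: "\<And>z. cmod z = 1 \<Longrightarrow> f z = (\<Sum>k\<le>n. c k * Ba \<alpha> k z)"
    using assms(2) by (rule circle_spanE) blast
  have "(\<lambda>z. \<Sum>k\<le>n. cnj (c k) * (\<Prod>j\<in>{1..n} - {1..k}. zeta_a \<alpha> j z)) \<in> circle_span \<alpha> n"
    by (intro circle_span_sum circle_span_scale zeta_a_prod_circle_span \<alpha>) auto
  then show ?thesis
  proof (rule circle_span_cong)
    fix z :: complex assume z: "cmod z = 1"
    have "Ba \<alpha> n z * cnj (Ba \<alpha> k z) = (\<Prod>j\<in>{1..n} - {1..k}. zeta_a \<alpha> j z)" if "k \<le> n" for k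
      unfolding Ba_def by (rule cancel_cnj_prod[OF \<alpha> z]) (use that in auto)
    then show "Ba \<alpha> n z * cnj (f z) = (\<Sum>k\<le>n. cnj (c k) * (\<Prod>j\<in>{1..n} - {1..k}. zeta_a \<alpha> j z))"
      unfolding c[OF z] by (simp add: sum_distrib_left mult.left_commute)
  qed
qed

section \<open>Orthonormality and uniqueness\<close>

lemma fspan_mono:
  assumes "f \<in> fspan B m" "m \<le> n"
  shows "f \<in> fspan B n"
proof -
  obtain c where c: "\<And>z. f z = (\<Sum>k\<le>m. c k * B k z)" using assms(1) by (auto simp: fspan_def)
  have "f z = (\<Sum>k\<le>n. (if k \<le> m then c k else 0) * B k z)" for z
    unfolding c by (rule sum.mono_neutral_cong_left) (use assms(2) in auto)
  then show ?thesis unfolding fspan_def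
    by (intro CollectI exI[of _ "\<lambda>k. if k \<le> m then c k else 0"]) blast
qed

lemma fspan_const_one: "B 0 = (\<lambda>z. 1) \<Longrightarrow> (\<lambda>z. 1) \<in> fspan B n"
  by (rule fspan_mono[of _ B 0]) (auto simp: fspan_def intro!: exI[of _ "\<lambda>_. 1"])

lemma orf_orthonormal:
  assumes one: "B 0 = (\<lambda>z. 1)" "\<phi> 0 = (\<lambda>z. 1)" and \<mu>: "circle_probability \<mu>"
    and span: "\<And>n. 1 \<le> n \<Longrightarrow> \<phi> n \<in> fspan B n"
    and orth: "\<And>n f. 1 \<le> n \<Longrightarrow> f \<in> fspan B (n - 1) \<Longrightarrow> ip \<mu> f (\<phi> n) = 0"
    and norm: "\<And>n. 1 \<le> n \<Longrightarrow> ip \<mu> (\<phi> n) (\<phi> n) = 1"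
  shows "ip \<mu> (\<phi> j) (\<phi> k) = (if j = k then 1 else 0)"
proof -
  have less: "ip \<mu> (\<phi> j) (\<phi> k) = 0" if "j < k" for j k
  proof (rule orth)
    have "\<phi> j \<in> fspan B j" using span fspan_const_one[of B, OF one(1)] one(2) by (cases j) auto
    then show "\<phi> j \<in> fspan B (k - 1)" by (rule fspan_mono) (use that in auto)
  qed (use that in auto)
  have "ip \<mu> (\<phi> 0) (\<phi> 0) = 1"
    using \<mu> by (simp add: one ip_def circle_probability_def prob_space.prob_space)
  then have diag: "ip \<mu> (\<phi> k) (\<phi> k) = 1" for k using norm by (cases k) auto
  show ?thesis
    using less[of j k] less[of k j] ip_cnj[of \<mu> "\<phi> k" "\<phi> j"] diag by (cases j k rule: linorder_cases) auto
qed

lemma circle_bounded_Ba: "\<forall>j. cmod (\<alpha> j) < 1 \<Longrightarrow> circle_bounded (Ba \<alpha> n)"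
  unfolding Ba_def[abs_def] by (intro circle_bounded_prod circle_bounded_zeta_a) auto

lemma circle_bounded_dBb: "\<forall>j. cmod (\<alpha> j) < 1 \<Longrightarrow> circle_bounded (dBb \<alpha> \<gamma> n)"
  unfolding dBb_def[abs_def] by (intro circle_bounded_prod circle_bounded_zeta_b) auto

lemma circle_bounded_Bg: "\<forall>j. cmod (\<alpha> j) < 1 \<Longrightarrow> circle_bounded (Bg \<alpha> \<gamma> n)"
  unfolding Bg_def[abs_def] dBa_def[abs_def] dBb_def[abs_def]
  by (cases "n = 0"; cases "\<gamma> n = Fin (\<alpha> n)")
     (simp_all add: circle_bounded_const circle_bounded_prod circle_bounded_zeta_a circle_bounded_zeta_b)

lemma orf_a_circle_bounded:
  assumes "\<forall>j. cmod (\<alpha> j) < 1" "orf_a \<alpha> \<mu> \<phi>"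
  shows "circle_bounded (\<phi> n)"
proof (cases n)
  case (Suc m)
  then have "\<phi> n \<in> fspan (Ba \<alpha>) n" using assms(2) by (simp add: orf_a_def)
  then show ?thesis by (rule circle_bounded_fspan[rotated]) (rule circle_bounded_Ba[OF assms(1)])
qed (use assms in \<open>simp add: orf_a_def circle_bounded_const\<close>)

lemma orf_g_circle_bounded:
  assumes "\<forall>j. cmod (\<alpha> j) < 1" "orf_g \<alpha> \<gamma> \<mu> \<phi>"
  shows "circle_bounded (\<phi> n)"
proof (cases n)
  case (Suc m)
  then have "\<phi> n \<in> fspan (Bg \<alpha> \<gamma>) n" using assms(2) by (simp add: orf_g_def)
  then show ?thesis by (rule circle_bounded_fspan[rotated]) (rule circle_bounded_Bg[OF assms(1)])
qed (use assms in \<open>simp add: orf_g_def circle_bounded_const\<close>)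

lemma orf_a_orthonormal:
  assumes "circle_probability \<mu>" "orf_a \<alpha> \<mu> \<phi>"
  shows "ip \<mu> (\<phi> j) (\<phi> k) = (if j = k then 1 else 0)"
  by (rule orf_orthonormal[of "Ba \<alpha>"]) (use assms in \<open>auto simp: orf_a_def Ba_def[abs_def]\<close>)

lemma orf_g_orthonormal:
  assumes "circle_probability \<mu>" "orf_g \<alpha> \<gamma> \<mu> \<phi>"
  shows "ip \<mu> (\<phi> j) (\<phi> k) = (if j = k then 1 else 0)"
  by (rule orf_orthonormal[of "Bg \<alpha> \<gamma>"]) (use assms in \<open>auto simp: orf_g_def Bg_def[abs_def]\<close>)

text \<open>
  The coefficient of \<open>B\<^sub>n\<close> in \<open>\<phi>\<^sub>n\<close> cannot vanish, since \<open>\<phi>\<^sub>n\<close> would then be orthogonal to itself.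
\<close>

lemma orf_a_spans:
  assumes \<alpha>: "\<forall>j. cmod (\<alpha> j) < 1" and \<mu>: "circle_probability \<mu>" and orf: "orf_a \<alpha> \<mu> \<phi>"
    and "f \<in> circle_span \<alpha> n"
  shows "\<exists>d. \<forall>z. cmod z = 1 \<longrightarrow> f z = (\<Sum>k\<le>n. d k * \<phi> k z)"
  using assms(4)
proof (induction n arbitrary: f)
  case 0
  then obtain c where "\<And>z. cmod z = 1 \<Longrightarrow> f z = (\<Sum>k\<le>0. c k * Ba \<alpha> k z)" by (rule circle_spanE) blast
  then show ?case using orf by (intro exI[of _ c]) (simp add: orf_a_def Ba_def)
next
  case (Suc n)
  have phi: "\<phi> (Suc n) \<in> fspan (Ba \<alpha>) (Suc n)" using orf by (simp add: orf_a_def)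
  then obtain c where c: "\<And>z. \<phi> (Suc n) z = (\<Sum>k\<le>Suc n. c k * Ba \<alpha> k z)" by (auto simp: fspan_def)
  have nz: "c (Suc n) \<noteq> 0"
  proof
    assume "c (Suc n) = 0"
    then have "\<phi> (Suc n) \<in> fspan (Ba \<alpha>) n" using c unfolding fspan_def by auto
    moreover have "\<forall>f\<in>fspan (Ba \<alpha>) (Suc n - 1). ip \<mu> f (\<phi> (Suc n)) = 0"
      using orf unfolding orf_a_def by (metis le_add1 plus_1_eq_Suc)
    ultimately have "ip \<mu> (\<phi> (Suc n)) (\<phi> (Suc n)) = 0" by simp
    then show False using orf_a_orthonormal[OF \<mu> orf] by simp
  qed
  obtain b where b: "\<And>z. cmod z = 1 \<Longrightarrow> f z = (\<Sum>k\<le>Suc n. b k * Ba \<alpha> k z)"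
    using Suc.prems by (rule circle_spanE) blast
  define r where "r = b (Suc n) / c (Suc n)"
  have "(\<lambda>z. f z - r * \<phi> (Suc n) z) \<in> circle_span \<alpha> n"
  proof (rule circle_spanI[where c = "\<lambda>k. b k - r * c k"])
    fix z :: complex assume z: "cmod z = 1"
    show "f z - r * \<phi> (Suc n) z = (\<Sum>k\<le>n. (b k - r * c k) * Ba \<alpha> k z)"
      unfolding b[OF z] c using nz
      by (simp add: r_def algebra_simps sum_subtractf sum_distrib_left)
  qed
  from Suc.IH[OF this] obtain d where
    d: "\<And>z. cmod z = 1 \<Longrightarrow> f z - r * \<phi> (Suc n) z = (\<Sum>k\<le>n. d k * \<phi> k z)" by blast
  have "f z = (\<Sum>k\<le>Suc n. (d(Suc n := r)) k * \<phi> k z)" if "cmod z = 1" for z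
    using d[OF that] by (simp add: diff_eq_eq)
  then show ?case by blast
qed

lemma orf_a_unique:
  assumes \<alpha>: "\<forall>j. cmod (\<alpha> j) < 1" and \<mu>: "circle_probability \<mu>" and orf: "orf_a \<alpha> \<mu> \<phi>"
    and f: "f \<in> circle_span \<alpha> n" "circle_bounded f" and orth: "\<And>k. k < n \<Longrightarrow> ip \<mu> (\<phi> k) f = 0"
  shows "\<exists>c. \<forall>z. cmod z = 1 \<longrightarrow> f z = c * \<phi> n z"
proof -
  note cb = orf_a_circle_bounded[OF \<alpha> orf]
  obtain d where d: "\<And>z. cmod z = 1 \<Longrightarrow> f z = (\<Sum>k\<le>n. d k * \<phi> k z)"
    using orf_a_spans[OF \<alpha> \<mu> orf f(1)] by blast
  have "d j = 0" if "j < n" for j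
  proof -
    have "0 = ip \<mu> (\<phi> j) f" using orth[OF that] by simp
    also have "\<dots> = ip \<mu> (\<phi> j) (\<lambda>z. \<Sum>k\<le>n. d k * \<phi> k z)"
    proof (rule ip_cong[OF \<mu> cb f(2) cb])
      show "circle_bounded (\<lambda>z. \<Sum>k\<le>n. d k * \<phi> k z)" by (intro circle_bounded_intros cb)
    qed (simp add: d)
    also have "\<dots> = (\<Sum>k\<le>n. d k * ip \<mu> (\<phi> j) (\<phi> k))"
      by (rule ip_sum_right[OF \<mu> cb cb])
    also have "\<dots> = d j"
      using that by (simp add: orf_a_orthonormal[OF \<mu> orf] if_distrib[of "\<lambda>c. _ * c"] cong: if_cong)
    finally show ?thesis ..
  qed
  then have "(\<Sum>k\<le>n. d k * \<phi> k z) = d n * \<phi> n z" for z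
    by (subst sum.mono_neutral_right[of "{..n}" "{n}"]) auto
  then show ?thesis using d by auto
qed

section \<open>The general orthogonal functions in terms of the classical ones\<close>

lemma idx_partition:
  assumes "\<forall>j. cmod (\<alpha> j) < 1" "\<forall>j. \<gamma> j \<in> {Fin (\<alpha> j), beta \<alpha> j}"
  shows "idx_a \<alpha> \<gamma> n \<union> idx_b \<alpha> \<gamma> n = {1..n}" "idx_a \<alpha> \<gamma> n \<inter> idx_b \<alpha> \<gamma> n = {}"
  using assms beta_neq by (auto simp: idx_a_def idx_b_def)

lemma finite_idx: "finite (idx_a \<alpha> \<gamma> n)" "finite (idx_b \<alpha> \<gamma> n)"
  by (rule finite_subset[of _ "{1..n}"], auto simp: idx_a_def idx_b_def)+

lemma idx_b_Suc:
  assumes "\<forall>j. cmod (\<alpha> j) < 1" "\<forall>j. \<gamma> j \<in> {Fin (\<alpha> j), beta \<alpha> j}"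
  shows "idx_b \<alpha> \<gamma> (Suc n) =
    (if \<gamma> (Suc n) = Fin (\<alpha> (Suc n)) then idx_b \<alpha> \<gamma> n else insert (Suc n) (idx_b \<alpha> \<gamma> n))"
  using assms beta_neq[of \<alpha> "Suc n"] by (auto simp: idx_b_def le_Suc_eq)

lemma dBb_circle:
  assumes \<alpha>: "\<forall>j. cmod (\<alpha> j) < 1" and z: "cmod z = 1"
  shows "dBb \<alpha> \<gamma> n z = cnj (\<Prod>j\<in>idx_b \<alpha> \<gamma> n. zeta_a \<alpha> j z)" "cmod (dBb \<alpha> \<gamma> n z) = 1"
proof -
  have "zeta_b \<alpha> j z = cnj (zeta_a \<alpha> j z)" for j
  proof -
    have "inverse (zeta_a \<alpha> j z) = cnj (zeta_a \<alpha> j z)"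
      using unimodular_cnj_mult[OF cmod_zeta_a[of \<alpha> j z]] \<alpha> z by (simp add: inverse_unique)
    then show ?thesis using zeta_b_eq_inverse[of z \<alpha> j] circle_nonzero[OF z] by simp
  qed
  then show 1: "dBb \<alpha> \<gamma> n z = cnj (\<Prod>j\<in>idx_b \<alpha> \<gamma> n. zeta_a \<alpha> j z)"
    by (simp add: dBb_def)
  show "cmod (dBb \<alpha> \<gamma> n z) = 1"
    unfolding 1 complex_mod_cnj by (rule cmod_prod_zeta_a[OF \<alpha> z])
qed

lemma dBb_Suc_circle:
  assumes \<alpha>: "\<forall>j. cmod (\<alpha> j) < 1" and \<gamma>: "\<forall>j. \<gamma> j \<in> {Fin (\<alpha> j), beta \<alpha> j}" and z: "cmod z = 1"
  shows "dBb \<alpha> \<gamma> (Suc n) z =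
    (if \<gamma> (Suc n) = Fin (\<alpha> (Suc n)) then dBb \<alpha> \<gamma> n z else cnj (zeta_a \<alpha> (Suc n) z) * dBb \<alpha> \<gamma> n z)"
proof -
  have "Suc n \<notin> idx_b \<alpha> \<gamma> n" by (simp add: idx_b_def)
  then show ?thesis
    unfolding dBb_circle[OF \<alpha> z] idx_b_Suc[OF \<alpha> \<gamma>] by (simp add: finite_idx)
qed

lemma Ba_split:
  assumes \<alpha>: "\<forall>j. cmod (\<alpha> j) < 1" and \<gamma>: "\<forall>j. \<gamma> j \<in> {Fin (\<alpha> j), beta \<alpha> j}"
  shows "Ba \<alpha> n z = dBa \<alpha> \<gamma> n z * (\<Prod>j\<in>idx_b \<alpha> \<gamma> n. zeta_a \<alpha> j z)"
  unfolding Ba_def dBa_def idx_partition(1)[OF \<alpha> \<gamma>, symmetric]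
  by (rule prod.union_disjoint) (use finite_idx idx_partition(2)[OF \<alpha> \<gamma>] in auto)

lemma cmod_Ba: "\<forall>j. cmod (\<alpha> j) < 1 \<Longrightarrow> cmod z = 1 \<Longrightarrow> cmod (Ba \<alpha> n z) = 1"
  unfolding Ba_def by (rule cmod_prod_zeta_a)

text \<open>
  Multiplying \<open>B\<^sub>k\<close> by the conjugate of \<^const>\<open>dBb\<close> leaves a product of distinct \<open>\<zeta>\<^sub>j\<^sup>\<alpha>\<close>: either the factors in
  \<open>\<a>\<^sub>k\<close> are added to those in \<open>\<b>\<^sub>n\<close>, or those in \<open>\<b>\<^sub>k\<close> cancel.
\<close>

lemma Bg_circle_span:
  assumes \<alpha>: "\<forall>j. cmod (\<alpha> j) < 1" and \<gamma>: "\<forall>j. \<gamma> j \<in> {Fin (\<alpha> j), beta \<alpha> j}" and "k \<le> n"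
  shows "(\<lambda>z. cnj (dBb \<alpha> \<gamma> n z) * Bg \<alpha> \<gamma> k z) \<in> circle_span \<alpha> n"
proof -
  define J where "J = (if k = 0 then idx_b \<alpha> \<gamma> n else if \<gamma> k = Fin (\<alpha> k) then idx_b \<alpha> \<gamma> n \<union> idx_a \<alpha> \<gamma> k
    else idx_b \<alpha> \<gamma> n - idx_b \<alpha> \<gamma> k)"
  have J: "J \<subseteq> {1..n}" using \<open>k \<le> n\<close> by (auto simp: J_def idx_a_def idx_b_def)
  have sub: "idx_b \<alpha> \<gamma> k \<subseteq> idx_b \<alpha> \<gamma> n" using \<open>k \<le> n\<close> by (auto simp: idx_b_def)
  have disj: "idx_b \<alpha> \<gamma> n \<inter> idx_a \<alpha> \<gamma> k = {}"
    using idx_partition(2)[OF \<alpha> \<gamma>, of n] \<open>k \<le> n\<close> by (auto simp: idx_a_def idx_b_def)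
  from zeta_a_prod_circle_span[OF \<alpha> J] show ?thesis
  proof (rule circle_span_cong)
    fix z :: complex assume z: "cmod z = 1"
    let ?P = "\<lambda>I. \<Prod>j\<in>I. zeta_a \<alpha> j z"
    have "?P (idx_b \<alpha> \<gamma> n) * ?P (idx_a \<alpha> \<gamma> k) = ?P (idx_b \<alpha> \<gamma> n \<union> idx_a \<alpha> \<gamma> k)"
      by (rule prod.union_disjoint[symmetric]) (use finite_idx disj in auto)
    moreover have "?P (idx_b \<alpha> \<gamma> n) * cnj (?P (idx_b \<alpha> \<gamma> k)) = ?P (idx_b \<alpha> \<gamma> n - idx_b \<alpha> \<gamma> k)"
      by (rule cancel_cnj_prod[OF \<alpha> z sub finite_idx(2)])
    ultimately show "cnj (dBb \<alpha> \<gamma> n z) * Bg \<alpha> \<gamma> k z = ?P J"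
      by (simp add: Bg_def J_def dBb_circle[OF \<alpha> z] dBa_def)
  qed
qed

lemma fspan_Bg_circle_span:
  assumes \<alpha>: "\<forall>j. cmod (\<alpha> j) < 1" and \<gamma>: "\<forall>j. \<gamma> j \<in> {Fin (\<alpha> j), beta \<alpha> j}" and "f \<in> fspan (Bg \<alpha> \<gamma>) n"
  shows "(\<lambda>z. cnj (dBb \<alpha> \<gamma> n z) * f z) \<in> circle_span \<alpha> n"
proof -
  obtain c where c: "\<And>z. f z = (\<Sum>k\<le>n. c k * Bg \<alpha> \<gamma> k z)" using assms(3) by (auto simp: fspan_def)
  have "(\<lambda>z. \<Sum>k\<le>n. c k * (cnj (dBb \<alpha> \<gamma> n z) * Bg \<alpha> \<gamma> k z)) \<in> circle_span \<alpha> n"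
    by (intro circle_span_sum circle_span_scale Bg_circle_span \<alpha> \<gamma>) auto
  then show ?thesis by (rule circle_span_cong) (simp add: c sum_distrib_left mult.left_commute)
qed

lemma circle_span_Suc_split:
  assumes "f \<in> circle_span \<alpha> (Suc n)"
  obtains b g where "g \<in> circle_span \<alpha> n" "\<And>z. cmod z = 1 \<Longrightarrow> f z = b * Ba \<alpha> (Suc n) z + g z"
proof -
  obtain c where c: "\<And>z. cmod z = 1 \<Longrightarrow> f z = (\<Sum>k\<le>Suc n. c k * Ba \<alpha> k z)"
    using assms by (rule circle_spanE) blast
  have "(\<lambda>z. \<Sum>k\<le>n. c k * Ba \<alpha> k z) \<in> circle_span \<alpha> n" by (rule circle_spanI) simp
  then show thesis by (rule that[of _ "c (Suc n)"]) (simp add: c)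
qed

text \<open>
  Conversely \<open>\<L>\<^sub>n\<close> exhausts \<open>D\<^sub>n \<L>\<^sub>n\<^sup>\<alpha>\<close>, where \<open>D\<^sub>n\<close> is \<^const>\<open>dBb\<close>.  In an \<open>\<alpha>\<close>-step this space grows by
  \<open>B\<^sub>n\<close>, as the one for \<open>\<alpha>\<close> alone.  A \<open>\<beta>\<close>-step is the same one after applying the
  involution \<open>f \<mapsto> B\<^sub>n\<^sup>\<alpha> f\<^sub>*\<close>, which exchanges \<open>B\<^sub>n\<^sup>\<alpha>\<close> with the constant \<open>1\<close>.
\<close>

lemma circle_span_fspan_Bg:
  assumes \<alpha>: "\<forall>j. cmod (\<alpha> j) < 1" and \<gamma>: "\<forall>j. \<gamma> j \<in> {Fin (\<alpha> j), beta \<alpha> j}" and "g \<in> circle_span \<alpha> n"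
  shows "\<exists>f\<in>fspan (Bg \<alpha> \<gamma>) n. \<forall>z. cmod z = 1 \<longrightarrow> f z = dBb \<alpha> \<gamma> n z * g z"
  using assms(3)
proof (induction n arbitrary: g)
  case 0
  then obtain c where c: "\<And>z. cmod z = 1 \<Longrightarrow> g z = (\<Sum>k\<le>0. c k * Ba \<alpha> k z)" by (rule circle_spanE) blast
  have "idx_b \<alpha> \<gamma> 0 = {}" by (auto simp: idx_b_def)
  then show ?case
    by (intro bexI[of _ "\<lambda>z. \<Sum>k\<le>0. c k * Bg \<alpha> \<gamma> k z"]) (auto simp: c Ba_def Bg_def dBb_def fspan_def)
next
  case (Suc n)
  let ?D = "dBb \<alpha> \<gamma>"
  have ext: "(\<lambda>z. b * Bg \<alpha> \<gamma> (Suc n) z + f z) \<in> fspan (Bg \<alpha> \<gamma>) (Suc n)"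
    if f: "f \<in> fspan (Bg \<alpha> \<gamma>) n" for b f
  proof -
    obtain c where c: "\<And>z. f z = (\<Sum>k\<le>n. c k * Bg \<alpha> \<gamma> k z)" using f by (auto simp: fspan_def)
    then have "b * Bg \<alpha> \<gamma> (Suc n) z + f z = (\<Sum>k\<le>Suc n. (c(Suc n := b)) k * Bg \<alpha> \<gamma> k z)" for z
      by simp
    then show ?thesis unfolding fspan_def by blast
  qed
  show ?case
  proof (cases "\<gamma> (Suc n) = Fin (\<alpha> (Suc n))")
    case True
    obtain b h where h: "h \<in> circle_span \<alpha> n" "\<And>z. cmod z = 1 \<Longrightarrow> g z = b * Ba \<alpha> (Suc n) z + h z"
      using Suc.prems by (rule circle_span_Suc_split) blast
    obtain f where f: "f \<in> fspan (Bg \<alpha> \<gamma>) n" "\<And>z. cmod z = 1 \<Longrightarrow> f z = ?D n z * h z"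
      using Suc.IH[OF h(1)] by blast
    have eq: "b * Bg \<alpha> \<gamma> (Suc n) z + f z = ?D (Suc n) z * g z" if z: "cmod z = 1" for z
    proof -
      have "?D (Suc n) z * Ba \<alpha> (Suc n) z = Bg \<alpha> \<gamma> (Suc n) z"
        using unimodular_cnj_mult[OF cmod_prod_zeta_a[OF \<alpha> z], of "idx_b \<alpha> \<gamma> (Suc n)"] True
        by (simp add: Ba_split[OF \<alpha> \<gamma>] Bg_def dBb_circle[OF \<alpha> z] mult_ac)
      moreover have "?D (Suc n) z = ?D n z" using True by (simp add: dBb_Suc_circle[OF \<alpha> \<gamma> z])
      ultimately show ?thesis by (simp add: h(2)[OF z] f(2)[OF z] distrib_left mult.left_commute)
    qed
    show ?thesis by (rule bexI[OF _ ext[OF f(1), of b]]) (use eq in blast)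
  next
    case False
    obtain b h where h: "h \<in> circle_span \<alpha> n"
      "\<And>z. cmod z = 1 \<Longrightarrow> Ba \<alpha> (Suc n) z * cnj (g z) = b * Ba \<alpha> (Suc n) z + h z"
      using circle_span_star[OF \<alpha> Suc.prems] by (rule circle_span_Suc_split) blast
    obtain f where f: "f \<in> fspan (Bg \<alpha> \<gamma>) n" "\<And>z. cmod z = 1 \<Longrightarrow> f z = ?D n z * (Ba \<alpha> n z * cnj (h z))"
      using Suc.IH[OF circle_span_star[OF \<alpha> h(1)]] by blast
    have eq: "cnj b * Bg \<alpha> \<gamma> (Suc n) z + f z = ?D (Suc n) z * g z" if z: "cmod z = 1" for z
    proof -
      let ?B = "Ba \<alpha> (Suc n) z"
      have B: "?B * cnj ?B = 1" by (rule unimodular_cnj_mult[OF cmod_Ba[OF \<alpha> z]])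
      have "g z = ?B * cnj (?B * cnj (g z))" using B by (simp add: mult.assoc[symmetric])
      also have "\<dots> = cnj b * (?B * cnj ?B) + ?B * cnj (h z)"
        unfolding h(2)[OF z] by (simp add: algebra_simps)
      finally have g: "g z = cnj b + ?B * cnj (h z)" unfolding B by simp
      have "?D (Suc n) z * ?B = ?D n z * Ba \<alpha> n z"
        using False unimodular_cnj_mult[OF cmod_zeta_a[of \<alpha> "Suc n" z]] \<alpha> z
        by (simp add: dBb_Suc_circle[OF \<alpha> \<gamma> z] Ba_Suc mult_ac)
      moreover have "Bg \<alpha> \<gamma> (Suc n) z = ?D (Suc n) z" using False by (simp add: Bg_def)
      ultimately show ?thesis
        by (simp add: g f(2)[OF z] distrib_left mult.assoc[symmetric])
    qed
    show ?thesis by (rule bexI[OF _ ext[OF f(1), of "cnj b"]]) (use eq in blast)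
  qed
qed

lemma substar_circle: "cmod z = 1 \<Longrightarrow> substar f z = cnj (f z)"
  by (simp add: substar_def circle_cnj circle_nonzero)

text \<open>
  If \<open>\<gamma>\<^sub>n = \<alpha>\<^sub>n\<close>, dividing \<open>\<phi>\<^sub>n\<close> by \<open>D\<^sub>n = D\<^sub>n\<^sub>-\<^sub>1\<close> gives a function in \<open>\<L>\<^sub>n\<^sup>\<alpha>\<close> orthogonal to \<open>\<L>\<^sub>n\<^sub>-\<^sub>1\<^sup>\<alpha>\<close>, a
  multiple of \<open>\<phi>\<^sub>n\<^sup>\<alpha>\<close>.  If \<open>\<gamma>\<^sub>n = \<beta>\<^sub>n\<close>, then \<open>D\<^sub>n = D\<^sub>n\<^sub>-\<^sub>1 / \<zeta>\<^sub>n\<close>, the quotient is orthogonal to \<open>\<zeta>\<^sub>n \<L>\<^sub>n\<^sub>-\<^sub>1\<^sup>\<alpha>\<close>,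
  and its image under the star operation is a multiple of \<open>\<phi>\<^sub>n\<^sup>\<alpha>\<close>.  The constant has modulus one, and
  it is positive because the two normalizations are limits of rational functions that are
  proportional on the circle.
\<close>

lemma orf_g_formula:
  assumes \<alpha>: "\<forall>j. cmod (\<alpha> j) < 1" and \<gamma>: "\<forall>j. \<gamma> j \<in> {Fin (\<alpha> j), beta \<alpha> j}"
    and \<mu>: "circle_probability \<mu>" and a: "orf_a \<alpha> \<mu> \<phi>\<alpha>" and g: "orf_g \<alpha> \<gamma> \<mu> \<phi>" and z: "cmod z = 1"
  shows "\<phi> n z = dBb \<alpha> \<gamma> n z *
    (if \<gamma> n = Fin (\<alpha> n) then \<phi>\<alpha> n z else star_a \<alpha> n (\<phi>\<alpha> n) z)"
proof (cases n)
  case 0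
  moreover have "idx_b \<alpha> \<gamma> 0 = {}" by (auto simp: idx_b_def)
  ultimately show ?thesis
    using a g by (simp add: orf_a_def orf_g_def dBb_def star_a_def Ba_def substar_def)
next
  case (Suc m)
  let ?D = "dBb \<alpha> \<gamma>"
  note cba = orf_a_circle_bounded[OF \<alpha> a] and cbg = orf_g_circle_bounded[OF \<alpha> g]
    and cbD = circle_bounded_dBb[OF \<alpha>, of \<gamma>] and cbB = circle_bounded_Ba[OF \<alpha>]
  have span: "\<phi> n \<in> fspan (Bg \<alpha> \<gamma>) n" and orth: "\<And>f. f \<in> fspan (Bg \<alpha> \<gamma>) m \<Longrightarrow> ip \<mu> f (\<phi> n) = 0"
    and ga: "\<gamma> n = Fin (\<alpha> n) \<Longrightarrow> pos_at (\<lambda>z. star_g \<alpha> \<gamma> n (\<phi> n) z / ?D n z) (Fin (\<alpha> n))"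
    and gb: "\<gamma> n = beta \<alpha> n \<Longrightarrow> pos_at (\<lambda>z. star_g \<alpha> \<gamma> n (\<phi> n) z / dBa \<alpha> \<gamma> n z) (beta \<alpha> n)"
    using g unfolding orf_g_def Suc by (metis diff_Suc_1 le_add1 plus_1_eq_Suc)+
  have spana: "\<phi>\<alpha> k \<in> fspan (Ba \<alpha>) k" for k
    using a fspan_const_one[of "Ba \<alpha>" k] by (cases k) (auto simp: orf_a_def Ba_def[abs_def])
  have posa: "pos_at (star_a \<alpha> n (\<phi>\<alpha> n)) (Fin (\<alpha> n))"
    using a unfolding orf_a_def Suc by (metis le_add1 plus_1_eq_Suc)
  have rg: "rational_fun (\<phi> n)" by (rule rational_fun_fspan[OF rational_fun_Bg span])
  have ra: "rational_fun (\<phi>\<alpha> n)" by (rule rational_fun_fspan[OF rational_fun_Ba spana])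
  have rsg: "rational_fun (star_g \<alpha> \<gamma> n (\<phi> n))"
    unfolding star_g_def[abs_def] by (intro rational_fun_intros rational_fun_dBa rational_fun_dBb rational_fun_substar rg)
  have rsa: "rational_fun (star_a \<alpha> n (\<phi>\<alpha> n))"
    unfolding star_a_def[abs_def] by (intro rational_fun_intros rational_fun_Ba rational_fun_substar ra)
  have D: "?D n z * cnj (?D n z) = 1" if "cmod z = 1" for z
    by (rule unimodular_cnj_mult[OF dBb_circle(2)[OF \<alpha> that]])
  have B: "Ba \<alpha> n z * cnj (Ba \<alpha> n z) = 1" if "cmod z = 1" for z
    by (rule unimodular_cnj_mult[OF cmod_Ba[OF \<alpha> that]])
  have D0: "?D n z \<noteq> 0" if "cmod z = 1" for z using dBb_circle(2)[OF \<alpha> that, of \<gamma> n] by auto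
  have orth': "ip \<mu> h (\<phi> n) = 0"
    if f: "f \<in> circle_span \<alpha> m" and h: "circle_bounded h" "\<And>z. cmod z = 1 \<Longrightarrow> h z = ?D m z * f z" for f h
  proof -
    obtain f' where f': "f' \<in> fspan (Bg \<alpha> \<gamma>) m" "\<And>z. cmod z = 1 \<Longrightarrow> f' z = ?D m z * f z"
      using circle_span_fspan_Bg[OF \<alpha> \<gamma> f] by blast
    have "ip \<mu> h (\<phi> n) = ip \<mu> f' (\<phi> n)"
      by (rule ip_cong[OF \<mu> h(1) cbg circle_bounded_fspan[OF circle_bounded_Bg[OF \<alpha>] f'(1)] cbg])
         (simp add: f' h(2))
    then show ?thesis using orth[OF f'(1)] by simp
  qed
  have unit: "cmod c = 1" if "\<And>z. cmod z = 1 \<Longrightarrow> cmod (\<phi> n z) = cmod c * cmod (\<phi>\<alpha> n z)" for c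
  proof -
    have "mean_square \<mu> (\<phi> n) = mean_square \<mu> (\<lambda>z. c * \<phi>\<alpha> n z)"
      by (rule mean_square_cong[OF \<mu> cbg]) (intro circle_bounded_intros cba, simp add: that norm_mult)
    moreover have "complex_of_real (mean_square \<mu> (\<phi> n)) = 1" "complex_of_real (mean_square \<mu> (\<phi>\<alpha> n)) = 1"
      unfolding mean_square_ip by (simp_all add: orf_a_orthonormal[OF \<mu> a] orf_g_orthonormal[OF \<mu> g])
    ultimately have "(cmod c)\<^sup>2 = 1" unfolding of_real_eq_1_iff by (simp add: mean_square_scale)
    then show ?thesis by (simp add: power2_eq_1_iff)  (metis norm_ge_zero not_one_le_zero neg_0_le_iff_le)
  qed
  show ?thesis
  proof (cases "\<gamma> n = Fin (\<alpha> n)")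
    case True
    have Dn: "?D n z = ?D m z" if "cmod z = 1" for z
      using dBb_Suc_circle[OF \<alpha> \<gamma> that, of m] True Suc by simp
    have "\<exists>c. \<forall>z. cmod z = 1 \<longrightarrow> cnj (?D n z) * \<phi> n z = c * \<phi>\<alpha> n z"
    proof (rule orf_a_unique[OF \<alpha> \<mu> a fspan_Bg_circle_span[OF \<alpha> \<gamma> span]])
      show "circle_bounded (\<lambda>z. cnj (?D n z) * \<phi> n z)" by (intro circle_bounded_intros cbD cbg)
      fix k assume "k < n"
      have "ip \<mu> (\<phi>\<alpha> k) (\<lambda>z. cnj (?D n z) * \<phi> n z) = ip \<mu> (\<lambda>z. ?D n z * \<phi>\<alpha> k z) (\<phi> n)"
        unfolding ip_def by (simp add: mult_ac)
      also have "\<dots> = 0"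
      proof (rule orth')
        show "\<phi>\<alpha> k \<in> circle_span \<alpha> m"
          by (rule circle_span_mono[OF fspan_circle_span[OF spana]]) (use \<open>k < n\<close> Suc in simp)
        show "circle_bounded (\<lambda>z. ?D n z * \<phi>\<alpha> k z)" by (intro circle_bounded_intros cbD cba)
      qed (simp add: Dn)
      finally show "ip \<mu> (\<phi>\<alpha> k) (\<lambda>z. cnj (?D n z) * \<phi> n z) = 0" .
    qed
    then obtain c where c: "\<And>z. cmod z = 1 \<Longrightarrow> cnj (?D n z) * \<phi> n z = c * \<phi>\<alpha> n z" by blast
    have phi: "\<phi> n z = c * (?D n z * \<phi>\<alpha> n z)" if "cmod z = 1" for z
      using arg_cong[OF c[OF that], of "\<lambda>w. ?D n z * w"] D[OF that]
      by (simp add: mult.assoc[symmetric])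
    have "cmod c = 1"
      by (rule unit) (simp add: phi norm_mult dBb_circle(2)[OF \<alpha>])
    moreover have "cnj c = 1"
    proof (rule pos_at_rational[OF _ rsa _ ga[OF True] posa])
      show "rational_fun (\<lambda>z. star_g \<alpha> \<gamma> n (\<phi> n) z / ?D n z)"
        by (intro rational_fun_intros rsg rational_fun_dBb)
      fix z :: complex assume z: "cmod z = 1"
      have "star_g \<alpha> \<gamma> n (\<phi> n) z / ?D n z = dBa \<alpha> \<gamma> n z * cnj (\<phi> n z)"
        using D0[OF z] by (simp add: star_g_def substar_circle[OF z])
      also have "\<dots> = cnj c * ((dBa \<alpha> \<gamma> n z * cnj (?D n z)) * cnj (\<phi>\<alpha> n z))"
        by (simp add: phi[OF z] mult_ac)
      also have "dBa \<alpha> \<gamma> n z * cnj (?D n z) = Ba \<alpha> n z"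
        by (simp add: Ba_split[OF \<alpha> \<gamma>] dBb_circle[OF \<alpha> z])
      finally show "star_g \<alpha> \<gamma> n (\<phi> n) z / ?D n z = cnj c * star_a \<alpha> n (\<phi>\<alpha> n) z"
        by (simp add: star_a_def substar_circle[OF z])
    qed (simp add: \<open>cmod c = 1\<close>)
    ultimately have "c = 1" by (metis complex_cnj_cnj complex_cnj_one)
    then show ?thesis using phi[OF z] True by simp
  next
    case False
    with \<gamma> have beta: "\<gamma> n = beta \<alpha> n" by blast
    have BD: "Ba \<alpha> n z * ?D n z = Ba \<alpha> m z * ?D m z" if z: "cmod z = 1" for z
      using dBb_Suc_circle[OF \<alpha> \<gamma> z, of m] False Suc unimodular_cnj_mult[OF cmod_zeta_a[of \<alpha> n z]] \<alpha> z
      by (simp add: Ba_Suc mult_ac)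
    have "\<exists>c. \<forall>z. cmod z = 1 \<longrightarrow> Ba \<alpha> n z * cnj (cnj (?D n z) * \<phi> n z) = c * \<phi>\<alpha> n z"
    proof (rule orf_a_unique[OF \<alpha> \<mu> a circle_span_star[OF \<alpha> fspan_Bg_circle_span[OF \<alpha> \<gamma> span]]])
      show "circle_bounded (\<lambda>z. Ba \<alpha> n z * cnj (cnj (?D n z) * \<phi> n z))"
        by (intro circle_bounded_intros cbD cbg cbB)
      fix k assume k: "k < n"
      have "ip \<mu> (\<phi>\<alpha> k) (\<lambda>z. Ba \<alpha> n z * cnj (cnj (?D n z) * \<phi> n z))
          = ip \<mu> (\<phi> n) (\<lambda>z. Ba \<alpha> n z * ?D n z * cnj (\<phi>\<alpha> k z))"
        unfolding ip_def by (simp add: mult_ac)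
      also have "\<dots> = cnj (ip \<mu> (\<lambda>z. Ba \<alpha> n z * ?D n z * cnj (\<phi>\<alpha> k z)) (\<phi> n))"
        by (rule ip_cnj[symmetric])
      also have "ip \<mu> (\<lambda>z. Ba \<alpha> n z * ?D n z * cnj (\<phi>\<alpha> k z)) (\<phi> n) = 0"
      proof (rule orth')
        show "(\<lambda>z. Ba \<alpha> m z * cnj (\<phi>\<alpha> k z)) \<in> circle_span \<alpha> m"
          by (rule circle_span_star[OF \<alpha> circle_span_mono[OF fspan_circle_span[OF spana]]])
             (use k Suc in simp)
        show "circle_bounded (\<lambda>z. Ba \<alpha> n z * ?D n z * cnj (\<phi>\<alpha> k z))"
          by (intro circle_bounded_intros cbD cba cbB)
      qed (simp add: BD mult_ac)
      finally show "ip \<mu> (\<phi>\<alpha> k) (\<lambda>z. Ba \<alpha> n z * cnj (cnj (?D n z) * \<phi> n z)) = 0" by simp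
    qed
    then obtain c where c: "\<And>z. cmod z = 1 \<Longrightarrow> Ba \<alpha> n z * cnj (cnj (?D n z) * \<phi> n z) = c * \<phi>\<alpha> n z" by blast
    have cphi: "cnj (\<phi> n z) = c * cnj (?D n z) * cnj (Ba \<alpha> n z) * \<phi>\<alpha> n z" if z: "cmod z = 1" for z
    proof -
      have "c * cnj (?D n z) * cnj (Ba \<alpha> n z) * \<phi>\<alpha> n z
          = (?D n z * cnj (?D n z)) * (Ba \<alpha> n z * cnj (Ba \<alpha> n z)) * cnj (\<phi> n z)"
        using c[OF z] by (simp add: mult_ac)
      then show ?thesis using D[OF z] B[OF z] by simp
    qed
    have "cmod c = 1"
    proof (rule unit)
      fix z :: complex assume z: "cmod z = 1"
      have "cmod (\<phi> n z) = cmod (cnj (\<phi> n z))" by simp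
      then show "cmod (\<phi> n z) = cmod c * cmod (\<phi>\<alpha> n z)"
        unfolding cphi[OF z] by (simp add: norm_mult dBb_circle(2)[OF \<alpha> z] cmod_Ba[OF \<alpha> z])
    qed
    moreover have "c = 1"
    proof (rule pos_at_rational[OF _ _ _ gb[OF beta] pos_at_substar[of _ \<alpha> n, OF posa]])
      show "rational_fun (\<lambda>z. star_g \<alpha> \<gamma> n (\<phi> n) z / dBa \<alpha> \<gamma> n z)"
        by (intro rational_fun_intros rsg rational_fun_dBa)
      show "rational_fun (substar (star_a \<alpha> n (\<phi>\<alpha> n)))" by (rule rational_fun_substar[OF rsa])
      fix z :: complex assume z: "cmod z = 1"
      have "dBa \<alpha> \<gamma> n z \<noteq> 0"
        using Ba_split[OF \<alpha> \<gamma>, of n z] cmod_Ba[OF \<alpha> z, of n] by auto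
      then have "star_g \<alpha> \<gamma> n (\<phi> n) z / dBa \<alpha> \<gamma> n z = ?D n z * cnj (\<phi> n z)"
        by (simp add: star_g_def substar_circle[OF z])
      also have "\<dots> = (?D n z * cnj (?D n z)) * (c * cnj (Ba \<alpha> n z) * \<phi>\<alpha> n z)"
        unfolding cphi[OF z] by (simp add: mult_ac)
      finally show "star_g \<alpha> \<gamma> n (\<phi> n) z / dBa \<alpha> \<gamma> n z = c * substar (star_a \<alpha> n (\<phi>\<alpha> n)) z"
        unfolding D[OF z] by (simp add: star_a_def substar_circle[OF z])
    qed (simp add: \<open>cmod c = 1\<close>)
    ultimately have "\<phi> n z = cnj (cnj (?D n z) * cnj (Ba \<alpha> n z) * \<phi>\<alpha> n z)"
      using arg_cong[OF cphi[OF z], of cnj] by simp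
    then show ?thesis using False by (simp add: star_a_def substar_circle[OF z])
  qed
qed

section \<open>The recurrence as a scattering relation\<close>

lemma Gt_a_entries:
  "Gt_a \<alpha> lam eta n $ 1 $ 1 = - (cnj (sg \<alpha> (n - 1)) * cnj (eta n) * lam n * eta n)"
  "Gt_a \<alpha> lam eta n $ 1 $ 2 = cnj (sg \<alpha> (n - 1)) * cnj (eta n) * of_real (sqrt (1 - (cmod (lam n))\<^sup>2)) * sg \<alpha> n"
  "Gt_a \<alpha> lam eta n $ 2 $ 1 = cnj (sg \<alpha> (n - 1)) * cnj (eta n) * of_real (sqrt (1 - (cmod (lam n))\<^sup>2))"
  "Gt_a \<alpha> lam eta n $ 2 $ 2 = cnj (sg \<alpha> (n - 1)) * cnj (eta n) * cnj (lam n) * cnj (eta n) * sg \<alpha> n"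
  by (simp_all add: Gt_a_def matrix_matrix_mult_def sum_2 mat_def mult_ac)

lemma Gt_b_entries:
  "Gt_b \<alpha> lam eta n $ 1 $ 1 = Gt_a \<alpha> lam eta n $ 1 $ 1"
  "Gt_b \<alpha> lam eta n $ 1 $ 2 = cnj (sg \<alpha> n) * Gt_a \<alpha> lam eta n $ 1 $ 2"
  "Gt_b \<alpha> lam eta n $ 2 $ 1 = Gt_a \<alpha> lam eta n $ 2 $ 1 * sg \<alpha> n"
  "Gt_b \<alpha> lam eta n $ 2 $ 2 = Gt_a \<alpha> lam eta n $ 2 $ 2"
proof -
  show "Gt_b \<alpha> lam eta n $ 1 $ 1 = Gt_a \<alpha> lam eta n $ 1 $ 1"
    using unimodular_cancel'[OF cmod_sg, of \<alpha> n "Gt_a \<alpha> lam eta n $ 1 $ 1"]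
    by (simp add: Gt_b_def matrix_matrix_mult_def sum_2 mult_ac)
qed (simp_all add: Gt_b_def matrix_matrix_mult_def sum_2)

lemma rotation_isometric:
  fixes r :: real
  assumes "l * cnj l + of_real r * of_real r = 1"
  shows "(cmod (- l * x + of_real r * y))\<^sup>2 + (cmod (of_real r * x + cnj l * y))\<^sup>2 = (cmod x)\<^sup>2 + (cmod y)\<^sup>2"
proof -
  define R where "R = complex_of_real r"
  have R: "cnj R = R" by (simp add: R_def)
  have "(- l * x + R * y) * cnj (- l * x + R * y) + (R * x + cnj l * y) * cnj (R * x + cnj l * y)
      = (l * cnj l + R * R) * (x * cnj x + y * cnj y)"
    by (simp add: R algebra_simps)
  also have "\<dots> = x * cnj x + y * cnj y" using assms by (simp add: R_def)
  finally have "complex_of_real ((cmod (- l * x + R * y))\<^sup>2 + (cmod (R * x + cnj l * y))\<^sup>2)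
      = complex_of_real ((cmod x)\<^sup>2 + (cmod y)\<^sup>2)"
    by (simp only: of_real_add complex_norm_square)
  then show ?thesis unfolding R_def by (simp only: of_real_eq_iff)
qed

lemma sqrt_complement:
  assumes "cmod l < 1"
  defines "r \<equiv> complex_of_real (sqrt (1 - (cmod l)\<^sup>2))"
  shows "l * cnj l + r * r = 1" "r \<noteq> 0"
proof -
  have pos: "0 < 1 - (cmod l)\<^sup>2" using assms(1) by (simp add: abs_square_less_1)
  then have "sqrt (1 - (cmod l)\<^sup>2) * sqrt (1 - (cmod l)\<^sup>2) = 1 - (cmod l)\<^sup>2" by simp
  then have "r * r = complex_of_real (1 - (cmod l)\<^sup>2)" unfolding r_def of_real_mult[symmetric] by simp
  also have "\<dots> = 1 - l * cnj l" by (simp only: of_real_diff of_real_1 complex_norm_square)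
  finally show "l * cnj l + r * r = 1" by simp
  show "r \<noteq> 0" using pos by (simp add: r_def)
qed

lemma isometric2_Gt_a:
  assumes "cmod (lam n) < 1" "cmod (eta n) = 1"
  shows "isometric2 (Gt_a \<alpha> lam eta n)"
  unfolding isometric2_def
proof (intro allI)
  fix a b
  define c where "c = cnj (sg \<alpha> (n - 1)) * cnj (eta n)"
  define r where "r = sqrt (1 - (cmod (lam n))\<^sup>2)"
  define l where "l = lam n * eta n"
  let ?T = "Gt_a \<alpha> lam eta n"
  have c: "cmod c = 1" by (simp add: c_def norm_mult cmod_sg assms)
  have "l * cnj l + of_real r * of_real r = 1"
  proof -
    have "l * cnj l = lam n * cnj (lam n) * (eta n * cnj (eta n))" by (simp add: l_def mult_ac)
    also have "\<dots> = complex_of_real ((cmod (lam n))\<^sup>2)"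
      unfolding unimodular_cnj_mult[OF assms(2)] complex_norm_square by simp
    finally have l: "l * cnj l = complex_of_real ((cmod (lam n))\<^sup>2)" .
    show ?thesis
      using sqrt_complement(1)[OF assms(1)] unfolding l r_def complex_norm_square .
  qed
  note rot = rotation_isometric[OF this, of a "sg \<alpha> n * b"]
  have "?T $ 1 $ 1 * a + ?T $ 1 $ 2 * b = c * (- l * a + of_real r * (sg \<alpha> n * b))"
    "?T $ 2 $ 1 * a + ?T $ 2 $ 2 * b = c * (of_real r * a + cnj l * (sg \<alpha> n * b))"
    by (simp_all add: Gt_a_entries c_def l_def r_def algebra_simps)
  then show "(cmod (?T $ 1 $ 1 * a + ?T $ 1 $ 2 * b))\<^sup>2 + (cmod (?T $ 2 $ 1 * a + ?T $ 2 $ 2 * b))\<^sup>2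
      = (cmod a)\<^sup>2 + (cmod b)\<^sup>2"
    using rot by (simp only: norm_mult c cmod_sg mult_1)
qed

lemma isometric2_Gt_b:
  assumes "cmod (lam n) < 1" "cmod (eta n) = 1"
  shows "isometric2 (Gt_b \<alpha> lam eta n)"
  unfolding isometric2_def
proof (intro allI)
  fix a b
  let ?T = "Gt_a \<alpha> lam eta n" and ?S = "Gt_b \<alpha> lam eta n" and ?s = "sg \<alpha> n"
  have "?T $ 1 $ 1 * a = cnj ?s * (?T $ 1 $ 1 * (?s * a))"
    using unimodular_cancel'[OF cmod_sg, of \<alpha> n "?T $ 1 $ 1 * a"] by (simp add: mult_ac)
  then have 1: "?S $ 1 $ 1 * a + ?S $ 1 $ 2 * b = cnj ?s * (?T $ 1 $ 1 * (?s * a) + ?T $ 1 $ 2 * b)"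
    by (simp add: Gt_b_entries distrib_left mult.assoc)
  have 2: "?S $ 2 $ 1 * a + ?S $ 2 $ 2 * b = ?T $ 2 $ 1 * (?s * a) + ?T $ 2 $ 2 * b"
    by (simp add: Gt_b_entries mult.assoc)
  have 3: "cmod (cnj ?s * w) = cmod w" "cmod (?s * w) = cmod w" for w
    by (simp_all add: norm_mult cmod_sg)
  show "(cmod (?S $ 1 $ 1 * a + ?S $ 1 $ 2 * b))\<^sup>2 + (cmod (?S $ 2 $ 1 * a + ?S $ 2 $ 2 * b))\<^sup>2
      = (cmod a)\<^sup>2 + (cmod b)\<^sup>2"
    using isometric2_Gt_a[of lam n eta \<alpha>, OF assms] unfolding 1 2 3 isometric2_def by (simp add: 3)
qed

text \<open>
  With \<open>a\<^sub>n = \<varpi>\<^sub>n \<phi>\<^sub>n / \<surd>(1 - \<bar>\<alpha>\<^sub>n\<bar>\<^sup>2)\<close> and \<open>b\<^sub>n\<close> built in the same way from \<open>\<phi>\<^sub>n\<^sup>*\<close>, the recurrence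
  and its image under the star operation express \<open>(a\<^sub>n, b\<^sub>n)\<close> by \<open>(\<zeta>\<^sub>n\<^sub>-\<^sub>1 a\<^sub>n\<^sub>-\<^sub>1, b\<^sub>n\<^sub>-\<^sub>1)\<close>.
  Solving for \<open>(\<zeta>\<^sub>n\<^sub>-\<^sub>1 a\<^sub>n\<^sub>-\<^sub>1, b\<^sub>n)\<close> in terms of \<open>(b\<^sub>n\<^sub>-\<^sub>1, a\<^sub>n)\<close> instead turns the transfer matrix into
  the unitary scattering matrix \<^const>\<open>Gt_a\<close>.
\<close>

definition wave_a :: "(nat \<Rightarrow> complex) \<Rightarrow> (nat \<Rightarrow> complex \<Rightarrow> complex) \<Rightarrow> nat \<Rightarrow> complex \<Rightarrow> complex" where
  "wave_a \<alpha> \<phi> n z = varpi (Fin (\<alpha> n)) z * \<phi> n z / of_real (defect \<alpha> n)"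

definition wave_b :: "(nat \<Rightarrow> complex) \<Rightarrow> (nat \<Rightarrow> complex \<Rightarrow> complex) \<Rightarrow> nat \<Rightarrow> complex \<Rightarrow> complex" where
  "wave_b \<alpha> \<phi> n z = varpi (Fin (\<alpha> n)) z * star_a \<alpha> n (\<phi> n) z / of_real (defect \<alpha> n)"

lemma zeta_a_varpi:
  assumes "cmod (\<alpha> n) < 1" "cmod z = 1"
  shows "z - \<alpha> n = cnj (sg \<alpha> n) * zeta_a \<alpha> n z * varpi (Fin (\<alpha> n)) z"
proof -
  have "zeta_a \<alpha> n z * varpi (Fin (\<alpha> n)) z = sg \<alpha> n * (z - \<alpha> n)"
    using varpi_circle_nonzero[OF assms] by (simp add: zeta_a_def)
  then show ?thesis using unimodular_cancel'[OF cmod_sg, of \<alpha> n "z - \<alpha> n"] by (simp add: mult.assoc)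
qed

text \<open>
  On the circle \<open>cnj \<varpi>\<^sub>n = cnj \<sigma>\<^sub>n \<zeta>\<^sub>n \<varpi>\<^sub>n / z\<close>, so \<open>b\<^sub>n\<close> is the conjugate of \<open>a\<^sub>n\<close> up to a unimodular
  function.
\<close>

lemma wave_b_eq:
  assumes \<alpha>: "\<forall>j. cmod (\<alpha> j) < 1" and z: "cmod z = 1"
  shows "wave_b \<alpha> \<phi> n z = sg \<alpha> n * z * Ba \<alpha> n z * cnj (zeta_a \<alpha> n z) * cnj (wave_a \<alpha> \<phi> n z)"
proof -
  let ?w = "varpi (Fin (\<alpha> n)) z" and ?\<zeta> = "zeta_a \<alpha> n z"
  have z0: "z \<noteq> 0" by (rule circle_nonzero[OF z])
  have "cnj ?w = (z - \<alpha> n) / z" using cnj_varpi_circle[OF z] by simp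
  then have "sg \<alpha> n * z * cnj ?\<zeta> * cnj ?w = sg \<alpha> n * (cnj (sg \<alpha> n) * (?\<zeta> * cnj ?\<zeta> * ?w))"
    using z0 zeta_a_varpi[of \<alpha> n z] \<alpha> z by (simp add: mult_ac)
  also have "\<dots> = ?w"
    using unimodular_cnj_mult[OF cmod_zeta_a[of \<alpha> n z]] \<alpha> z by (simp add: unimodular_cancel cmod_sg)
  finally have w: "?w = sg \<alpha> n * z * cnj ?\<zeta> * cnj ?w" ..
  have "wave_b \<alpha> \<phi> n z = ?w * (Ba \<alpha> n z * cnj (\<phi> n z)) / of_real (defect \<alpha> n)"
    by (simp add: wave_b_def star_a_def substar_circle[OF z])
  also have "\<dots> = sg \<alpha> n * z * cnj ?\<zeta> * cnj ?w * (Ba \<alpha> n z * cnj (\<phi> n z)) / of_real (defect \<alpha> n)"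
    by (subst w) (rule refl)
  also have "\<dots> = sg \<alpha> n * z * Ba \<alpha> n z * cnj ?\<zeta> * cnj (wave_a \<alpha> \<phi> n z)"
    by (simp add: wave_a_def mult_ac)
  finally show ?thesis .
qed

lemma recurrence_coefficients:
  "recurrence \<alpha> \<phi> lam eta \<Longrightarrow> 1 \<le> n \<Longrightarrow> cmod (lam n) < 1 \<and> cmod (eta n) = 1"
  unfolding recurrence_def by blast

lemma scattering:
  assumes \<alpha>: "\<forall>j. cmod (\<alpha> j) < 1" and rec: "recurrence \<alpha> \<phi> lam eta" and z: "cmod z = 1"
  shows "wave_b \<alpha> \<phi> n z * Gt_a \<alpha> lam eta (Suc n) $ 1 $ 1 + wave_a \<alpha> \<phi> (Suc n) z * Gt_a \<alpha> lam eta (Suc n) $ 2 $ 1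
      = cnj (sg \<alpha> n) * zeta_a \<alpha> n z * wave_a \<alpha> \<phi> n z"
    and "wave_b \<alpha> \<phi> n z * Gt_a \<alpha> lam eta (Suc n) $ 1 $ 2 + wave_a \<alpha> \<phi> (Suc n) z * Gt_a \<alpha> lam eta (Suc n) $ 2 $ 2
      = wave_b \<alpha> \<phi> (Suc n) z"
proof -
  define a b a' b' where "a = wave_a \<alpha> \<phi> n z" and "b = wave_b \<alpha> \<phi> n z"
    and "a' = wave_a \<alpha> \<phi> (Suc n) z" and "b' = wave_b \<alpha> \<phi> (Suc n) z"
  define l e \<zeta> s s' where "l = lam (Suc n)" and "e = eta (Suc n)" and "\<zeta> = zeta_a \<alpha> n z"
    and "s = sg \<alpha> n" and "s' = sg \<alpha> (Suc n)"
  define r where "r = complex_of_real (sqrt (1 - (cmod l)\<^sup>2))"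
  have l: "cmod l < 1" and e: "cmod e = 1"
    using recurrence_coefficients[OF rec, of "Suc n"] by (simp_all add: l_def e_def)
  have r0: "r \<noteq> 0" unfolding r_def by (rule sqrt_complement(2)[OF l])
  have "l * cnj l + r * r = 1" unfolding r_def by (rule sqrt_complement(1)[OF l])
  then have rr: "r * r = 1 - l * cnj l" by (metis add_diff_cancel_left')
  have rc: "cnj r = r" by (simp add: r_def)
  have ee: "e * cnj e = 1" by (rule unimodular_cnj_mult[OF e])
  have ss: "s * cnj s = 1" unfolding s_def by (rule unimodular_cnj_mult[OF cmod_sg])
  have "cmod (\<alpha> n) < 1" using \<alpha> by blast
  from unimodular_cnj_mult[OF cmod_zeta_a[of \<alpha>, OF this z]] have zz: "\<zeta> * cnj \<zeta> = 1" unfolding \<zeta>_def .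
  have d: "0 < defect \<alpha> j" for j by (rule defect_pos) (use \<alpha> in blast)
  \<comment> \<open>the recurrence in terms of \<open>a\<^sub>n\<close> and \<open>b\<^sub>n\<close>\<close>
  have a': "r * a' = e * (\<zeta> * a + l * b)"
  proof -
    have sq: "sqrt ((1 - (cmod (\<alpha> (Suc n)))\<^sup>2) / (1 - (cmod (\<alpha> n))\<^sup>2) * (1 / (1 - (cmod l)\<^sup>2)))
        = defect \<alpha> (Suc n) / (defect \<alpha> n * sqrt (1 - (cmod l)\<^sup>2))"
      by (simp add: defect_def real_sqrt_divide real_sqrt_mult)
    have "\<phi> (Suc n) z = of_real (defect \<alpha> (Suc n) / (defect \<alpha> n * sqrt (1 - (cmod l)\<^sup>2))) * e *
            (varpi (Fin (\<alpha> n)) z / varpi (Fin (\<alpha> (Suc n))) z) *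
            (\<zeta> * \<phi> n z + l * star_a \<alpha> n (\<phi> n) z)"
    proof -
      have "1 \<le> Suc n" by simp
      from rec[unfolded recurrence_def, rule_format, OF this, THEN conjunct2, THEN conjunct2, rule_format, OF z]
      show ?thesis
        unfolding diff_Suc_1 l_def[symmetric] e_def[symmetric] \<zeta>_def[symmetric] sq .
    qed
    moreover have "varpi (Fin (\<alpha> (Suc n))) z \<noteq> 0"
      using varpi_circle_nonzero[of "\<alpha> (Suc n)" z] \<alpha> z by simp
    ultimately have "a' = e / r * (varpi (Fin (\<alpha> n)) z * (\<zeta> * \<phi> n z + l * star_a \<alpha> n (\<phi> n) z) / of_real (defect \<alpha> n))"
      using d[of "Suc n"] d[of n] by (simp add: a'_def wave_a_def r_def)
    also have "\<dots> = e / r * (\<zeta> * a + l * b)"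
      by (simp add: a_def b_def wave_a_def wave_b_def distrib_left add_divide_distrib mult_ac)
    finally show ?thesis using r0 by simp
  qed
  have b: "b = s * z * Ba \<alpha> n z * cnj \<zeta> * cnj a"
    unfolding a_def b_def s_def \<zeta>_def by (rule wave_b_eq[OF \<alpha> z])
  have bb: "z * Ba \<alpha> n z * cnj b = cnj s * \<zeta> * a"
  proof -
    have "z * cnj z = 1" using unimodular_cnj_mult[OF z] .
    moreover have "Ba \<alpha> n z * cnj (Ba \<alpha> n z) = 1" by (rule unimodular_cnj_mult[OF cmod_Ba[OF \<alpha> z]])
    moreover have "z * Ba \<alpha> n z * cnj b = (z * cnj z) * (Ba \<alpha> n z * cnj (Ba \<alpha> n z)) * (cnj s * \<zeta> * a)"
      unfolding b by (simp add: mult_ac)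
    ultimately show ?thesis by simp
  qed
  have ba: "z * Ba \<alpha> n z * (cnj \<zeta> * cnj a) = cnj s * b"
  proof -
    have "cnj s * b = s * cnj s * (z * Ba \<alpha> n z * (cnj \<zeta> * cnj a))" unfolding b by (simp add: mult_ac)
    then show ?thesis by (simp add: ss)
  qed
  \<comment> \<open>its image under the star operation\<close>
  have b': "r * b' = s' * cnj s * cnj e * (b + cnj l * \<zeta> * a)"
  proof -
    have "b' = s' * z * Ba \<alpha> (Suc n) z * cnj (zeta_a \<alpha> (Suc n) z) * cnj a'"
      unfolding a'_def b'_def s'_def by (rule wave_b_eq[OF \<alpha> z])
    also have "Ba \<alpha> (Suc n) z = zeta_a \<alpha> (Suc n) z * Ba \<alpha> n z" by (rule Ba_Suc)
    also have "s' * z * (zeta_a \<alpha> (Suc n) z * Ba \<alpha> n z) * cnj (zeta_a \<alpha> (Suc n) z) * cnj a'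
        = (zeta_a \<alpha> (Suc n) z * cnj (zeta_a \<alpha> (Suc n) z)) * (s' * z * Ba \<alpha> n z * cnj a')"
      by (simp add: mult_ac)
    also have "\<dots> = s' * z * Ba \<alpha> n z * cnj a'"
      using unimodular_cnj_mult[OF cmod_zeta_a[of \<alpha> "Suc n" z]] \<alpha> z by simp
    finally have "r * b' = s' * z * Ba \<alpha> n z * cnj (r * a')" by (simp add: rc mult_ac)
    also have "\<dots> = s' * cnj e * (z * Ba \<alpha> n z * (cnj \<zeta> * cnj a) + cnj l * (z * Ba \<alpha> n z * cnj b))"
      unfolding a' by (simp add: algebra_simps)
    finally show ?thesis unfolding ba bb by (simp add: algebra_simps)
  qed
  show "wave_b \<alpha> \<phi> n z * Gt_a \<alpha> lam eta (Suc n) $ 1 $ 1 + wave_a \<alpha> \<phi> (Suc n) z * Gt_a \<alpha> lam eta (Suc n) $ 2 $ 1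
      = cnj (sg \<alpha> n) * zeta_a \<alpha> n z * wave_a \<alpha> \<phi> n z"
  proof -
    have "b * - (cnj s * cnj e * l * e) + a' * (cnj s * cnj e * r) = cnj s * (cnj e * (r * a') - e * cnj e * (l * b))"
      by (simp add: algebra_simps)
    also have "\<dots> = cnj s * (e * cnj e * (\<zeta> * a + l * b) - e * cnj e * (l * b))"
      unfolding a' by (simp add: mult_ac)
    also have "\<dots> = cnj s * \<zeta> * a" unfolding ee by simp
    finally show ?thesis
      by (simp add: Gt_a_entries a_def b_def a'_def s_def \<zeta>_def l_def e_def r_def)
  qed
  show "wave_b \<alpha> \<phi> n z * Gt_a \<alpha> lam eta (Suc n) $ 1 $ 2 + wave_a \<alpha> \<phi> (Suc n) z * Gt_a \<alpha> lam eta (Suc n) $ 2 $ 2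
      = wave_b \<alpha> \<phi> (Suc n) z"
  proof -
    have "r * (b * (cnj s * cnj e * r * s') + a' * (cnj s * cnj e * cnj l * cnj e * s'))
        = s' * cnj s * cnj e * (b * (r * r) + cnj l * cnj e * (r * a'))"
      by (simp add: algebra_simps)
    also have "\<dots> = s' * cnj s * cnj e * (b * (1 - l * cnj l) + cnj l * (e * cnj e) * (\<zeta> * a + l * b))"
      unfolding rr a' by (simp add: mult_ac)
    also have "\<dots> = r * b'" unfolding ee b' by (simp add: algebra_simps)
    finally have "b * (cnj s * cnj e * r * s') + a' * (cnj s * cnj e * cnj l * cnj e * s') = b'"
      using r0 by simp
    then show ?thesis
      by (simp add: Gt_a_entries a_def b_def a'_def b'_def s_def s'_def l_def e_def r_def)
  qed
qed

text \<open>
  A chain of scatterers: the incoming amplitudes \<^term>\<open>u 0\<close>, \<dots>, \<^term>\<open>u (n - 1)\<close>, \<^term>\<open>q n\<close> are mapped to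
  \<^term>\<open>v 0\<close>, \<dots>, \<^term>\<open>v (n - 1)\<close>, \<^term>\<open>p n\<close>.  The order of the factors is the order in which the
  amplitudes \<^term>\<open>X n\<close> and \<^term>\<open>Y n\<close> of the link between scatterers \<^term>\<open>n\<close> and \<^term>\<open>n + 1\<close> become
  available: scatterer \<^term>\<open>n\<close> provides \<^term>\<open>X n\<close> if \<^term>\<open>app n\<close>, and otherwise consumes \<^term>\<open>Y n\<close>.
\<close>

lemma zigzag_scattering:
  fixes u v p q X Y :: "nat \<Rightarrow> complex"
  assumes start: "q 0 = p 0"
    and app: "\<And>n. app n \<Longrightarrow> u n = q n \<and> p n = X n \<and> v n = Y n"
    and pre: "\<And>n. \<not> app n \<Longrightarrow> u n = X n \<and> q n = Y n \<and> v n = p n"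
    and step1: "\<And>n. X n * T (Suc n) $ 1 $ 1 + q (Suc n) * T (Suc n) $ 2 $ 1 = Y n"
    and step2: "\<And>n. X n * T (Suc n) $ 1 $ 2 + q (Suc n) * T (Suc n) $ 2 $ 2 = p (Suc n)"
  shows "k \<le> n \<Longrightarrow> (\<Sum>j<n. u j * zigzag app T n j k) + q n * zigzag app T n n k = (if k < n then v k else p n)"
proof (induction n arbitrary: k)
  case 0
  then show ?case by (simp add: mone_apply start)
next
  case (Suc n)
  let ?Z = "zigzag app T n" and ?T = "T (Suc n)"
  have out: "?Z i j = (if i = j then 1 else 0)" if "n < i \<or> n < j" for i j
    using that by (rule zigzag_outside)
  show ?case
  proof (cases "app n")
    case True
    have s: "(\<Sum>j<n. u j * ?Z j k) + u n * ?Z n k = (if k < n then v k else X n)" if "k \<le> n" for k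
      using Suc.IH[OF that] app[OF True] by simp
    have z: "(\<Sum>j<n. u j * ?Z j (Suc n)) = 0" by (rule sum.neutral) (simp add: out)
    consider "k < n" | "k = n" | "k = Suc n" using Suc.prems by linarith
    then show ?thesis
    proof cases
      case 1
      then show ?thesis using True s[of k] by (simp add: embed2_right out)
    next
      case 2
      have "(\<Sum>j<n. u j * (?Z j n * ?T $ 1 $ 1 + ?Z j (Suc n) * ?T $ 2 $ 1)) + u n * ?Z n n * ?T $ 1 $ 1
          = ((\<Sum>j<n. u j * ?Z j n) + u n * ?Z n n) * ?T $ 1 $ 1"
        by (simp add: distrib_right sum_distrib_right out mult.assoc)
      then show ?thesis
        using True 2 s[of n] step1[of n] app[OF True] by (simp add: embed2_right out mult.assoc)
    next
      case 3
      have "(\<Sum>j<n. u j * (?Z j n * ?T $ 1 $ 2 + ?Z j (Suc n) * ?T $ 2 $ 2)) + u n * ?Z n n * ?T $ 1 $ 2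
          = ((\<Sum>j<n. u j * ?Z j n) + u n * ?Z n n) * ?T $ 1 $ 2"
        by (simp add: distrib_right sum_distrib_right out mult.assoc)
      then show ?thesis
        using True 3 s[of n] step2[of n] by (simp add: embed2_right out mult.assoc)
    qed
  next
    case False
    note P = pre[OF False]
    have e: "u n * (?T $ 1 $ 1 * ?Z n k + ?T $ 1 $ 2 * ?Z (Suc n) k) + q (Suc n) * (?T $ 2 $ 1 * ?Z n k + ?T $ 2 $ 2 * ?Z (Suc n) k)
        = q n * ?Z n k + p (Suc n) * ?Z (Suc n) k"
    proof -
      have "u n * (?T $ 1 $ 1 * ?Z n k + ?T $ 1 $ 2 * ?Z (Suc n) k) + q (Suc n) * (?T $ 2 $ 1 * ?Z n k + ?T $ 2 $ 2 * ?Z (Suc n) k)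
          = (X n * ?T $ 1 $ 1 + q (Suc n) * ?T $ 2 $ 1) * ?Z n k + (X n * ?T $ 1 $ 2 + q (Suc n) * ?T $ 2 $ 2) * ?Z (Suc n) k"
        using P by (simp add: algebra_simps)
      then show ?thesis unfolding step1 step2 using P by simp
    qed
    have "(\<Sum>j<Suc n. u j * zigzag app T (Suc n) j k) + q (Suc n) * zigzag app T (Suc n) (Suc n) k
        = (\<Sum>j<n. u j * ?Z j k) + (q n * ?Z n k + p (Suc n) * ?Z (Suc n) k)"
      using False by (simp add: embed2_left e[symmetric] add.assoc)
    also have "\<dots> = (if k < Suc n then v k else p (Suc n))"
    proof (cases "k = Suc n")
      case True
      then show ?thesis by (simp add: out)
    next
      case False
      then have "k \<le> n" using Suc.prems by simp
      then show ?thesis using Suc.IH[of k] P by (auto simp: out)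
    qed
    finally show ?thesis .
  qed
qed

section \<open>Mean square convergence\<close>

lemma mean_square_orthonormal:
  assumes \<mu>: "circle_probability \<mu>" and cb: "\<And>j. circle_bounded (\<phi> j)"
    and on: "\<And>j k. ip \<mu> (\<phi> j) (\<phi> k) = (if j = k then 1 else 0)" and J: "finite J"
  shows "mean_square \<mu> (\<lambda>z. \<Sum>j\<in>J. c j * \<phi> j z) = (\<Sum>j\<in>J. (cmod (c j))\<^sup>2)"
proof -
  let ?S = "\<lambda>z. \<Sum>j\<in>J. c j * \<phi> j z"
  have cbS: "circle_bounded ?S" by (intro circle_bounded_intros cb)
  have coeff: "ip \<mu> ?S (\<phi> k) = cnj (c k)" if "k \<in> J" for k
  proof -
    have "ip \<mu> (\<phi> k) ?S = (\<Sum>j\<in>J. c j * ip \<mu> (\<phi> k) (\<phi> j))" by (rule ip_sum_right[OF \<mu> cb cb])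
    also have "\<dots> = c k" using J that by (simp add: on if_distrib[of "\<lambda>x. _ * x"] cong: if_cong)
    finally show ?thesis using ip_cnj[of \<mu> "\<phi> k" ?S] by simp
  qed
  have "complex_of_real (mean_square \<mu> ?S) = (\<Sum>j\<in>J. c j * ip \<mu> ?S (\<phi> j))"
    unfolding mean_square_ip by (rule ip_sum_right[OF \<mu> cbS cb])
  also have "\<dots> = complex_of_real (\<Sum>j\<in>J. (cmod (c j))\<^sup>2)"
    unfolding of_real_sum by (intro sum.cong refl) (simp only: coeff complex_norm_square)
  finally show ?thesis by (simp only: of_real_eq_iff)
qed

lemma mean_square_shift_le:
  assumes \<mu>: "circle_probability \<mu>" and cb: "\<And>j. circle_bounded (\<phi> j)"
    and on: "\<And>j k. ip \<mu> (\<phi> j) (\<phi> k) = (if j = k then 1 else 0)" and J: "finite J"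
  shows "mean_square \<mu> (\<lambda>z. \<Sum>j\<in>J. \<phi> j z * (z * c j - d j))
    \<le> 2 * (\<Sum>j\<in>J. (cmod (c j))\<^sup>2) + 2 * (\<Sum>j\<in>J. (cmod (d j))\<^sup>2)"
proof -
  let ?C = "\<lambda>z. \<Sum>j\<in>J. c j * \<phi> j z" and ?D = "\<lambda>z. \<Sum>j\<in>J. d j * \<phi> j z"
  have cbC: "circle_bounded ?C" and cbD: "circle_bounded ?D" by (intro circle_bounded_intros cb)+
  have eq: "(\<lambda>z. \<Sum>j\<in>J. \<phi> j z * (z * c j - d j)) = (\<lambda>z. z * ?C z + (- 1) * ?D z)"
    by (intro ext) (simp add: sum_distrib_left right_diff_distrib sum_subtractf sum_negf mult_ac)
  have "mean_square \<mu> (\<lambda>z. z * ?C z + (- 1) * ?D z)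
      \<le> 2 * mean_square \<mu> (\<lambda>z. z * ?C z) + 2 * mean_square \<mu> (\<lambda>z. (- 1) * ?D z)"
    by (rule mean_square_add_le[OF \<mu>]; intro circle_bounded_intros cb)
  moreover have "mean_square \<mu> (\<lambda>z. z * ?C z) = mean_square \<mu> ?C"
    by (intro mean_square_cong[OF \<mu>] circle_bounded_intros cb) (simp add: norm_mult)
  moreover have "mean_square \<mu> (\<lambda>z. (- 1) * ?D z) = mean_square \<mu> ?D"
    unfolding mean_square_scale by simp
  ultimately show ?thesis
    unfolding eq mean_square_orthonormal[OF \<mu> cb on J, symmetric] by linarith
qed

text \<open>
  The relation \<open>z \<Sum>\<^sub>j c\<^sub>j \<phi>\<^sub>j = \<Sum>\<^sub>j d\<^sub>j \<phi>\<^sub>j\<close> in \<open>L\<^sup>2(\<mu>)\<close>, for square-summable coefficients.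
\<close>

definition times_z :: "complex measure \<Rightarrow> (nat \<Rightarrow> complex \<Rightarrow> complex) \<Rightarrow> (nat \<Rightarrow> complex) \<Rightarrow> (nat \<Rightarrow> complex) \<Rightarrow> bool" where
  "times_z \<mu> \<phi> c d \<longleftrightarrow> (\<lambda>n. mean_square \<mu> (\<lambda>z. \<Sum>j<n. \<phi> j z * (z * c j - d j))) \<longlonglongrightarrow> 0"

lemma times_z_combination:
  fixes M H :: imat and m :: nat
  assumes \<mu>: "circle_probability \<mu>" and cb: "\<And>j. circle_bounded (\<phi> j)"
    and col: "\<And>l. times_z \<mu> \<phi> (\<lambda>j. M j l) (\<lambda>j. H j l)"
  shows "times_z \<mu> \<phi> (\<lambda>j. \<Sum>l<m. M j l * x l) (\<lambda>j. \<Sum>l<m. H j l * x l)"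
proof (induction m)
  case 0
  show ?case by (simp add: times_z_def mean_square_def)
next
  case (Suc m)
  let ?f = "\<lambda>n z. \<Sum>j<n. \<phi> j z * (z * (\<Sum>l<m. M j l * x l) - (\<Sum>l<m. H j l * x l))"
  let ?g = "\<lambda>n z. \<Sum>j<n. \<phi> j z * (z * M j m - H j m)"
  have cbf: "circle_bounded (?f n)" and cbg: "circle_bounded (?g n)" for n
    by (intro circle_bounded_intros cb)+
  have "(\<lambda>z. \<Sum>j<n. \<phi> j z * (z * (\<Sum>l<Suc m. M j l * x l) - (\<Sum>l<Suc m. H j l * x l)))
      = (\<lambda>z. ?f n z + x m * ?g n z)" for n
    by (intro ext) (simp add: sum_distrib_left sum.distrib[symmetric] algebra_simps)
  moreover have "(\<lambda>n. mean_square \<mu> (\<lambda>z. ?f n z + x m * ?g n z)) \<longlonglongrightarrow> 0"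
  proof (rule tendsto_sandwich[of "\<lambda>_. 0"])
    have "mean_square \<mu> (\<lambda>z. ?f n z + x m * ?g n z)
        \<le> 2 * mean_square \<mu> (?f n) + 2 * ((cmod (x m))\<^sup>2 * mean_square \<mu> (?g n))" for n
      unfolding mean_square_scale[of \<mu> "x m" "?g n", symmetric]
      by (rule mean_square_add_le[OF \<mu>]; intro circle_bounded_intros cb)
    then show "\<forall>\<^sub>F n in sequentially. mean_square \<mu> (\<lambda>z. ?f n z + x m * ?g n z)
        \<le> 2 * mean_square \<mu> (?f n) + 2 * ((cmod (x m))\<^sup>2 * mean_square \<mu> (?g n))"
      by (intro always_eventually) blast
    have "(\<lambda>n. 2 * mean_square \<mu> (?f n) + 2 * ((cmod (x m))\<^sup>2 * mean_square \<mu> (?g n))) \<longlonglongrightarrow> 2 * 0 + 2 * ((cmod (x m))\<^sup>2 * 0)"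
      using Suc.IH col[of m] unfolding times_z_def by (intro tendsto_intros)
    then show "(\<lambda>n. 2 * mean_square \<mu> (?f n) + 2 * ((cmod (x m))\<^sup>2 * mean_square \<mu> (?g n))) \<longlonglongrightarrow> 0" by simp
  qed (auto simp: mean_square_nonneg)
  ultimately show ?case by (simp only: times_z_def)
qed

text \<open>
  The relation \<^const>\<open>times_z\<close> is linear, and closed because the mean square in its definition is bounded by the
  \<open>\<l>\<^sup>2\<close> norms of the coefficients for all \<open>n\<close> at once.
\<close>

lemma times_z_closed:
  assumes \<mu>: "circle_probability \<mu>" and cb: "\<And>j. circle_bounded (\<phi> j)"
    and on: "\<And>j k. ip \<mu> (\<phi> j) (\<phi> k) = (if j = k then 1 else 0)"
    and M: "bounded_mat M" and H: "bounded_mat H" and x: "x \<in> l2"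
    and col: "\<And>l. times_z \<mu> \<phi> (\<lambda>j. M j l) (\<lambda>j. H j l)"
  shows "times_z \<mu> \<phi> (mvec M x) (mvec H x)"
  unfolding times_z_def
proof (rule LIMSEQ_I)
  fix e :: real assume e: "0 < e"
  let ?rM = "\<lambda>m j. mvec M x j - (\<Sum>l<m. M j l * x l)" and ?rH = "\<lambda>m j. mvec H x j - (\<Sum>l<m. H j l * x l)"
  have "\<forall>\<^sub>F m in sequentially. sqnorm (?rM m) < e / 16 \<and> sqnorm (?rH m) < e / 16"
    using e by (intro eventually_conj order_tendstoD(2)[OF sqnorm_mvec_trunc_tendsto[OF M x]]
        order_tendstoD(2)[OF sqnorm_mvec_trunc_tendsto[OF H x]]) auto
  then obtain m where m: "sqnorm (?rM m) < e / 16" "sqnorm (?rH m) < e / 16"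
    unfolding eventually_sequentially by blast
  have l: "?rM m \<in> l2" "?rH m \<in> l2"
    unfolding mvec_trunc[symmetric] by (intro l2_diff bounded_mat_l2 M H x l2_trunc)+
  let ?f = "\<lambda>n z. \<Sum>j<n. \<phi> j z * (z * (\<Sum>l<m. M j l * x l) - (\<Sum>l<m. H j l * x l))"
  let ?g = "\<lambda>n z. \<Sum>j<n. \<phi> j z * (z * ?rM m j - ?rH m j)"
  have "(\<lambda>n. mean_square \<mu> (?f n)) \<longlonglongrightarrow> 0"
    using times_z_combination[OF \<mu> cb col, where m = m and x = x] by (simp only: times_z_def)
  then have "\<forall>\<^sub>F n in sequentially. mean_square \<mu> (?f n) < e / 8"
    using e by (intro order_tendstoD(2)) auto
  then obtain n0 where n0: "\<And>n. n0 \<le> n \<Longrightarrow> mean_square \<mu> (?f n) < e / 8"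
    by (auto simp: eventually_sequentially)
  have part: "(\<Sum>j<n. (cmod (y j))\<^sup>2) \<le> sqnorm y" if "y \<in> l2" for y n
    unfolding sqnorm_def by (rule sum_le_suminf[OF l2_summable[OF that]]) auto
  have "mean_square \<mu> (\<lambda>z. \<Sum>j<n. \<phi> j z * (z * mvec M x j - mvec H x j)) < e" if "n0 \<le> n" for n
  proof -
    have eq: "(\<lambda>z. \<Sum>j<n. \<phi> j z * (z * mvec M x j - mvec H x j)) = (\<lambda>z. ?f n z + ?g n z)"
      unfolding sum.distrib[symmetric] by (intro ext sum.cong refl) (simp add: algebra_simps)
    have "mean_square \<mu> (\<lambda>z. ?f n z + ?g n z) \<le> 2 * mean_square \<mu> (?f n) + 2 * mean_square \<mu> (?g n)"
      by (rule mean_square_add_le[OF \<mu>]; intro circle_bounded_intros cb)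
    moreover have "mean_square \<mu> (?g n) \<le> 2 * (\<Sum>j<n. (cmod (?rM m j))\<^sup>2) + 2 * (\<Sum>j<n. (cmod (?rH m j))\<^sup>2)"
      by (rule mean_square_shift_le[OF \<mu> cb on]) simp
    ultimately show ?thesis
      unfolding eq using part[OF l(1), of n] part[OF l(2), of n] m n0[OF that] e by linarith
  qed
  then show "\<exists>no. \<forall>n\<ge>no. norm (mean_square \<mu> (\<lambda>z. \<Sum>j<n. \<phi> j z * (z * mvec M x j - mvec H x j)) - 0) < e"
    by (auto simp: mean_square_nonneg abs_of_nonneg)
qed

text \<open>
  The partial sums form a Cauchy sequence, because the coefficients are square-summable, so
  convergence along a subsequence suffices.
\<close>

lemma times_z_subsequence:
  assumes \<mu>: "circle_probability \<mu>" and cb: "\<And>j. circle_bounded (\<phi> j)"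
    and on: "\<And>j k. ip \<mu> (\<phi> j) (\<phi> k) = (if j = k then 1 else 0)"
    and c: "c \<in> l2" and d: "d \<in> l2"
    and sub: "\<And>e n0. 0 < e \<Longrightarrow> \<exists>n\<ge>n0. mean_square \<mu> (\<lambda>z. \<Sum>j<n. \<phi> j z * (z * c j - d j)) < e"
  shows "times_z \<mu> \<phi> c d"
  unfolding times_z_def
proof (rule LIMSEQ_I)
  fix e :: real assume e: "0 < e"
  let ?F = "\<lambda>J z. \<Sum>j\<in>J. \<phi> j z * (z * c j - d j)"
  have "summable (\<lambda>j. (cmod (c j))\<^sup>2 + (cmod (d j))\<^sup>2)"
    by (intro summable_add l2_summable c d)
  then have "\<exists>n0. \<forall>m\<ge>n0. \<forall>n. norm (\<Sum>j=m..<n. (cmod (c j))\<^sup>2 + (cmod (d j))\<^sup>2) < e / 8"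
    unfolding summable_Cauchy using e by (elim allE[of _ "e / 8"]) simp
  then obtain n0 where n0: "\<And>m n. n0 \<le> m \<Longrightarrow> norm (\<Sum>j=m..<n. (cmod (c j))\<^sup>2 + (cmod (d j))\<^sup>2) < e / 8"
    by blast
  obtain n1 where n1: "n0 \<le> n1" "mean_square \<mu> (?F {..<n1}) < e / 4"
    using sub[of "e / 4" n0] e by auto
  have "mean_square \<mu> (?F {..<n}) < e" if "n1 \<le> n" for n
  proof -
    have eq: "?F {..<n} = (\<lambda>z. ?F {..<n1} z + ?F {n1..<n} z)"
      unfolding lessThan_atLeast0
      by (rule ext, rule sum.atLeastLessThan_concat[symmetric]) (use that in auto)
    have "mean_square \<mu> (\<lambda>z. ?F {..<n1} z + ?F {n1..<n} z)
        \<le> 2 * mean_square \<mu> (?F {..<n1}) + 2 * mean_square \<mu> (?F {n1..<n})"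
      by (rule mean_square_add_le[OF \<mu>]; intro circle_bounded_intros cb)
    moreover have "mean_square \<mu> (?F {n1..<n}) \<le> 2 * (\<Sum>j=n1..<n. (cmod (c j))\<^sup>2) + 2 * (\<Sum>j=n1..<n. (cmod (d j))\<^sup>2)"
      by (rule mean_square_shift_le[OF \<mu> cb on]) simp
    moreover have "(\<Sum>j=n1..<n. (cmod (c j))\<^sup>2) + (\<Sum>j=n1..<n. (cmod (d j))\<^sup>2) < e / 8"
      using n0[OF n1(1), of n] unfolding sum.distrib real_norm_def by linarith
    ultimately show ?thesis unfolding eq using n1(2) by linarith
  qed
  then show "\<exists>no. \<forall>n\<ge>no. norm (mean_square \<mu> (\<lambda>z. \<Sum>j<n. \<phi> j z * (z * c j - d j)) - 0) < e"
    by (auto simp: mean_square_nonneg abs_of_nonneg)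
qed

text \<open>
  If \<open>p\<^sub>n \<ge> c s\<^sub>n\<close> from some index on, then \<open>p\<^sub>n\<^sup>2 = \<Sum>\<^sub>j\<^sub>\<ge>\<^sub>n g\<^sub>j\<^sup>2\<close> is at most
  \<open>c\<^sup>-\<^sup>2 p\<^sub>n\<^sup>2 \<Sum>\<^sub>j\<^sub>\<ge>\<^sub>n g\<^sub>j\<^sup>2 / s\<^sub>j\<^sup>2\<close>, which for large \<open>n\<close> is less than \<open>p\<^sub>n\<^sup>2\<close>.
\<close>

lemma frequently_small_ratio:
  fixes p s g :: "nat \<Rightarrow> real"
  assumes p0: "\<And>n. 0 \<le> p n" and s: "\<And>n. 0 < s n" and lim: "p \<longlonglongrightarrow> 0"
    and step: "\<And>n. N \<le> n \<Longrightarrow> (p n)\<^sup>2 = (g n)\<^sup>2 + (p (Suc n))\<^sup>2"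
    and sm: "summable (\<lambda>n. (g n / s n)\<^sup>2)" and c: "0 < c"
  shows "\<exists>n\<ge>N. p n < c * s n"
proof (rule ccontr)
  assume "\<not> ?thesis"
  then have ge: "c * s n \<le> p n" if "N \<le> n" for n using that by force
  have "\<exists>N'. \<forall>m\<ge>N'. \<forall>n. norm (\<Sum>j=m..<n. (g j / s j)\<^sup>2) < c\<^sup>2 / 2"
    using sm c unfolding summable_Cauchy by (elim allE[of _ "c\<^sup>2 / 2"]) simp
  then obtain N' where N': "\<And>m n. N' \<le> m \<Longrightarrow> norm (\<Sum>j=m..<n. (g j / s j)\<^sup>2) < c\<^sup>2 / 2"
    by blast
  define n where "n = max N N'"
  have tele: "(p n)\<^sup>2 - (p m)\<^sup>2 = (\<Sum>j=n..<m. (g j)\<^sup>2)" if "n \<le> m" for m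
    using that
  proof (induction m rule: dec_induct)
    case (step m)
    then have "N \<le> m" by (simp add: n_def)
    then show ?case using step assms(4)[of m] by simp
  qed simp
  have mono: "(p m)\<^sup>2 \<le> (p n)\<^sup>2" if "n \<le> m" for m
    using tele[OF that] sum_nonneg[of "{n..<m}" "\<lambda>j. (g j)\<^sup>2"] by simp
  have "(p n)\<^sup>2 - (p m)\<^sup>2 \<le> (p n)\<^sup>2 / 2" if "n \<le> m" for m
  proof -
    have "(\<Sum>j=n..<m. (g j)\<^sup>2) \<le> (\<Sum>j=n..<m. (p n)\<^sup>2 / c\<^sup>2 * (g j / s j)\<^sup>2)"
    proof (rule sum_mono)
      fix j assume j: "j \<in> {n..<m}"
      have "(c * s j)\<^sup>2 \<le> (p j)\<^sup>2" using ge[of j] j c s[of j] by (intro power_mono) (auto simp: n_def)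
      also have "\<dots> \<le> (p n)\<^sup>2" using mono j by auto
      finally have "(s j)\<^sup>2 \<le> (p n)\<^sup>2 / c\<^sup>2" using c by (simp add: power_mult_distrib field_simps)
      then have "(s j)\<^sup>2 * (g j / s j)\<^sup>2 \<le> (p n)\<^sup>2 / c\<^sup>2 * (g j / s j)\<^sup>2" by (rule mult_right_mono) simp
      moreover have "(s j)\<^sup>2 * (g j / s j)\<^sup>2 = (g j)\<^sup>2" using s[of j] by (simp add: power_divide)
      ultimately show "(g j)\<^sup>2 \<le> (p n)\<^sup>2 / c\<^sup>2 * (g j / s j)\<^sup>2" by simp
    qed
    also have "\<dots> = (p n)\<^sup>2 / c\<^sup>2 * (\<Sum>j=n..<m. (g j / s j)\<^sup>2)" by (simp add: sum_distrib_left)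
    also have "\<dots> \<le> (p n)\<^sup>2 / c\<^sup>2 * (c\<^sup>2 / 2)"
      using N'[of n m] by (intro mult_left_mono) (auto simp: n_def sum_nonneg)
    finally show ?thesis using tele[OF that] c by simp
  qed
  moreover have "(\<lambda>m. (p n)\<^sup>2 - (p m)\<^sup>2) \<longlonglongrightarrow> (p n)\<^sup>2 - 0\<^sup>2" by (intro tendsto_intros lim)
  ultimately have "(p n)\<^sup>2 - 0\<^sup>2 \<le> (p n)\<^sup>2 / 2" by (intro LIMSEQ_le_const2) blast+
  then have "p n = 0" by simp
  moreover have "0 < p n" using ge[of n] mult_pos_pos[OF c s[of n]] by (simp add: n_def)
  ultimately show False by simp
qed

lemma strong_mat_lim_diagonal:
  assumes "strong_mat_lim X L" "bounded_mat L"
  shows "(\<lambda>n. X n n k) \<longlonglongrightarrow> 0"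
proof -
  let ?S = "\<lambda>n. \<Sum>i. (cmod (X n i k - L i k))\<^sup>2"
  have S: "summable (\<lambda>i. (cmod (X n i k - L i k))\<^sup>2)" "?S \<longlonglongrightarrow> 0" for n
    using assms(1) unfolding strong_mat_lim_def by blast+
  have "(cmod (X n n k - L n k))\<^sup>2 \<le> ?S n" for n
    using sum_le_suminf[OF S(1), of "{n}" n] by simp
  then have "(\<lambda>n. (cmod (X n n k - L n k))\<^sup>2) \<longlonglongrightarrow> 0"
    by (intro tendsto_sandwich[OF _ _ tendsto_const S(2)]) auto
  then have "(\<lambda>n. X n n k - L n k) \<longlonglongrightarrow> 0" by (rule tendsto_0_if_sq)
  moreover have "(\<lambda>n. L n k) \<longlonglongrightarrow> 0"
    by (rule tendsto_0_if_sq[OF summable_LIMSEQ_zero[OF l2_summable[OF bounded_mat_column[OF assms(2)]]]])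
  ultimately show ?thesis using tendsto_add by fastforce
qed

lemma mult_by_z_if_times_z:
  assumes \<mu>: "circle_probability \<mu>" and cb: "\<And>j. circle_bounded (\<phi> j)"
    and U: "\<And>k. times_z \<mu> \<phi> (\<lambda>j. mone j k) (\<lambda>j. U j k)"
  shows "mult_by_z \<mu> \<phi> U"
  unfolding mult_by_z_def
proof
  fix k
  let ?R = "\<lambda>n z. z * \<phi> k z - (\<Sum>j<n. \<phi> j z * U j k)"
  have eq: "(\<Sum>j<n. \<phi> j z * (z * mone j k - U j k)) = ?R n z" if "k < n" for n z
  proof -
    have "(\<Sum>j<n. \<phi> j z * (z * mone j k - U j k)) = (\<Sum>j<n. (if j = k then z * \<phi> k z else 0) - \<phi> j z * U j k)"
      by (intro sum.cong) (auto simp: mone_apply algebra_simps)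
    then show ?thesis using that by (simp add: sum_subtractf)
  qed
  have "(\<integral>\<^sup>+ z. ennreal ((cmod (?R n z))\<^sup>2) \<partial>\<mu>) = ennreal (mean_square \<mu> (?R n))" for n
    by (intro nn_integral_mean_square[OF \<mu>] circle_bounded_intros cb)
  moreover have "(\<lambda>n. mean_square \<mu> (?R n)) \<longlonglongrightarrow> 0"
  proof (rule Lim_transform_eventually)
    show "(\<lambda>n. mean_square \<mu> (\<lambda>z. \<Sum>j<n. \<phi> j z * (z * mone j k - U j k))) \<longlonglongrightarrow> 0"
      using U[of k] by (simp only: times_z_def)
    show "\<forall>\<^sub>F n in sequentially. mean_square \<mu> (\<lambda>z. \<Sum>j<n. \<phi> j z * (z * mone j k - U j k)) = mean_square \<mu> (?R n)"
      using eventually_gt_at_top[of k] by (rule eventually_mono) (simp add: eq)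
  qed
  ultimately show "(\<lambda>n. \<integral>\<^sup>+ z. ennreal ((cmod (?R n z))\<^sup>2) \<partial>\<mu>) \<longlonglongrightarrow> 0"
    using tendsto_ennrealI[of "\<lambda>n. mean_square \<mu> (?R n)" 0] by simp
qed

section \<open>Multiplication by \<open>z\<close>\<close>

locale mixed_orf =
  fixes \<alpha> lam eta :: "nat \<Rightarrow> complex" and \<gamma> :: "nat \<Rightarrow> riemann" and \<mu> :: "complex measure"
    and \<phi>\<alpha> \<phi> :: "nat \<Rightarrow> complex \<Rightarrow> complex"
  assumes \<mu>: "circle_probability \<mu>"
    and \<alpha>0: "\<alpha> 0 = 0" and \<alpha>: "\<forall>j. cmod (\<alpha> j) < 1"
    and \<gamma>: "\<forall>j. \<gamma> j \<in> {Fin (\<alpha> j), beta \<alpha> j}"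
    and orf_alpha: "orf_a \<alpha> \<mu> \<phi>\<alpha>" and rec: "recurrence \<alpha> \<phi>\<alpha> lam eta"
    and orf_gamma: "orf_g \<alpha> \<gamma> \<mu> \<phi>"
begin

definition T :: "nat \<Rightarrow> complex^2^2" where
  "T n = (if \<gamma> n = Fin (\<alpha> n) then Gt_a \<alpha> lam eta n else Gt_b \<alpha> lam eta n)"

text \<open>Factor \<^term>\<open>1::nat\<close> is the first one to be placed, hence the value at \<^term>\<open>0::nat\<close>.\<close>

definition app :: "nat \<Rightarrow> bool" where
  "app n \<longleftrightarrow> n = 0 \<or> \<gamma> n = Fin (\<alpha> n)"

abbreviation G :: imat where
  "G \<equiv> zigzag_limit app T"

lemmas \<phi>_circle_bounded = orf_g_circle_bounded[OF \<alpha> orf_gamma]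
  and \<phi>_orthonormal = orf_g_orthonormal[OF \<mu> orf_gamma]

lemma isometric2_T: "1 \<le> n \<Longrightarrow> isometric2 (T n)"
  using isometric2_Gt_a isometric2_Gt_b recurrence_coefficients[OF rec] by (simp add: T_def)

text \<open>
  The functions \<open>\<phi>\<^sub>n\<close> as amplitudes in a chain of scatterers.  The link after scatterer \<open>n\<close> carries
  \<open>X\<^sub>n = D\<^sub>n b\<^sub>n\<close> forward and \<open>Y\<^sub>n = cnj \<sigma>\<^sub>n D\<^sub>n \<zeta>\<^sub>n a\<^sub>n\<close> backward; \<open>u\<^sub>n\<close> is \<open>D\<^sub>n a\<^sub>n\<close> or \<open>X\<^sub>n\<close>, and \<open>v\<^sub>n\<close> is
  \<open>Y\<^sub>n\<close> or \<open>cnj \<sigma>\<^sub>n \<zeta>\<^sub>n X\<^sub>n\<close>, according to whether \<open>\<gamma>\<^sub>n\<close> is \<open>\<alpha>\<^sub>n\<close> or \<open>\<beta>\<^sub>n\<close>.  The unimodular factors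
  \<open>\<sigma>\<^sub>n\<close> that distinguish \<^const>\<open>Gt_b\<close> from \<^const>\<open>Gt_a\<close> account for the factor \<open>cnj \<sigma>\<^sub>n\<close> in \<open>v\<^sub>n\<close>.
\<close>

lemma orf_scattering:
  assumes z: "cmod z = 1" and k: "k < n"
  shows "\<exists>q. cmod q = cmod (wave_a \<alpha> \<phi> n z) \<and>
    (z - \<alpha> k) * \<phi> k z / of_real (defect \<alpha> k) =
      (\<Sum>j<n. wave_a \<alpha> \<phi> j z * zigzag app T n j k) + q * zigzag app T n n k"
proof -
  let ?a = "\<lambda>n. wave_a \<alpha> \<phi>\<alpha> n z" and ?b = "\<lambda>n. wave_b \<alpha> \<phi>\<alpha> n z" and ?D = "\<lambda>n. dBb \<alpha> \<gamma> n z"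
    and ?s = "sg \<alpha>" and ?z = "\<lambda>n. zeta_a \<alpha> n z"
  define u where "u n = wave_a \<alpha> \<phi> n z" for n
  define v where "v n = (z - \<alpha> n) * \<phi> n z / of_real (defect \<alpha> n)" for n
  define X where "X n = ?D n * ?b n" for n
  define Y where "Y n = cnj (?s n) * ?D n * ?z n * ?a n" for n
  define q where "q n = (if app n then u n else Y n)" for n
  define p where "p n = (if app n then X n else v n)" for n
  have u: "u n = ?D n * (if \<gamma> n = Fin (\<alpha> n) then ?a n else ?b n)" for n
    unfolding u_def wave_a_def wave_b_def orf_g_formula[OF \<alpha> \<gamma> \<mu> orf_alpha orf_gamma z] by simp
  have v: "v n = cnj (?s n) * ?z n * u n" for n
  proof -
    have "z - \<alpha> n = cnj (?s n) * ?z n * varpi (Fin (\<alpha> n)) z"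
      by (rule zeta_a_varpi) (use \<alpha> z in auto)
    then show ?thesis unfolding v_def u_def wave_a_def by (simp add: mult_ac)
  qed
  have zz: "?z n * cnj (?z n) = 1" for n
    by (rule unimodular_cnj_mult, rule cmod_zeta_a) (use \<alpha> z in auto)
  have ab: "cmod (?a n) = cmod (?b n)" for n
    unfolding wave_b_eq[OF \<alpha> z]
    using \<alpha> z by (simp add: norm_mult cmod_sg cmod_zeta_a cmod_Ba)
  \<comment> \<open>the chain starts with \<open>q\<^sub>0 = p\<^sub>0 = 1\<close>\<close>
  have zero: "u 0 = 1" "X 0 = 1" "v 0 = Y 0"
  proof -
    have "\<phi>\<alpha> 0 = (\<lambda>z. 1)" "\<phi> 0 = (\<lambda>z. 1)" using orf_alpha orf_gamma by (simp_all add: orf_a_def orf_g_def)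
    moreover have "idx_b \<alpha> \<gamma> 0 = {}" by (auto simp: idx_b_def)
    then have "?D 0 = 1" by (simp add: dBb_def)
    ultimately show "u 0 = 1" "X 0 = 1" "v 0 = Y 0"
      by (simp_all add: u_def v_def X_def Y_def wave_a_def wave_b_def star_a_def Ba_def substar_def
          \<alpha>0 defect_def zeta_a_def sg_def)
  qed
  have sum: "(\<Sum>j<n. u j * zigzag app T n j k) + q n * zigzag app T n n k = (if k < n then v k else p n)"
  proof (rule zigzag_scattering[where X = X and Y = Y])
    show "q 0 = p 0" by (simp add: q_def p_def app_def zero)
    show "u n = q n \<and> p n = X n \<and> v n = Y n" if "app n" for n
    proof (cases "n = 0")
      case False
      then have "\<gamma> n = Fin (\<alpha> n)" using that by (simp add: app_def)
      then show ?thesis using that v[of n] u[of n] by (simp add: q_def p_def Y_def mult_ac)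
    qed (use that in \<open>simp add: q_def p_def zero\<close>)
    show "u n = X n \<and> q n = Y n \<and> v n = p n" if "\<not> app n" for n
      using that u[of n] by (simp add: q_def p_def X_def app_def)
    fix n
    note sc = scattering[OF \<alpha> rec z, of n]
    have D: "?D (Suc n) = (if \<gamma> (Suc n) = Fin (\<alpha> (Suc n)) then ?D n else cnj (?z (Suc n)) * ?D n)"
      by (rule dBb_Suc_circle[OF \<alpha> \<gamma> z])
    have Y: "Y n = ?D n * (cnj (?s n) * ?z n * ?a n)" by (simp add: Y_def mult_ac)
    show "X n * T (Suc n) $ 1 $ 1 + q (Suc n) * T (Suc n) $ 2 $ 1 = Y n"
      and "X n * T (Suc n) $ 1 $ 2 + q (Suc n) * T (Suc n) $ 2 $ 2 = p (Suc n)"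
    proof -
      let ?G = "Gt_a \<alpha> lam eta (Suc n)"
      have "X n * T (Suc n) $ 1 $ 1 + q (Suc n) * T (Suc n) $ 2 $ 1 = Y n \<and>
        X n * T (Suc n) $ 1 $ 2 + q (Suc n) * T (Suc n) $ 2 $ 2 = p (Suc n)"
      proof (cases "\<gamma> (Suc n) = Fin (\<alpha> (Suc n))")
        case True
        then have "q (Suc n) = ?D n * ?a (Suc n)" "p (Suc n) = ?D n * ?b (Suc n)"
          using D u[of "Suc n"] by (simp_all add: q_def p_def app_def X_def)
        then show ?thesis
          unfolding Y sc(1)[symmetric] sc(2)[symmetric] using True
          by (simp add: T_def X_def distrib_left mult.assoc)
      next
        case False
        let ?t = "cnj (?s (Suc n))"
        have q: "q (Suc n) = ?t * ?D n * ?a (Suc n)"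
        proof -
          have "q (Suc n) = (?z (Suc n) * cnj (?z (Suc n))) * (?t * ?D n * ?a (Suc n))"
            using False D by (simp add: q_def app_def Y_def mult_ac)
          then show ?thesis unfolding zz by simp
        qed
        have p: "p (Suc n) = ?t * ?D n * ?b (Suc n)"
        proof -
          have "p (Suc n) = (?z (Suc n) * cnj (?z (Suc n))) * (?t * ?D n * ?b (Suc n))"
            using False D u[of "Suc n"] by (simp add: p_def app_def v mult_ac)
          then show ?thesis unfolding zz by simp
        qed
        have ts: "?t * ?s (Suc n) = 1" using unimodular_cnj_mult[OF cmod_sg] by (simp add: mult.commute)
        have "X n * T (Suc n) $ 1 $ 1 + q (Suc n) * T (Suc n) $ 2 $ 1
            = ?D n * (?b n * ?G $ 1 $ 1 + (?t * ?s (Suc n)) * (?a (Suc n) * ?G $ 2 $ 1))"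
          using False by (simp add: T_def X_def q Gt_b_entries distrib_left mult_ac)
        moreover have "X n * T (Suc n) $ 1 $ 2 + q (Suc n) * T (Suc n) $ 2 $ 2
            = ?t * ?D n * (?b n * ?G $ 1 $ 2 + ?a (Suc n) * ?G $ 2 $ 2)"
          using False by (simp add: T_def X_def q Gt_b_entries distrib_left mult_ac)
        ultimately show ?thesis unfolding ts Y p sc(2) using sc(1) by simp
      qed
      then show "X n * T (Suc n) $ 1 $ 1 + q (Suc n) * T (Suc n) $ 2 $ 1 = Y n"
        "X n * T (Suc n) $ 1 $ 2 + q (Suc n) * T (Suc n) $ 2 $ 2 = p (Suc n)" by blast+
    qed
  qed (use k in simp)
  have "cmod (q n) = cmod (u n)"
  proof (cases "app n")
    case False
    then have "u n = ?D n * ?b n" using u[of n] by (simp add: app_def)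
    then show ?thesis using False \<alpha> z
      by (simp add: q_def Y_def norm_mult cmod_sg cmod_zeta_a ab)
  qed (simp add: q_def)
  then show ?thesis using sum k unfolding u_def v_def by auto
qed

text \<open>
  The partial sums of column \<^term>\<open>k\<close> leave one amplitude of the chain, which has the modulus of
  \<open>u\<^sub>n\<close>; the factor 2 bounds \<open>\<bar>1 - cnj \<alpha>\<^sub>n z\<bar>\<close>.
\<close>

lemma column_residual:
  assumes z: "cmod z = 1" and k: "k < n"
  shows "cmod (\<Sum>j<n. \<phi> j z * (z * (mone \<oplus> madj (Amat \<alpha>) \<odot> hat \<alpha> G) j k - (hat \<alpha> G \<oplus> Amat \<alpha>) j k))
    \<le> cmod (of_real (2 * cmod (zigzag app T n n k) / defect \<alpha> n) * \<phi> n z)"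
proof -
  let ?s = "\<lambda>j. complex_of_real (defect \<alpha> j)" and ?G = "zigzag_limit app T"
  have s: "?s j \<noteq> 0" for j using defect_positive[OF \<alpha>, of j] by simp
  obtain q where q: "cmod q = cmod (wave_a \<alpha> \<phi> n z)"
    and eq: "(z - \<alpha> k) * \<phi> k z / ?s k = (\<Sum>j<n. wave_a \<alpha> \<phi> j z * zigzag app T n j k) + q * zigzag app T n n k"
    using orf_scattering[OF z k] by blast
  have "(\<Sum>j<n. \<phi> j z * (z * (mone \<oplus> madj (Amat \<alpha>) \<odot> hat \<alpha> ?G) j k - (hat \<alpha> ?G \<oplus> Amat \<alpha>) j k))
      = (\<Sum>j<n. (if j = k then (z - \<alpha> k) * \<phi> k z else 0) - ?s k * (wave_a \<alpha> \<phi> j z * zigzag app T n j k))"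
  proof (rule sum.cong[OF refl])
    fix j assume "j \<in> {..<n}"
    then have "?G j k = zigzag app T n j k" using k by (intro zigzag_limit_eq) auto
    then have "wave_a \<alpha> \<phi> j z * zigzag app T n j k * ?s k = (1 - cnj (\<alpha> j) * z) * \<phi> j z * hat \<alpha> ?G j k"
      by (simp add: wave_a_def hat_apply)
    then show "\<phi> j z * (z * (mone \<oplus> madj (Amat \<alpha>) \<odot> hat \<alpha> ?G) j k - (hat \<alpha> ?G \<oplus> Amat \<alpha>) j k)
      = (if j = k then (z - \<alpha> k) * \<phi> k z else 0) - ?s k * (wave_a \<alpha> \<phi> j z * zigzag app T n j k)"
      unfolding shifted_apply by (simp add: mone_apply madd_def Amat_def mdiag_def algebra_simps)
  qed
  also have "\<dots> = (z - \<alpha> k) * \<phi> k z - ?s k * (\<Sum>j<n. wave_a \<alpha> \<phi> j z * zigzag app T n j k)"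
    using k by (simp add: sum_subtractf sum_distrib_left)
  also have "(z - \<alpha> k) * \<phi> k z = ?s k * ((z - \<alpha> k) * \<phi> k z / ?s k)" using s by simp
  also have "?s k * ((z - \<alpha> k) * \<phi> k z / ?s k) - ?s k * (\<Sum>j<n. wave_a \<alpha> \<phi> j z * zigzag app T n j k)
      = ?s k * (q * zigzag app T n n k)"
    unfolding eq by (simp add: algebra_simps)
  finally have sum: "(\<Sum>j<n. \<phi> j z * (z * (mone \<oplus> madj (Amat \<alpha>) \<odot> hat \<alpha> ?G) j k - (hat \<alpha> ?G \<oplus> Amat \<alpha>) j k))
      = ?s k * (q * zigzag app T n n k)" .
  have "cmod (1 - cnj (\<alpha> n) * z) \<le> 2"
  proof -
    have "cmod (1 - cnj (\<alpha> n) * z) \<le> cmod 1 + cmod (cnj (\<alpha> n) * z)" by (rule norm_triangle_ineq4)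
    also have "\<dots> \<le> 2" using \<alpha> z by (simp add: norm_mult less_imp_le)
    finally show ?thesis .
  qed
  then have "cmod q \<le> 2 * cmod (\<phi> n z) / defect \<alpha> n"
    unfolding q using defect_positive[OF \<alpha>, of n]
    by (simp add: wave_a_def norm_mult norm_divide divide_right_mono mult_right_mono)
  then have "cmod q * cmod (zigzag app T n n k) \<le> 2 * cmod (\<phi> n z) / defect \<alpha> n * cmod (zigzag app T n n k)"
    by (rule mult_right_mono) simp
  moreover have "defect \<alpha> k * (cmod q * cmod (zigzag app T n n k)) \<le> 1 * (cmod q * cmod (zigzag app T n n k))"
    by (rule mult_right_mono[OF defect_le_1]) simp
  ultimately have "defect \<alpha> k * (cmod q * cmod (zigzag app T n n k))
      \<le> 2 * cmod (zigzag app T n n k) / defect \<alpha> n * cmod (\<phi> n z)"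
    by (simp add: mult_ac)
  then show ?thesis
    unfolding sum norm_mult norm_of_real
    using defect_positive[OF \<alpha>, of n] defect_positive[OF \<alpha>, of k] by simp
qed

text \<open>
  Column \<open>k\<close> of \<open>z \<Phi> (I + A\<^sup>* hat G) = \<Phi> (hat G + A)\<close>.  If \<open>\<alpha>\<close> occurs infinitely often, the column of
  \<open>G\<close> is finite and the residual vanishes eventually.  In an infinite block of \<open>\<beta>\<close>'s the residual
  after \<open>n\<close> terms is of the order of \<open>p\<^sub>n / s\<^sub>n\<close>, with \<open>p\<^sub>n\<close> the entry of the partial product in row
  \<open>n\<close>, and \<open>s\<^sub>n = \<surd>(1 - \<bar>\<alpha>\<^sub>n\<bar>\<^sup>2)\<close> need not be bounded below.  Since \<open>hat G\<close> has square-summable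
  columns, \<open>p\<^sub>n / s\<^sub>n\<close> is nevertheless small infinitely often.
\<close>

lemma column_relation:
  assumes tail: "finite {n. app n} \<Longrightarrow> strong_mat_lim (zigzag app T) G"
    and M: "bounded_mat (mone \<oplus> madj (Amat \<alpha>) \<odot> hat \<alpha> G)"
    and h: "bounded_mat (hat \<alpha> G)" and H: "bounded_mat (hat \<alpha> G \<oplus> Amat \<alpha>)"
  shows "times_z \<mu> \<phi> (\<lambda>j. (mone \<oplus> madj (Amat \<alpha>) \<odot> hat \<alpha> G) j k) (\<lambda>j. (hat \<alpha> G \<oplus> Amat \<alpha>) j k)"
proof (rule times_z_subsequence[OF \<mu> \<phi>_circle_bounded \<phi>_orthonormal
      bounded_mat_column[OF M] bounded_mat_column[OF H]])
  fix e :: real and n0 :: nat assume e: "0 < e"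
  let ?F = "\<lambda>n z. \<Sum>j<n. \<phi> j z * (z * (mone \<oplus> madj (Amat \<alpha>) \<odot> hat \<alpha> G) j k - (hat \<alpha> G \<oplus> Amat \<alpha>) j k)"
  let ?Z = "zigzag app T" and ?s = "defect \<alpha>"
  have F: "mean_square \<mu> (?F n) \<le> (2 * cmod (?Z n n k) / ?s n)\<^sup>2" if "k < n" for n
  proof -
    have "mean_square \<mu> (?F n) \<le> mean_square \<mu> (\<lambda>z. of_real (2 * cmod (?Z n n k) / ?s n) * \<phi> n z)"
    proof (rule mean_square_mono[OF \<mu>])
      fix z :: complex assume z: "cmod z = 1"
      show "cmod (?F n z) \<le> cmod (of_real (2 * cmod (?Z n n k) / ?s n) * \<phi> n z)"
        by (rule column_residual[OF z that])
    qed (intro circle_bounded_intros \<phi>_circle_bounded)+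
    also have "\<dots> = (2 * cmod (?Z n n k) / ?s n)\<^sup>2 * mean_square \<mu> (\<phi> n)"
      unfolding mean_square_scale norm_of_real power2_abs ..
    also have "mean_square \<mu> (\<phi> n) = 1"
      using mean_square_ip[of \<mu> "\<phi> n"] by (simp add: \<phi>_orthonormal)
    finally show ?thesis by simp
  qed
  show "\<exists>n\<ge>n0. mean_square \<mu> (?F n) < e"
  proof (cases "finite {n. app n}")
    case False
    then obtain n1 where n1: "k < n1" "app n1"
      unfolding infinite_nat_iff_unbounded by blast
    let ?n = "Suc (max n0 n1)"
    have "?Z ?n ?n k = ?Z n1 ?n k" using n1 by (intro zigzag_column_constant) auto
    also have "\<dots> = 0" using n1 zigzag_outside[of n1 ?n k app T] by auto
    finally have "mean_square \<mu> (?F ?n) \<le> 0" using F[of ?n] n1 by simp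
    then show ?thesis using e by (intro exI[of _ ?n]) auto
  next
    case True
    have Gb: "bounded_mat G" by (rule zigzag_limit_bounded[OF isometric2_T])
    obtain n1 where n1: "\<And>n. n1 \<le> n \<Longrightarrow> \<not> app n"
      using True unfolding finite_nat_set_iff_bounded_le by (metis mem_Collect_eq not_less_eq_eq)
    define N where "N = Suc (max (max n0 n1) k)"
    have "\<exists>n\<ge>N. cmod (?Z n n k) < sqrt e / 2 * ?s n"
    proof (rule frequently_small_ratio[where g = "\<lambda>n. cmod (G n k)"])
      show "0 < ?s n" for n by (rule defect_positive[OF \<alpha>])
      show "(\<lambda>n. cmod (?Z n n k)) \<longlonglongrightarrow> 0"
        using strong_mat_lim_diagonal[OF tail[OF True] Gb] by (simp add: tendsto_norm_zero)
      have "summable (\<lambda>n. (1 / ?s k)\<^sup>2 * (cmod (hat \<alpha> G n k))\<^sup>2)"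
        by (intro summable_mult l2_summable bounded_mat_column h)
      moreover have "(1 / ?s k)\<^sup>2 * (cmod (hat \<alpha> G n k))\<^sup>2 = (cmod (G n k) / ?s n)\<^sup>2" for n
        using defect_positive[OF \<alpha>, of k]
        by (simp add: hat_apply norm_mult norm_divide power_divide power_mult_distrib)
      ultimately show "summable (\<lambda>n. (cmod (G n k) / ?s n)\<^sup>2)" by simp
      show "0 < sqrt e / 2" using e by simp
      fix n assume n: "N \<le> n"
      then have app: "\<not> app n" and kn: "k < n" using n1 by (auto simp: N_def)
      have Z0: "?Z n (Suc n) k = 0" using zigzag_outside[of n "Suc n" k app T] kn by simp
      have "G n k = ?Z (Suc n) n k" by (rule zigzag_limit_eq) (use kn in auto)
      then have 1: "G n k = T (Suc n) $ 1 $ 1 * ?Z n n k + T (Suc n) $ 1 $ 2 * 0"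
        using app Z0 by (simp add: embed2_left)
      have 2: "?Z (Suc n) (Suc n) k = T (Suc n) $ 2 $ 1 * ?Z n n k + T (Suc n) $ 2 $ 2 * 0"
        using app Z0 by (simp add: embed2_left)
      have "(cmod (G n k))\<^sup>2 + (cmod (?Z (Suc n) (Suc n) k))\<^sup>2 = (cmod (?Z n n k))\<^sup>2 + (cmod 0)\<^sup>2"
        unfolding 1 2 using isometric2_T[of "Suc n"] unfolding isometric2_def by (metis le_add1 plus_1_eq_Suc)
      then show "(cmod (?Z n n k))\<^sup>2 = (cmod (G n k))\<^sup>2 + (cmod (?Z (Suc n) (Suc n) k))\<^sup>2" by simp
    qed simp
    then obtain n where n: "N \<le> n" "cmod (?Z n n k) < sqrt e / 2 * ?s n" by blast
    then have "2 * cmod (?Z n n k) / ?s n < sqrt e"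
      using defect_positive[OF \<alpha>, of n] by (simp add: pos_divide_less_eq)
    then have "(2 * cmod (?Z n n k) / ?s n)\<^sup>2 < (sqrt e)\<^sup>2"
      using defect_positive[OF \<alpha>, of n] by (intro power_strict_mono) auto
    also have "(sqrt e)\<^sup>2 = e" using e by simp
    finally have "(2 * cmod (?Z n n k) / ?s n)\<^sup>2 < e" .
    moreover have "n0 \<le> n" "k < n" using n(1) by (simp_all add: N_def)
    ultimately show ?thesis using F[of n] by (intro exI[of _ n]) linarith
  qed
qed

lemma mult_by_z_zigzag_limit:
  assumes tail: "finite {n. app n} \<Longrightarrow> strong_mat_lim (zigzag app T) G"
    and N: "l2_inverse (mone \<oplus> madj (Amat \<alpha>) \<odot> hat \<alpha> G) N"
  shows "mult_by_z \<mu> \<phi> ((hat \<alpha> G \<oplus> Amat \<alpha>) \<odot> N)"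
proof (rule mult_by_z_if_times_z[OF \<mu> \<phi>_circle_bounded])
  fix k
  let ?M = "mone \<oplus> madj (Amat \<alpha>) \<odot> hat \<alpha> G" and ?H = "hat \<alpha> G \<oplus> Amat \<alpha>"
  have M: "bounded_mat ?M" and bN: "bounded_mat N" and MN: "?M \<odot> N = mone"
    using N by (auto simp: l2_inverse_def)
  have h: "bounded_mat (hat \<alpha> G)"
    by (rule hat_bounded[OF \<alpha> zigzag_limit_bounded[OF isometric2_T] M])
  have "bounded_mat (Amat \<alpha>)"
    unfolding Amat_def by (rule bounded_mat_mdiag) (use \<alpha> less_imp_le in blast)
  then have H: "bounded_mat ?H" by (rule bounded_mat_add[OF h])
  note col = column_relation[OF tail M h H]
  have "times_z \<mu> \<phi> (mvec ?M (\<lambda>j. N j k)) (mvec ?H (\<lambda>j. N j k))"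
    by (rule times_z_closed[OF \<mu> \<phi>_circle_bounded \<phi>_orthonormal M H bounded_mat_column[OF bN] col])
  moreover have "mvec ?M (\<lambda>j. N j k) = (\<lambda>j. mone j k)"
    using mmult_eq_mvec[of ?M N _ k] unfolding MN by auto
  moreover have "mvec ?H (\<lambda>j. N j k) = (\<lambda>j. (?H \<odot> N) j k)"
    using mmult_eq_mvec[of ?H N _ k] by auto
  ultimately show "times_z \<mu> \<phi> (\<lambda>j. mone j k) (\<lambda>j. (?H \<odot> N) j k)" by simp
qed

end

section \<open>The rotated basis\<close>

lemma conjugate_by_embed2:
  assumes n: "1 \<le> n" and \<tau>: "\<And>j. cmod (\<tau> j) = 1"
    and "S $ 1 $ 1 = cnj (\<tau> (n - 1)) * T $ 1 $ 1 * \<tau> (n - 1)" "S $ 1 $ 2 = cnj (\<tau> (n - 1)) * T $ 1 $ 2 * \<tau> n"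
    "S $ 2 $ 1 = cnj (\<tau> n) * T $ 2 $ 1 * \<tau> (n - 1)" "S $ 2 $ 2 = cnj (\<tau> n) * T $ 2 $ 2 * \<tau> n"
  shows "conjugate_by \<tau> (embed2 n T) = embed2 n S"
proof (intro ext)
  fix i j
  have "cnj (\<tau> i) * \<tau> i = 1" using unimodular_cnj_mult[OF \<tau>, of i] by (simp add: mult.commute)
  then show "conjugate_by \<tau> (embed2 n T) i j = embed2 n S i j"
    using n assms(3-) by (auto simp: conjugate_by_def embed2_def)
qed

text \<open>
  Passing from the factors \<open>G\<^sub>k\<close> to \<open>G\<^sub>k\<^sup>\<alpha>\<close> throughout is conjugation by the diagonal matrix of the
  factors by which the two orthonormal bases differ.
\<close>

lemma zigzag_Gt_a_conjugate_by:
  fixes lam eta :: "nat \<Rightarrow> complex"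
  assumes \<alpha>: "\<forall>j. cmod (\<alpha> j) < 1" and \<gamma>: "\<forall>j. \<gamma> j \<in> {Fin (\<alpha> j), beta \<alpha> j}"
  defines "\<tau> \<equiv> \<lambda>n. \<Prod>j\<in>idx_b \<alpha> \<gamma> n. sg \<alpha> j"
  defines "T \<equiv> \<lambda>n. if \<gamma> n = Fin (\<alpha> n) then Gt_a \<alpha> lam eta n else Gt_b \<alpha> lam eta n"
  shows "zigzag app (Gt_a \<alpha> lam eta) n = conjugate_by \<tau> (zigzag app T n)" and "\<And>n. cmod (\<tau> n) = 1"
proof -
  show \<tau>: "cmod (\<tau> n) = 1" for n
    by (simp add: \<tau>_def cmod_sg prod_norm[symmetric])
  have \<tau>\<tau>: "cnj (\<tau> n) * \<tau> n = 1" for n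
    using unimodular_cnj_mult[OF \<tau>, of n] by (simp add: mult.commute)
  have step: "conjugate_by \<tau> (embed2 (Suc n) (T (Suc n))) = embed2 (Suc n) (Gt_a \<alpha> lam eta (Suc n))" for n
  proof (rule conjugate_by_embed2[OF _ \<tau>])
    let ?s = "sg \<alpha> (Suc n)"
    have suc: "\<tau> (Suc n) = (if \<gamma> (Suc n) = Fin (\<alpha> (Suc n)) then \<tau> n else ?s * \<tau> n)"
    proof -
      have "Suc n \<notin> idx_b \<alpha> \<gamma> n" by (simp add: idx_b_def)
      then show ?thesis by (simp add: \<tau>_def idx_b_Suc[OF \<alpha> \<gamma>] finite_idx)
    qed
    have c1: "cnj (\<tau> n) * w * \<tau> n = w" for w
    proof -
      have "cnj (\<tau> n) * w * \<tau> n = (cnj (\<tau> n) * \<tau> n) * w" by (simp add: mult_ac)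
      then show ?thesis by (simp add: \<tau>\<tau>)
    qed
    have ss: "cnj ?s * ?s = 1" using unimodular_cnj_mult[OF cmod_sg] by (simp add: mult.commute)
    have c2: "cnj (\<tau> n) * (cnj ?s * w) * (?s * \<tau> n) = w" and c3: "cnj (?s * \<tau> n) * (w * ?s) * \<tau> n = w"
      and c4: "cnj (?s * \<tau> n) * w * (?s * \<tau> n) = w" for w
    proof -
      have "cnj (\<tau> n) * (cnj ?s * w) * (?s * \<tau> n) = (cnj (\<tau> n) * \<tau> n) * (cnj ?s * ?s) * w"
        "cnj (?s * \<tau> n) * (w * ?s) * \<tau> n = (cnj (\<tau> n) * \<tau> n) * (cnj ?s * ?s) * w"
        "cnj (?s * \<tau> n) * w * (?s * \<tau> n) = (cnj (\<tau> n) * \<tau> n) * (cnj ?s * ?s) * w"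
        by (simp_all add: mult_ac)
      then show "cnj (\<tau> n) * (cnj ?s * w) * (?s * \<tau> n) = w" "cnj (?s * \<tau> n) * (w * ?s) * \<tau> n = w"
        "cnj (?s * \<tau> n) * w * (?s * \<tau> n) = w"
        by (simp_all only: \<tau>\<tau> ss mult_1)
    qed
    show "Gt_a \<alpha> lam eta (Suc n) $ 1 $ 1 = cnj (\<tau> (Suc n - 1)) * T (Suc n) $ 1 $ 1 * \<tau> (Suc n - 1)"
      unfolding diff_Suc_1 c1 by (simp add: T_def Gt_b_entries)
    show "Gt_a \<alpha> lam eta (Suc n) $ 1 $ 2 = cnj (\<tau> (Suc n - 1)) * T (Suc n) $ 1 $ 2 * \<tau> (Suc n)"
      unfolding diff_Suc_1 suc T_def by (cases "\<gamma> (Suc n) = Fin (\<alpha> (Suc n))") (simp_all only: simp_thms if_True if_False Gt_b_entries c1 c2)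
    show "Gt_a \<alpha> lam eta (Suc n) $ 2 $ 1 = cnj (\<tau> (Suc n)) * T (Suc n) $ 2 $ 1 * \<tau> (Suc n - 1)"
      unfolding diff_Suc_1 suc T_def by (cases "\<gamma> (Suc n) = Fin (\<alpha> (Suc n))") (simp_all only: simp_thms if_True if_False Gt_b_entries c1 c3)
    show "Gt_a \<alpha> lam eta (Suc n) $ 2 $ 2 = cnj (\<tau> (Suc n)) * T (Suc n) $ 2 $ 2 * \<tau> (Suc n)"
      unfolding suc T_def by (cases "\<gamma> (Suc n) = Fin (\<alpha> (Suc n))") (simp_all only: simp_thms if_True if_False Gt_b_entries c1 c4)
  qed simp
  show "zigzag app (Gt_a \<alpha> lam eta) n = conjugate_by \<tau> (zigzag app T n)"
  proof (induction n)
    case 0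
    show ?case by (simp add: mone_def conjugate_by_mdiag[OF \<tau>])
  next
    case (Suc n)
    then show ?case by (simp add: conjugate_by_mmult[OF \<tau>] step)
  qed
qed

theorem theorem9p2:
  fixes \<alpha> lam eta :: "nat \<Rightarrow> complex"
    and \<gamma> :: "nat \<Rightarrow> riemann"
    and \<mu> :: "complex measure"
    and \<phi>\<alpha> \<phi> \<psi> :: "nat \<Rightarrow> complex \<Rightarrow> complex"
    and Ga Gb :: "nat \<Rightarrow> imat"
    and G G' N :: imat
  assumes "circle_probability \<mu>"
    and "\<alpha> 0 = 0" and "\<forall>j. cmod (\<alpha> j) < 1"
    and "\<forall>j. \<gamma> j \<in> {Fin (\<alpha> j), beta \<alpha> j}"
    and "orf_a \<alpha> \<mu> \<phi>\<alpha>" and "recurrence \<alpha> \<phi>\<alpha> lam eta"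
    and "orf_g \<alpha> \<gamma> \<mu> \<phi>"
    and "Ga = G_a \<alpha> lam eta" and "Gb = G_b \<alpha> lam eta"
    and "G = ordered_product \<alpha> \<gamma> (select \<alpha> \<gamma> Ga Gb)"
    and "finite {j. \<gamma> j = Fin (\<alpha> j)} \<longrightarrow>
           strong_mat_lim (partial_product \<alpha> \<gamma> (select \<alpha> \<gamma> Ga Gb)) G"
    and "l2_inverse (mone \<oplus> madj (Amat \<alpha>) \<odot> hat \<alpha> G) N"
    and "\<psi> = (\<lambda>n z. (\<Prod>j\<in>idx_b \<alpha> \<gamma> n. sg \<alpha> j) * \<phi> n z)"
    and "G' = ordered_product \<alpha> \<gamma> Ga"
  shows "mat_lim (partial_product \<alpha> \<gamma> (select \<alpha> \<gamma> Ga Gb)) G \<and>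
         mult_matrix_relations \<mu> \<alpha> \<phi> G N \<and>
         special_forms \<alpha> \<gamma> Ga Gb G \<and>
         mat_lim (partial_product \<alpha> \<gamma> Ga) G' \<and>
         (\<exists>N'. l2_inverse (mone \<oplus> madj (Amat \<alpha>) \<odot> hat \<alpha> G') N' \<and>
               mult_matrix_relations \<mu> \<alpha> \<psi> G' N') \<and>
         special_forms \<alpha> \<gamma> Ga Ga G'"
proof -
  note \<alpha> = assms(3) and \<gamma> = assms(4)
  interpret M: mixed_orf \<alpha> lam eta \<gamma> \<mu> \<phi>\<alpha> \<phi>
    using assms(1-7) by unfold_locales
  let ?S = "Gt_a \<alpha> lam eta" and ?E = "select \<alpha> \<gamma> Ga Gb"
  let ?\<tau> = "\<lambda>n. \<Prod>j\<in>idx_b \<alpha> \<gamma> n. sg \<alpha> j"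
  have Ga: "Ga n = embed2 n (?S n)" and Gb: "Gb n = embed2 n (Gt_b \<alpha> lam eta n)" for n
    by (simp_all add: assms(8,9) G_a_def G_b_def)
  have E: "?E n = embed2 n (M.T n)" for n by (simp add: select_def Ga Gb M.T_def)
  have Ps: "partial_product \<alpha> \<gamma> ?E = zigzag M.app M.T"
    using mprod_factor_order[of ?E M.T \<alpha> \<gamma>] E unfolding M.app_def[abs_def] by blast
  have Pa: "partial_product \<alpha> \<gamma> Ga = zigzag M.app ?S"
    using mprod_factor_order[of Ga ?S \<alpha> \<gamma>] Ga unfolding M.app_def[abs_def] by blast
  have G: "G = zigzag_limit M.app M.T"
    unfolding assms(10) M.app_def[abs_def] by (rule ordered_product_zigzag) (rule E)
  have G': "G' = zigzag_limit M.app ?S"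
    unfolding assms(14) M.app_def[abs_def] by (rule ordered_product_zigzag) (rule Ga)
  have sel: "select \<alpha> \<gamma> Ga Ga = Ga" by (rule ext) (simp add: select_def)
  have conj: "G' = conjugate_by ?\<tau> G"
    unfolding G G' zigzag_limit_def
    by (intro ext) (simp only: zigzag_Gt_a_conjugate_by(1)[OF \<alpha> \<gamma>] conjugate_by_def M.T_def[abs_def])
  have tail: "strong_mat_lim (zigzag M.app M.T) (zigzag_limit M.app M.T)" if "finite {n. M.app n}"
  proof -
    have "finite {j. \<gamma> j = Fin (\<alpha> j)}" by (rule finite_subset[OF _ that]) (auto simp: M.app_def)
    then show ?thesis using assms(11) unfolding Ps G by blast
  qed
  have z: "mult_by_z \<mu> \<phi> ((hat \<alpha> G \<oplus> Amat \<alpha>) \<odot> N)"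
    using M.mult_by_z_zigzag_limit[OF tail] assms(12) unfolding G by blast
  have "mult_matrix_relations \<mu> \<alpha> \<phi> G N"
    unfolding mult_matrix_relations_def using z hat_inverse_transfer[OF \<alpha> assms(12)] by blast
  moreover have "special_forms \<alpha> \<gamma> Ga Gb G"
    unfolding assms(10) using \<alpha> Ga Gb by (rule special_forms_ordered_product)
  moreover have "special_forms \<alpha> \<gamma> Ga Ga G'"
    using special_forms_ordered_product[OF \<alpha> Ga Ga, of \<gamma>] unfolding assms(14) sel .
  moreover have "mat_lim (partial_product \<alpha> \<gamma> ?E) G" "mat_lim (partial_product \<alpha> \<gamma> Ga) G'"
    unfolding Ps Pa G G' by (rule mat_lim_zigzag)+
  moreover have "\<exists>N'. l2_inverse (mone \<oplus> madj (Amat \<alpha>) \<odot> hat \<alpha> G') N' \<and>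
               mult_matrix_relations \<mu> \<alpha> \<psi> G' N'"
    unfolding conj assms(13)
  proof (intro exI conjI)
    have \<tau>: "cmod (?\<tau> n) = 1" for n by (rule zigzag_Gt_a_conjugate_by(2)[OF \<alpha> \<gamma>])
    show "l2_inverse (mone \<oplus> madj (Amat \<alpha>) \<odot> hat \<alpha> (conjugate_by ?\<tau> G)) (conjugate_by ?\<tau> N)"
      and "mult_matrix_relations \<mu> \<alpha> (\<lambda>n z. ?\<tau> n * \<phi> n z) (conjugate_by ?\<tau> G) (conjugate_by ?\<tau> N)"
      by (rule mult_matrix_relations_conjugate_by[OF \<alpha> \<tau> assms(12) z])+
  qed
  ultimately show ?thesis by blast
qed

end
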